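(* Fix $s\ge 2$, $M>0$ and $\alpha\in(0,1)$. Let $\boldsymbol\gamma\in\mathbb R^n$ with $\|\boldsymbol\gamma\|_\infty\le M$, suppose that $\lambda_{n,s}\xrightarrow{D}\mathcal N(0,1)$ as $n\to\infty$ under $H_0:\boldsymbol\beta_s=\boldsymbol\gamma$, and let $\boldsymbol\gamma'\in\mathbb R^n$, $\boldsymbol\gamma'\ne\boldsymbol\gamma$, be such that $\|\boldsymbol\gamma-\boldsymbol\gamma'\|_2=O(1)$. Then the asymptotic power at $H_1:\boldsymbol\beta_s=\boldsymbol\gamma'$ of the test $\phi_{n,s}=\mathbf 1\{|\lambda_{n,s}|>z_{\alpha/2}\}$ satisfies $$\lim_{n\to\infty}\mathbb E_{\boldsymbol\gamma'}[\phi_{n,s}]=\begin{cases}\alpha&\text{if }\|\boldsymbol\gamma'-\boldsymbol\gamma\|_2\ll n^{-\frac{2s-3}{4}},\\ 1&\text{if }\|\boldsymbol\gamma'-\boldsymbol\gamma\|_2\gg n^{-\frac{2s-3}{4}}.\end{cases}$$ Moreover, if $n^{\frac{2s-3}{4}}\|\boldsymbol\gamma'-\boldsymbol\gamma\|_2\to\tau\in(0,\infty)$, then there exists $\eta\in(0,\infty)$ depending on $\tau$ such that $$\eta=\lim_{n\to\infty}\frac{(\boldsymbol\gamma'-\boldsymbol\gamma)^\top\mathrm{Cov}_{\boldsymbol\gamma}[\boldsymbol d_s](\boldsymbol\gamma'-\boldsymbol\gamma)}{\sqrt n},$$ where the limit always exists along a subsequence, and (along that subsequence) $$\lim_{n\to\infty}\mathbb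 E_{\boldsymbol\gamma'}[\phi_{n,s}]=\mathbb P\left(\left|\mathcal N\left(-\tfrac{\eta}{\sqrt2},1\right)\right|>z_{\alpha/2}\right).$$
   Context: $[n]=\{1,\ldots,n\}$ and $\binom{[n]}{s}$ is the collection of $s$-element subsets of $[n]$. The size-$s$ hyperedges of the random hypergraph $H_n$ on $[n]$ follow the hypergraph $\boldsymbol\beta$-model with parameter $\boldsymbol\beta_s=(\beta_{s,v})_{v\in[n]}\in\mathbb R^n$: each $\{v_1,\ldots,v_s\}\in\binom{[n]}{s}$ is a hyperedge independently with probability $\frac{e^{\beta_{s,v_1}+\cdots+\beta_{s,v_s}}}{1+e^{\beta_{s,v_1}+\cdots+\beta_{s,v_s}}}$. $\mathbb E_{\boldsymbol\kappa},\mathrm{Cov}_{\boldsymbol\kappa}$ refer to $\boldsymbol\beta_s=\boldsymbol\kappa$. $d_s(v)$ is the number of size-$s$ hyperedges containing $v$ and $\boldsymbol d_s=(d_s(1),\ldots,d_s(n))^\top$. The negative log-likelihood is $\ell_{n,s}(\boldsymbol\beta)=\sum_{\{v_1,\ldots,v_s\}\in\binom{[n]}{s}}\log(1+e^{\beta_{v_1}+\cdots+\beta_{v_s}})-\sum_{v=1}^n\beta_v d_s(v)$; $\hat{\boldsymbol\beta}_s$ is its minimizer over $\mathbb R^n$ (ML estimate; exists and is unique with probability $1-o(1)$, defined arbitrarily otherwise); $\log\Lambda_{n,s}=\ell_{n,s}(\boldsymbol\gamma)-\ell_{n,s}(\hat{\boldsymbol\beta}_s)$ and $\lambda_{n,s}=\frac{2\log\Lambda_{n,s}-n}{\sqrt{2n}}$.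 $z_{\alpha/2}$ is the $(1-\alpha/2)$-quantile of the standard normal distribution. $a_n\ll b_n$ means $a_n/b_n\to0$; $a_n\gg b_n$ means $a_n/b_n\to\infty$. $\boldsymbol\gamma,\boldsymbol\gamma'$ may depend on $n$. *)

theory Defs
  imports "HOL-Probability.Probability" "HOL-Probability.Product_PMF"
begin

text \<open>
  A vector in \<open>\<real>^n\<close> is a function in \<open>extensional {1..n}\<close>, so that equality of vectors and
  uniqueness of minimizers only concern the coordinates in \<open>{1..n}\<close>.  The size-\<open>s\<close> layer of a
  hypergraph on \<open>{1..n}\<close> is the set of its size-\<open>s\<close> hyperedges.
\<close>

definition vecs :: "nat \<Rightarrow> (nat \<Rightarrow> real) set" where
  "vecs n = extensional {1..n}"

definition ssubsets :: "nat \<Rightarrow> nat \<Rightarrow> nat set set" where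
  "ssubsets n s = {e. e \<subseteq> {1..n} \<and> card e = s}"

definition edge_prob :: "(nat \<Rightarrow> real) \<Rightarrow> nat set \<Rightarrow> real" where
  "edge_prob \<beta> e = exp (\<Sum>v\<in>e. \<beta> v) / (1 + exp (\<Sum>v\<in>e. \<beta> v))"

definition beta_model :: "nat \<Rightarrow> nat \<Rightarrow> (nat \<Rightarrow> real) \<Rightarrow> nat set set pmf" where
  "beta_model n s \<beta> =
     map_pmf (\<lambda>X. {e \<in> ssubsets n s. X e})
       (Pi_pmf (ssubsets n s) False (\<lambda>e. bernoulli_pmf (edge_prob \<beta> e)))"

definition sdegree :: "nat set set \<Rightarrow> nat \<Rightarrow> nat" where
  "sdegree H v = card {e \<in> H. v \<in> e}"

definition neg_log_lik :: "nat \<Rightarrow> nat \<Rightarrow> nat set set \<Rightarrow> (nat \<Rightarrow> real) \<Rightarrow> real" where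
  "neg_log_lik n s H \<beta> =
     (\<Sum>e\<in>ssubsets n s. ln (1 + exp (\<Sum>v\<in>e. \<beta> v))) - (\<Sum>v=1..n. \<beta> v * real (sdegree H v))"

definition is_mle :: "nat \<Rightarrow> nat \<Rightarrow> nat set set \<Rightarrow> (nat \<Rightarrow> real) \<Rightarrow> bool" where
  "is_mle n s H \<beta> \<longleftrightarrow> is_arg_min (neg_log_lik n s H) (\<lambda>\<beta>. \<beta> \<in> vecs n) \<beta>"

text \<open>
  The estimator is the minimizer whenever that exists and is unique; its value at any other
  hypergraph is unconstrained.
\<close>

definition mle_estimator :: "nat \<Rightarrow> nat \<Rightarrow> (nat set set \<Rightarrow> nat \<Rightarrow> real) \<Rightarrow> bool" where
  "mle_estimator n s bhat \<longleftrightarrow>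
     (\<forall>H. H \<subseteq> ssubsets n s \<longrightarrow> (\<exists>!\<beta>. is_mle n s H \<beta>) \<longrightarrow> is_mle n s H (bhat H))"

definition log_LR ::
  "nat \<Rightarrow> nat \<Rightarrow> (nat \<Rightarrow> real) \<Rightarrow> (nat set set \<Rightarrow> nat \<Rightarrow> real) \<Rightarrow> nat set set \<Rightarrow> real" where
  "log_LR n s \<gamma> bhat H = neg_log_lik n s H \<gamma> - neg_log_lik n s H (bhat H)"

definition LR_stat ::
  "nat \<Rightarrow> nat \<Rightarrow> (nat \<Rightarrow> real) \<Rightarrow> (nat set set \<Rightarrow> nat \<Rightarrow> real) \<Rightarrow> nat set set \<Rightarrow> real" where
  "LR_stat n s \<gamma> bhat H = (2 * log_LR n s \<gamma> bhat H - real n) / sqrt (2 * real n)"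

definition std_normal_quantile :: "real \<Rightarrow> real" where
  "std_normal_quantile p = Inf {x. p \<le> cdf std_normal_distribution x}"

definition LR_test ::
  "nat \<Rightarrow> nat \<Rightarrow> real \<Rightarrow> (nat \<Rightarrow> real) \<Rightarrow> (nat set set \<Rightarrow> nat \<Rightarrow> real) \<Rightarrow> nat set set \<Rightarrow> real" where
  "LR_test n s \<alpha> \<gamma> bhat H =
     (if \<bar>LR_stat n s \<gamma> bhat H\<bar> > std_normal_quantile (1 - \<alpha> / 2) then 1 else 0)"

definition LR_power ::
  "nat \<Rightarrow> nat \<Rightarrow> real \<Rightarrow> (nat \<Rightarrow> real) \<Rightarrow> (nat set set \<Rightarrow> nat \<Rightarrow> real) \<Rightarrow> (nat \<Rightarrow> real) \<Rightarrow> real" where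
  "LR_power n s \<alpha> \<gamma> bhat \<gamma>' =
     measure_pmf.expectation (beta_model n s \<gamma>') (LR_test n s \<alpha> \<gamma> bhat)"

definition covariance_pmf :: "'a pmf \<Rightarrow> ('a \<Rightarrow> real) \<Rightarrow> ('a \<Rightarrow> real) \<Rightarrow> real" where
  "covariance_pmf p X Y =
     measure_pmf.expectation p
       (\<lambda>\<omega>. (X \<omega> - measure_pmf.expectation p X) * (Y \<omega> - measure_pmf.expectation p Y))"

definition degree_cov :: "nat \<Rightarrow> nat \<Rightarrow> (nat \<Rightarrow> real) \<Rightarrow> nat \<Rightarrow> nat \<Rightarrow> real" where
  "degree_cov n s \<beta> u v =
     covariance_pmf (beta_model n s \<beta>) (\<lambda>H. real (sdegree H u)) (\<lambda>H. real (sdegree H v))"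

definition l2_dist :: "nat \<Rightarrow> (nat \<Rightarrow> real) \<Rightarrow> (nat \<Rightarrow> real) \<Rightarrow> real" where
  "l2_dist n x y = L2_set (\<lambda>v. x v - y v) {1..n}"

definition degree_cov_form ::
  "nat \<Rightarrow> nat \<Rightarrow> (nat \<Rightarrow> real) \<Rightarrow> (nat \<Rightarrow> real) \<Rightarrow> real" where
  "degree_cov_form n s \<beta> x = (\<Sum>u=1..n. \<Sum>v=1..n. x u * degree_cov n s \<beta> u v * x v)"

end

theory Submission
  imports Defs
begin

text \<open>
  The weak limit is only assumed along \<open>\<gamma>\<close>, and the laws under \<open>\<gamma>\<close> and \<open>\<gamma>'\<close> are not contiguous at
  the critical rate, so the limit has to be carried over to \<open>\<gamma>'\<close>.  Couple the two hypergraphs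
  edge by edge so that an edge differs with probability at most \<open>\<bar>\<Sum>v\<in>e. \<gamma>' v - \<gamma> v\<bar>\<close>.  By strong
  convexity, the drop of the negative log-likelihood from the true parameter to its minimum differs
  by a stochastically bounded amount from the drop after one diagonal Newton step, which is an
  explicit function of the centred edge indicators: half the sum of the normalised squared scores,
  a negligible degenerate quadratic form, and a remainder of third order.  Under the coupling,
  second moments of degenerate quadratic forms and fourth moments of linear forms show that the two
  explicit drops differ by \<open>O(n\<^bsup>1/4\<^esup>)\<close> as soon as \<open>\<parallel>\<gamma>' - \<gamma>\<parallel> = O(1)\<close>.  No central limit theorem is
  needed: up to \<open>o(1)\<close>, the statistic under \<open>\<gamma>'\<close> is the one under \<open>\<gamma>\<close> shifted by a deterministic
  Kullback--Leibler term, which tends to zero, to infinity, or to \<open>\<eta> / \<surd>2\<close> in the three regimes.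
\<close>

section \<open>The softplus function\<close>

text \<open>The statistic is normalised by \<open>sqrt (2 * n)\<close>, so an error of order n^(1/4)
  in the likelihood drop is harmless. At the critical distance the log-likelihood ratio of the two
  laws has mean of order sqrt n and deviations of order n^(1/4): it diverges, yet on the scale sqrt
  n only its mean survives. Write b for the number of hyperedges through a vertex, of order n^(s-1).
  Absolute bounds on two parts of the Newton drop are not o(sqrt n): the off-diagonal part of the
  squared scores, which carries the fluctuations of the statistic itself, and, for s = 2, the
  third-order remainder, where n * b edges contribute b^(-3/2) each. These two are compared under
  the coupling. The diagonal of the squared scores (mean exactly n, bounded fluctuation) and the
  effect of the off-diagonal Fisher information are bounded one layer at a time. The critical
  exponent comes from equating b * ||\<gamma>' - \<gamma>||^2, the order of the Kullback-Leibler
  term, with sqrt n.\<close>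

definition softplus :: "real \<Rightarrow> real" where
  "softplus x = ln (1 + exp x)"

definition sigmoid :: "real \<Rightarrow> real" where
  "sigmoid x = exp x / (1 + exp x)"

definition sigvar :: "real \<Rightarrow> real" where
  "sigvar x = sigmoid x * (1 - sigmoid x)"

lemma sigmoid_bounds: "0 < sigmoid x" "sigmoid x < 1"
  unfolding sigmoid_def by (auto simp: add_pos_pos divide_simps)

lemma sigvar_bounds: "0 < sigvar x" "sigvar x \<le> 1 / 4"
proof -
  show "0 < sigvar x" unfolding sigvar_def using sigmoid_bounds[of x] by simp
  have "0 \<le> (sigmoid x - 1 / 2)\<^sup>2" by simp
  then show "sigvar x \<le> 1 / 4" unfolding sigvar_def by (simp add: power2_eq_square algebra_simps)
qed

lemma has_real_derivative_softplus [derivative_intros]: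
  "(softplus has_real_derivative sigmoid x) (at x)"
  unfolding softplus_def[abs_def] sigmoid_def
  by (rule derivative_eq_intros refl | simp add: add_pos_pos divide_simps)+

lemma has_real_derivative_sigmoid [derivative_intros]:
  "(sigmoid has_real_derivative sigvar x) (at x)"
proof -
  have pos: "1 + exp x > 0" by (simp add: add_pos_pos)
  have "((\<lambda>x. exp x / (1 + exp x)) has_real_derivative
      (exp x * (1 + exp x) - exp x * exp x) / ((1 + exp x) * (1 + exp x))) (at x)"
    using pos by (auto intro!: derivative_eq_intros)
  moreover have "(exp x * (1 + exp x) - exp x * exp x) / ((1 + exp x) * (1 + exp x)) = sigvar x"
    using pos by (simp add: sigvar_def sigmoid_def field_simps)
  ultimately show ?thesis by (simp add: sigmoid_def[abs_def])
qed

text \<open>The \<open>m\<close>-th derivative of \<open>softplus\<close>, meaningful only for \<open>m \<le> 4\<close>.\<close>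

definition softplus_deriv :: "nat \<Rightarrow> real \<Rightarrow> real" where
  "softplus_deriv m x =
     (if m = 0 then softplus x else if m = 1 then sigmoid x else if m = 2 then sigvar x
      else if m = 3 then sigvar x * (1 - 2 * sigmoid x) else sigvar x * (1 - 6 * sigvar x))"

lemma has_real_derivative_sigvar [derivative_intros]:
  "(sigvar has_real_derivative softplus_deriv 3 x) (at x)"
  unfolding sigvar_def[abs_def] 
  by (rule derivative_eq_intros refl)+ (simp add: softplus_deriv_def sigvar_def algebra_simps)

lemma has_real_derivative_softplus_deriv:
  assumes "m < 4"
  shows "(softplus_deriv m has_real_derivative softplus_deriv (Suc m) x) (at x)"
proof -
  have s: "softplus_deriv 0 = softplus" "softplus_deriv 1 = sigmoid" "softplus_deriv 2 = sigvar"
    "softplus_deriv 3 = (\<lambda>x. sigvar x * (1 - 2 * sigmoid x))"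
    "softplus_deriv 4 = (\<lambda>x. sigvar x * (1 - 6 * sigvar x))"
    by (auto simp: softplus_deriv_def fun_eq_iff)
  have d3: "(softplus_deriv 3 has_real_derivative softplus_deriv 4 x) (at x)"
    unfolding s
    by (rule derivative_eq_intros refl)+
      (simp add: softplus_deriv_def sigvar_def power2_eq_square algebra_simps)
  consider "m = 0" | "m = 1" | "m = 2" | "m = 3" using assms by linarith
  then show ?thesis
    using d3 has_real_derivative_softplus[of x] has_real_derivative_sigmoid[of x]
      has_real_derivative_sigvar[of x] s
    by cases (auto simp: eval_nat_numeral)
qed

lemma softplus_deriv_bound:
  assumes "2 \<le> m" shows "\<bar>softplus_deriv m x\<bar> \<le> 1 / 4"
proof -
  note b = sigvar_bounds[of x] sigmoid_bounds[of x]
  have "\<bar>sigvar x * y\<bar> \<le> 1 / 4" if "\<bar>y\<bar> \<le> 1" for y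
    using mult_mono[of "\<bar>sigvar x\<bar>" "1/4" "\<bar>y\<bar>" 1] that b by (simp add: abs_mult)
  moreover have "\<bar>1 - 2 * sigmoid x\<bar> \<le> 1" "\<bar>1 - 6 * sigvar x\<bar> \<le> 1" using b by auto
  ultimately show ?thesis using assms b by (auto simp: softplus_deriv_def)
qed

text \<open>Taylor's theorem with an interior point excludes a zero increment, so
  \<open>t = 0\<close> is split off. The intermediate point is recorded only through its absolute
  value, which is all that a lower bound for \<open>sigvar\<close> on a symmetric interval
  consumes.\<close>

lemma softplus_deriv_taylor:
  assumes "k + j \<le> 4" "0 < j"
  shows "\<exists>z. \<bar>z\<bar> \<le> max \<bar>a\<bar> \<bar>a + t\<bar> \<and> softplus_deriv k (a + t)
    = (\<Sum>m<j. softplus_deriv (k + m) a / fact m * t ^ m) + softplus_deriv (k + j) z / fact j * t ^ j"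
proof (cases "t = 0")
  case True
  have "(\<Sum>m<j. softplus_deriv (k + m) a / fact m * 0 ^ m) = (\<Sum>m\<in>{0}. softplus_deriv (k + m) a / fact m * 0 ^ m)"
    using assms by (intro sum.mono_neutral_right) auto
  then show ?thesis using True assms by (intro exI[of _ a]) auto
next
  case False
  have "\<exists>z. (if a + t < a then a + t < z \<and> z < a else a < z \<and> z < a + t) \<and>
     softplus_deriv k (a + t) = (\<Sum>m<j. softplus_deriv (k + m) a / fact m * (a + t - a) ^ m)
      + softplus_deriv (k + j) z / fact j * (a + t - a) ^ j"
    by (rule Taylor[where diff = "\<lambda>m. softplus_deriv (k + m)" and a = "min a (a + t)" and b = "max a (a + t)"])
      (use assms False in \<open>auto intro: has_real_derivative_softplus_deriv\<close>)
  then obtain z where z: "if a + t < a then a + t < z \<and> z < a else a < z \<and> z < a + t"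
    "softplus_deriv k (a + t) = (\<Sum>m<j. softplus_deriv (k + m) a / fact m * t ^ m)
      + softplus_deriv (k + j) z / fact j * t ^ j" by auto
  have "\<bar>z\<bar> \<le> max \<bar>a\<bar> \<bar>a + t\<bar>" using z(1) by (auto split: if_splits)
  with z(2) show ?thesis by blast
qed

text \<open>From the second derivative on everything is bounded by 1/4, so the factorial is dropped
  and one constant, 1, serves all orders.\<close>

lemma softplus_deriv_taylor_bound:
  assumes "k + j \<le> 4" "0 < j" "2 \<le> k + j"
  shows "\<bar>softplus_deriv k (a + t) - (\<Sum>m<j. softplus_deriv (k + m) a / fact m * t ^ m)\<bar> \<le> \<bar>t\<bar> ^ j"
proof -
  obtain z where "softplus_deriv k (a + t) - (\<Sum>m<j. softplus_deriv (k + m) a / fact m * t ^ m)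
      = softplus_deriv (k + j) z / fact j * t ^ j"
    using softplus_deriv_taylor[OF assms(1,2), of a t] by (auto simp: algebra_simps)
  moreover have "\<bar>softplus_deriv (k + j) z / fact j\<bar> \<le> 1"
  proof -
    have "\<bar>softplus_deriv (k + j) z\<bar> / fact j \<le> \<bar>softplus_deriv (k + j) z\<bar> / 1"
      by (intro divide_left_mono) auto
    also have "\<dots> \<le> 1" using softplus_deriv_bound[OF assms(3), of z] by linarith
    finally show ?thesis by (simp add: abs_divide)
  qed
  then have "\<bar>softplus_deriv (k + j) z / fact j\<bar> * \<bar>t\<bar> ^ j \<le> 1 * \<bar>t\<bar> ^ j"
    by (intro mult_right_mono) auto
  ultimately show ?thesis by (simp add: abs_mult power_abs)
qed

lemma sigmoid_lipschitz: "\<bar>sigmoid a - sigmoid b\<bar> \<le> \<bar>a - b\<bar>"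
  using softplus_deriv_taylor_bound[of 1 1 b "a - b"] by (simp add: softplus_deriv_def)

lemma sigvar_lipschitz: "\<bar>sigvar a - sigvar b\<bar> \<le> \<bar>a - b\<bar>"
  using softplus_deriv_taylor_bound[of 2 1 b "a - b"] by (simp add: softplus_deriv_def)

lemma sigmoid_taylor2: "\<bar>sigmoid (a + t) - sigmoid a - sigvar a * t\<bar> \<le> t\<^sup>2"
  using softplus_deriv_taylor_bound[of 1 2 a t]
  by (simp add: softplus_deriv_def numeral_2_eq_2 algebra_simps) 

section \<open>Bregman divergence of softplus and its third-order remainder\<close>

definition softplus_breg :: "real \<Rightarrow> real \<Rightarrow> real" where
  "softplus_breg a t = softplus (a + t) - softplus a - sigmoid a * t"

definition softplus_rem :: "real \<Rightarrow> real \<Rightarrow> real" where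
  "softplus_rem a t = softplus_breg a t - sigvar a * t\<^sup>2 / 2"

text \<open>Since \<open>sigvar a = 1 / (2 + exp a + exp (- a))\<close>, replacing both exponentials
  by \<open>exp K\<close> gives a lower bound on \<open>[-K, K]\<close> that does not depend on the
  sign of \<open>a\<close>.\<close>

definition sigvar_min :: "real \<Rightarrow> real" where
  "sigvar_min K = 1 / (2 + 2 * exp K)"

lemma sigvar_min_pos: "0 < sigvar_min K"
  unfolding sigvar_min_def by (simp add: add_pos_pos)

lemma sigvar_ge_min:
  assumes "\<bar>a\<bar> \<le> K" shows "sigvar_min K \<le> sigvar a"
proof -
  have "exp a \<le> exp K" "exp (- a) \<le> exp K" using assms by auto
  then have "2 + exp a + exp (- a) \<le> 2 + 2 * exp K" by linarith
  moreover have "sigvar a = 1 / (2 + exp a + exp (- a))"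
  proof -
    have "exp a * exp (- a) = 1" by (simp add: exp_minus)
    moreover have "1 - sigmoid a = 1 / (1 + exp a)"
      unfolding sigmoid_def using add_pos_pos[of 1 "exp a"] by (simp add: divide_simps)
    ultimately have "sigvar a = exp a / ((1 + exp a) * (1 + exp a))"
      unfolding sigvar_def by (simp add: sigmoid_def)
    also have "(1 + exp a) * (1 + exp a) = exp a * (2 + exp a + exp (- a))"
      using \<open>exp a * exp (- a) = 1\<close> by (simp add: algebra_simps)
    finally show ?thesis by simp
  qed
  ultimately show ?thesis unfolding sigvar_min_def
    by (simp only:) (intro divide_left_mono, auto simp: add_pos_pos)
qed

lemma softplus_breg_taylor:
  "\<exists>z. \<bar>z\<bar> \<le> max \<bar>a\<bar> \<bar>a + t\<bar> \<and> softplus_breg a t = sigvar z / 2 * t\<^sup>2"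
  using softplus_deriv_taylor[of 0 2 a t]
  by (auto simp: softplus_deriv_def softplus_breg_def numeral_2_eq_2)

lemma softplus_breg_ge:
  assumes "\<bar>a\<bar> \<le> K" "\<bar>a + t\<bar> \<le> K"
  shows "sigvar_min K / 2 * t\<^sup>2 \<le> softplus_breg a t"
proof -
  obtain z where z: "\<bar>z\<bar> \<le> max \<bar>a\<bar> \<bar>a + t\<bar>" "softplus_breg a t = sigvar z / 2 * t\<^sup>2"
    using softplus_breg_taylor by blast
  have "sigvar_min K \<le> sigvar z" using z(1) assms by (intro sigvar_ge_min) auto
  then show ?thesis unfolding z(2) by (intro mult_right_mono) auto
qed

lemma softplus_breg_le: "softplus_breg a t \<le> t\<^sup>2"
proof -
  obtain z where z: "softplus_breg a t = sigvar z / 2 * t\<^sup>2"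
    using softplus_breg_taylor by blast
  have "sigvar z / 2 * t\<^sup>2 \<le> 1 * t\<^sup>2" using sigvar_bounds[of z] by (intro mult_right_mono) auto
  then show ?thesis unfolding z by simp
qed

lemma softplus_breg_nonneg: "0 \<le> softplus_breg a t"
proof -
  obtain z where z: "softplus_breg a t = sigvar z / 2 * t\<^sup>2"
    using softplus_breg_taylor by blast
  moreover have "0 \<le> sigvar z / 2 * t\<^sup>2" using sigvar_bounds(1)[of z] by (intro mult_nonneg_nonneg) auto
  ultimately show ?thesis by simp
qed

lemma softplus_breg_pos: "t \<noteq> 0 \<Longrightarrow> 0 < softplus_breg a t"
proof -
  obtain z where z: "softplus_breg a t = sigvar z / 2 * t\<^sup>2"
    using softplus_breg_taylor by blast
  have "0 < sigvar z / 2 * t\<^sup>2" if "t \<noteq> 0"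
    using sigvar_bounds(1)[of z] that by (intro mult_pos_pos) auto
  with z show "t \<noteq> 0 \<Longrightarrow> ?thesis" by simp
qed

lemma softplus_rem_bound: "\<bar>softplus_rem a t\<bar> \<le> \<bar>t\<bar> ^ 3"
  using softplus_deriv_taylor_bound[of 0 3 a t]
  by (simp add: softplus_deriv_def softplus_rem_def softplus_breg_def numeral_3_eq_3 power2_eq_square algebra_simps)

lemma abs_mvt:
  fixes f f' :: "real \<Rightarrow> real"
  assumes "\<And>x. (f has_real_derivative f' x) (at x)"
    and "\<And>x. min a b \<le> x \<Longrightarrow> x \<le> max a b \<Longrightarrow> \<bar>f' x\<bar> \<le> C"
  shows "\<bar>f a - f b\<bar> \<le> C * \<bar>a - b\<bar>"
  using field_differentiable_bound[of "{min a b..max a b}" f f' C a b] assms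
  by (auto intro: has_field_derivative_at_within)

text \<open>The derivative in the displacement is the second-order Taylor error of
  \<open>sigmoid\<close>, which is quadratic. Keeping the factor \<open>\<bar>t - t'\<bar>\<close>,
  instead of bounding the two remainders separately, is what the coupling exploits.\<close>

lemma softplus_rem_diff: "\<bar>softplus_rem a t - softplus_rem a t'\<bar> \<le> \<bar>t - t'\<bar> * (t\<^sup>2 + t'\<^sup>2)"
proof -
  have "\<bar>softplus_rem a t - softplus_rem a t'\<bar> \<le> (t\<^sup>2 + t'\<^sup>2) * \<bar>t - t'\<bar>"
  proof (rule abs_mvt)
    show "(softplus_rem a has_real_derivative sigmoid (a + x) - sigmoid a - sigvar a * x) (at x)" for x
      unfolding softplus_rem_def[abs_def] softplus_breg_def
      by (rule derivative_eq_intros DERIV_chain2[OF has_real_derivative_softplus] refl | simp)+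
    fix x assume x: "min t t' \<le> x" "x \<le> max t t'"
    then have "\<bar>x\<bar> \<le> \<bar>t\<bar> \<or> \<bar>x\<bar> \<le> \<bar>t'\<bar>" by auto
    then have "x\<^sup>2 \<le> t\<^sup>2 \<or> x\<^sup>2 \<le> t'\<^sup>2" by (simp add: abs_le_square_iff)
    then have "x\<^sup>2 \<le> t\<^sup>2 + t'\<^sup>2" by (smt (verit) zero_le_power2)
    then show "\<bar>sigmoid (a + x) - sigmoid a - sigvar a * x\<bar> \<le> t\<^sup>2 + t'\<^sup>2"
      using sigmoid_taylor2[of a x] by linarith
  qed
  then show ?thesis by (simp add: mult.commute)
qed

text \<open>The derivative in the base point is the third-order Taylor error of
  \<open>sigmoid\<close>, because the term produced by \<open>sigvar a * t\<^sup>2 / 2\<close> is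
  exactly its quadratic Taylor term.\<close>

lemma softplus_rem_base_diff: "\<bar>softplus_rem a t - softplus_rem b t\<bar> \<le> \<bar>a - b\<bar> * \<bar>t\<bar> ^ 3"
proof -
  have "\<bar>softplus_rem a t - softplus_rem b t\<bar> \<le> \<bar>t\<bar> ^ 3 * \<bar>a - b\<bar>"
  proof (rule abs_mvt)
    show "((\<lambda>a. softplus_rem a t) has_real_derivative
        sigmoid (x + t) - sigmoid x - sigvar x * t - softplus_deriv 3 x * t\<^sup>2 / 2) (at x)" for x
      unfolding softplus_rem_def[abs_def] softplus_breg_def
      by (rule derivative_eq_intros DERIV_chain2[OF has_real_derivative_softplus] refl | simp)+
    show "\<bar>sigmoid (x + t) - sigmoid x - sigvar x * t - softplus_deriv 3 x * t\<^sup>2 / 2\<bar> \<le> \<bar>t\<bar> ^ 3" for x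
      using softplus_deriv_taylor_bound[of 1 3 x t]
      by (simp add: softplus_deriv_def numeral_3_eq_3 numeral_2_eq_2 algebra_simps)
  qed
  then show ?thesis by (simp add: mult.commute)
qed

section \<open>Moments under finite product distributions\<close>

lemma integrable_Pi_pmf_finite [simp]:
  fixes f :: "_ \<Rightarrow> real"
  assumes "finite A" "\<And>x. x \<in> A \<Longrightarrow> finite (set_pmf (q x))"
  shows "integrable (measure_pmf (Pi_pmf A d q)) f"
  by (intro integrable_measure_pmf_finite) (use assms in \<open>auto simp: set_Pi_pmf\<close>)

text \<open>Fubini for one coordinate against the rest. The dependence on coordinate
  \<open>e\<close> is isolated in a separate argument of \<open>F\<close>, so that averaging over it
  can be stated without splitting the product space.\<close>

lemma expectation_Pi_pmf_resample:
  fixes F :: "'b \<Rightarrow> ('a \<Rightarrow> 'b) \<Rightarrow> real"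
  assumes "finite A" and "e \<in> A" and fin: "\<And>x. x \<in> A \<Longrightarrow> finite (set_pmf (q x))"
    and indep: "\<And>x \<omega> y. F x (fun_upd \<omega> e y) = F x \<omega>"
  shows "measure_pmf.expectation (Pi_pmf A d q) (\<lambda>\<omega>. F (\<omega> e) \<omega>) =
    measure_pmf.expectation (Pi_pmf A d q) (\<lambda>\<omega>. measure_pmf.expectation (q e) (\<lambda>x. F x \<omega>))"
proof -
  obtain A' where A: "A = insert e A'" "e \<notin> A'" "finite A'"
    using assms by (metis finite_insert mk_disjoint_insert)
  let ?P = "Pi_pmf A' d q"
  have ins: "Pi_pmf A d q = map_pmf (\<lambda>(x, f). f(e := x)) (pair_pmf (q e) ?P)"
    unfolding A(1) by (rule Pi_pmf_insert) (use A in auto)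
  have f: "finite (set_pmf (q e))" "finite (set_pmf ?P)"
    using A fin by (auto simp: set_Pi_pmf)
  have "measure_pmf.expectation (Pi_pmf A d q) (\<lambda>\<omega>. F (\<omega> e) \<omega>) =
      measure_pmf.expectation (pair_pmf (q e) ?P) (\<lambda>z. F (fst z) (snd z))"
    unfolding ins by (auto simp: case_prod_unfold indep)
  also have "\<dots> = (\<Sum>z\<in>set_pmf (q e) \<times> set_pmf ?P. pmf (pair_pmf (q e) ?P) z * F (fst z) (snd z))"
    using f by (subst integral_measure_pmf[of "set_pmf (q e) \<times> set_pmf ?P"]) auto
  also have "\<dots> = (\<Sum>(x, y)\<in>set_pmf (q e) \<times> set_pmf ?P. pmf ?P y * (pmf (q e) x * F x y))"
    by (intro sum.cong) (auto simp: pmf_pair)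
  also have "\<dots> = (\<Sum>y\<in>set_pmf ?P. \<Sum>x\<in>set_pmf (q e). pmf ?P y * (pmf (q e) x * F x y))"
    by (subst sum.swap) (simp add: sum.cartesian_product)
  also have "\<dots> = (\<Sum>y\<in>set_pmf ?P. pmf ?P y * measure_pmf.expectation (q e) (\<lambda>x. F x y))"
    using f by (subst integral_measure_pmf[of "set_pmf (q e)"]) (auto simp: sum_distrib_left)
  also have "\<dots> = measure_pmf.expectation ?P (\<lambda>y. measure_pmf.expectation (q e) (\<lambda>x. F x y))"
    using f by (subst integral_measure_pmf[where M = ?P and A = "set_pmf ?P"]) auto
  also have "\<dots> = measure_pmf.expectation (pair_pmf (q e) ?P)
      (\<lambda>z. measure_pmf.expectation (q e) (\<lambda>x. F x (snd z)))"
    by (rule expectation_pair_pmf_snd[symmetric])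
  also have "\<dots> = measure_pmf.expectation (Pi_pmf A d q) (\<lambda>\<omega>. measure_pmf.expectation (q e) (\<lambda>x. F x \<omega>))"
    unfolding ins by (auto simp: case_prod_unfold indep)
  finally show ?thesis .
qed

locale finite_product =
  fixes E :: "'e set" and d :: 'b and q :: "'e \<Rightarrow> 'b pmf"
  assumes finite_index: "finite E" and finite_factor: "\<And>e. e \<in> E \<Longrightarrow> finite (set_pmf (q e))"
begin

definition prodP :: "('e \<Rightarrow> 'b) pmf" where "prodP = Pi_pmf E d q"

abbreviation Ex :: "(('e \<Rightarrow> 'b) \<Rightarrow> real) \<Rightarrow> real" where
  "Ex \<equiv> measure_pmf.expectation prodP"

lemma integrable_prodP [simp]: "integrable (measure_pmf prodP) (f :: _ \<Rightarrow> real)"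
  unfolding prodP_def using finite_index finite_factor by (rule integrable_Pi_pmf_finite)

lemma integrable_factor [simp]: "e \<in> E \<Longrightarrow> integrable (measure_pmf (q e)) (f :: _ \<Rightarrow> real)"
  using finite_factor by (rule integrable_measure_pmf_finite)

lemma Ex_resample:
  assumes "e \<in> E" "\<And>x \<omega> y. F x (fun_upd \<omega> e y) = F x \<omega>"
  shows "Ex (\<lambda>\<omega>. F (\<omega> e) \<omega>) = Ex (\<lambda>\<omega>. measure_pmf.expectation (q e) (\<lambda>x. F x \<omega>))"
  unfolding prodP_def
  by (rule expectation_Pi_pmf_resample[OF finite_index assms(1) finite_factor assms(2)])

lemma Ex_split:
  assumes "e \<in> E" "\<And>\<omega> x. G (fun_upd \<omega> e x) = G \<omega>"
  shows "Ex (\<lambda>\<omega>. \<phi> (\<omega> e) * G \<omega>) = measure_pmf.expectation (q e) \<phi> * Ex G"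
  using Ex_resample[of e "\<lambda>x \<omega>. \<phi> x * G \<omega>"] assms by simp

lemma Ex_component: "e \<in> E \<Longrightarrow> Ex (\<lambda>\<omega>. \<phi> (\<omega> e)) = measure_pmf.expectation (q e) \<phi>"
  using Ex_split[of e "\<lambda>_. 1" \<phi>] by simp

lemma Ex_mono: "(\<And>\<omega>. f \<omega> \<le> g \<omega>) \<Longrightarrow> Ex f \<le> Ex g"
  by (rule integral_mono) auto

lemma Ex_nonneg: "(\<And>\<omega>. 0 \<le> f \<omega>) \<Longrightarrow> 0 \<le> Ex f"
  by (rule Bochner_Integration.integral_nonneg) auto

lemma Ex_abs_le: "Ex (\<lambda>\<omega>. \<bar>f \<omega>\<bar>) \<le> sqrt (Ex (\<lambda>\<omega>. (f \<omega>)\<^sup>2))"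
proof -
  have "0 \<le> Ex (\<lambda>\<omega>. (\<bar>f \<omega>\<bar> - Ex (\<lambda>\<omega>. \<bar>f \<omega>\<bar>))\<^sup>2)" by (rule Ex_nonneg) simp
  also have "\<dots> = Ex (\<lambda>\<omega>. (f \<omega>)\<^sup>2) - (Ex (\<lambda>\<omega>. \<bar>f \<omega>\<bar>))\<^sup>2"
    by (simp add: power2_diff power2_eq_square algebra_simps)
  finally show ?thesis by (intro real_le_rsqrt) simp
qed

lemma Markov_Ex:
  assumes "\<And>\<omega>. 0 \<le> f \<omega>" "0 < u"
  shows "measure_pmf.prob prodP {\<omega>. u < f \<omega>} \<le> Ex f / u"
proof -
  have "u * measure_pmf.prob prodP {\<omega>. u < f \<omega>} = Ex (\<lambda>\<omega>. u * indicator {\<omega>. u < f \<omega>} \<omega>)"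
    by simp
  also have "\<dots> \<le> Ex f" using assms by (intro Ex_mono) (auto simp: indicator_def)
  finally show ?thesis using assms by (simp add: field_simps)
qed

lemma second_moment_linear:
  assumes "I \<subseteq> E" and centered: "\<And>e. e \<in> I \<Longrightarrow> measure_pmf.expectation (q e) (\<zeta> e) = 0"
  shows "Ex (\<lambda>\<omega>. (\<Sum>e\<in>I. \<zeta> e (\<omega> e))\<^sup>2) = (\<Sum>e\<in>I. measure_pmf.expectation (q e) (\<lambda>x. (\<zeta> e x)\<^sup>2))"
proof -
  have "Ex (\<lambda>\<omega>. (\<Sum>e\<in>I. \<zeta> e (\<omega> e))\<^sup>2) = (\<Sum>e\<in>I. \<Sum>f\<in>I. Ex (\<lambda>\<omega>. \<zeta> e (\<omega> e) * \<zeta> f (\<omega> f)))"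
    by (simp add: power2_eq_square sum_product)
  also have "\<dots> = (\<Sum>e\<in>I. \<Sum>f\<in>I. if e = f then measure_pmf.expectation (q e) (\<lambda>x. (\<zeta> e x)\<^sup>2) else 0)"
  proof (intro sum.cong refl)
    fix e f assume ef: "e \<in> I" "f \<in> I"
    show "Ex (\<lambda>\<omega>. \<zeta> e (\<omega> e) * \<zeta> f (\<omega> f)) = (if e = f then measure_pmf.expectation (q e) (\<lambda>x. (\<zeta> e x)\<^sup>2) else 0)"
    proof (cases "e = f")
      case True then show ?thesis
        using ef assms(1) Ex_component[of e "\<lambda>x. (\<zeta> e x)\<^sup>2"] by (auto simp: power2_eq_square)
    next
      case False then show ?thesis
        using ef assms Ex_split[of e "\<lambda>\<omega>. \<zeta> f (\<omega> f)" "\<zeta> e"] by auto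
    qed
  qed
  also have "\<dots> = (\<Sum>e\<in>I. measure_pmf.expectation (q e) (\<lambda>x. (\<zeta> e x)\<^sup>2))"
    using finite_subset[OF assms(1) finite_index] by (simp add: sum.delta)
  finally show ?thesis .
qed

text \<open>Induction on the number of summands: in the binomial expansion the terms with the first
  power of the new variable or of the old sum vanish by independence and centring. The rest gives
  3m^2 + 6m + 1, which is at most 3(m + 1)^2.\<close>

lemma fourth_moment_linear:
  assumes "I \<subseteq> E" and centered: "\<And>e. e \<in> I \<Longrightarrow> measure_pmf.expectation (q e) (\<zeta> e) = 0"
    and bounded: "\<And>e x. e \<in> I \<Longrightarrow> \<bar>\<zeta> e x\<bar> \<le> 1"
  shows "Ex (\<lambda>\<omega>. (\<Sum>e\<in>I. \<zeta> e (\<omega> e)) ^ 4) \<le> 3 * real (card I) ^ 2"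
proof -
  have "finite I" using assms(1) finite_index by (rule finite_subset)
  then show ?thesis using assms
  proof (induction I rule: finite_induct)
    case empty then show ?case by simp
  next
    case (insert e I)
    let ?S = "\<lambda>\<omega>. \<Sum>e\<in>I. \<zeta> e (\<omega> e)" and ?E = "measure_pmf.expectation (q e)"
    have eE: "e \<in> E" using insert by auto
    have S: "?S (fun_upd \<omega> e x) = ?S \<omega>" for \<omega> x using insert by (intro sum.cong) auto
    have cross: "Ex (\<lambda>\<omega>. \<zeta> e (\<omega> e) ^ k * ?S \<omega> ^ l) = ?E (\<lambda>x. \<zeta> e x ^ k) * Ex (\<lambda>\<omega>. ?S \<omega> ^ l)" for k l
      by (rule Ex_split[OF eE]) (simp only: S)
    have m1: "?E (\<lambda>x. \<zeta> e x ^ k) \<le> 1" for k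
    proof -
      have "\<zeta> e x ^ k \<le> 1" for x
      proof -
        have "\<bar>\<zeta> e x\<bar> ^ k \<le> 1" using insert by (intro power_le_one) auto
        then show ?thesis by (metis abs_le_D1 power_abs)
      qed
      then have "?E (\<lambda>x. \<zeta> e x ^ k) \<le> ?E (\<lambda>x. 1)" using eE by (intro integral_mono) auto
      then show ?thesis by simp
    qed
    have S1: "Ex ?S = 0"
      using insert(5) insert.prems by (simp add: Ex_component subset_iff)
    have S2: "Ex (\<lambda>\<omega>. (?S \<omega>)\<^sup>2) \<le> card I"
    proof -
      have "Ex (\<lambda>\<omega>. (?S \<omega>)\<^sup>2) = (\<Sum>e\<in>I. measure_pmf.expectation (q e) (\<lambda>x. (\<zeta> e x)\<^sup>2))"
        using insert.prems by (intro second_moment_linear) auto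
      also have "\<dots> \<le> (\<Sum>e\<in>I. 1)"
      proof (rule sum_mono)
        fix f assume f: "f \<in> I"
        have "measure_pmf.expectation (q f) (\<lambda>x. (\<zeta> f x)\<^sup>2) \<le> measure_pmf.expectation (q f) (\<lambda>x. 1)"
          using f insert.prems by (intro integral_mono) (auto simp: abs_square_le_1)
        then show "measure_pmf.expectation (q f) (\<lambda>x. (\<zeta> f x)\<^sup>2) \<le> 1" by simp
      qed
      finally show ?thesis by simp
    qed
    have S2n: "0 \<le> Ex (\<lambda>\<omega>. (?S \<omega>)\<^sup>2)" by (rule Ex_nonneg) simp
    have z2n: "0 \<le> ?E (\<lambda>x. (\<zeta> e x)\<^sup>2)" by (rule Bochner_Integration.integral_nonneg) simp
    have "Ex (\<lambda>\<omega>. (\<Sum>e\<in>insert e I. \<zeta> e (\<omega> e)) ^ 4) = 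
      Ex (\<lambda>\<omega>. ?S \<omega> ^ 4 + 4 * (\<zeta> e (\<omega> e) ^ 1 * ?S \<omega> ^ 3) + 6 * (\<zeta> e (\<omega> e) ^ 2 * ?S \<omega> ^ 2)
        + 4 * (\<zeta> e (\<omega> e) ^ 3 * ?S \<omega> ^ 1) + \<zeta> e (\<omega> e) ^ 4 * ?S \<omega> ^ 0)"
    proof -
      have b4: "(a + b) ^ 4 = b ^ 4 + 4 * (a ^ 1 * b ^ 3) + 6 * (a ^ 2 * b ^ 2) + 4 * (a ^ 3 * b ^ 1) + a ^ 4 * b ^ 0"
        for a b :: real by (simp add: eval_nat_numeral algebra_simps)
      show ?thesis by (subst sum.insert[OF insert(1,2)]) (simp only: b4)
    qed
    also have "\<dots> = Ex (\<lambda>\<omega>. ?S \<omega> ^ 4) + 4 * Ex (\<lambda>\<omega>. \<zeta> e (\<omega> e) ^ 1 * ?S \<omega> ^ 3)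
       + 6 * Ex (\<lambda>\<omega>. \<zeta> e (\<omega> e) ^ 2 * ?S \<omega> ^ 2)
        + 4 * Ex (\<lambda>\<omega>. \<zeta> e (\<omega> e) ^ 3 * ?S \<omega> ^ 1) + Ex (\<lambda>\<omega>. \<zeta> e (\<omega> e) ^ 4 * ?S \<omega> ^ 0)"
      by simp
    also have "\<dots> = Ex (\<lambda>\<omega>. ?S \<omega> ^ 4) + 6 * (?E (\<lambda>x. (\<zeta> e x)\<^sup>2) * Ex (\<lambda>\<omega>. (?S \<omega>)\<^sup>2)) + ?E (\<lambda>x. \<zeta> e x ^ 4)"
      unfolding cross using S1 insert.prems(2)[of e] by simp
    also have "\<dots> \<le> 3 * real (card I) ^ 2 + 6 * (1 * card I) + 1"
      using insert.IH insert.prems m1[of 4] mult_mono[OF m1[of 2] S2] S2n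
      by (intro add_mono mult_left_mono) auto
    also have "\<dots> \<le> 3 * real (card (insert e I)) ^ 2"
      using insert by (simp add: power2_eq_square algebra_simps)
    finally show ?case .
  qed
qed

text \<open>An ordered pair correlates only with itself and with its swap: any other pair misses one
  of its two indices, and integrating that coordinate first gives zero. As \<open>u\<close> need not
  be symmetric, the swapped product is bounded by the mean of the two squares, which yields 3/2 +
  1/2 = 2.\<close>

lemma second_moment_chaos:
  fixes u :: "'e \<Rightarrow> 'e \<Rightarrow> 'b \<Rightarrow> 'b \<Rightarrow> real"
  assumes left: "\<And>e f y. e \<in> E \<Longrightarrow> f \<in> E \<Longrightarrow> measure_pmf.expectation (q e) (\<lambda>x. u e f x y) = 0"
    and right: "\<And>e f x. e \<in> E \<Longrightarrow> f \<in> E \<Longrightarrow> measure_pmf.expectation (q f) (\<lambda>y. u e f x y) = 0"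
  shows "Ex (\<lambda>\<omega>. (\<Sum>e\<in>E. \<Sum>f\<in>E - {e}. u e f (\<omega> e) (\<omega> f))\<^sup>2)
    \<le> 2 * (\<Sum>e\<in>E. \<Sum>f\<in>E - {e}. Ex (\<lambda>\<omega>. (u e f (\<omega> e) (\<omega> f))\<^sup>2))"
proof -
  define P where "P = Sigma E (\<lambda>e. E - {e})"
  define U where "U p \<omega> = u (fst p) (snd p) (\<omega> (fst p)) (\<omega> (snd p))" for p \<omega>
  have fin: "finite P" unfolding P_def using finite_index by auto
  have sum_P: "(\<Sum>e\<in>E. \<Sum>f\<in>E - {e}. g e f) = (\<Sum>p\<in>P. g (fst p) (snd p))" for g :: "'e \<Rightarrow> 'e \<Rightarrow> real"
    unfolding P_def using finite_index by (subst sum.Sigma) (auto simp: case_prod_unfold)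
  have swap: "prod.swap ` P = P" "inj_on prod.swap P" unfolding P_def by force+
  have zero: "Ex (\<lambda>\<omega>. U p \<omega> * U p' \<omega>) = 0" if "p \<in> P" "p' \<in> P" "p' \<noteq> p" "p' \<noteq> prod.swap p" for p p'
  proof -
    obtain e f where p: "p = (e, f)" by force
    obtain g h where p': "p' = (g, h)" by force
    have mem: "e \<in> E" "f \<in> E" "e \<noteq> f" "g \<in> E" "h \<in> E" "g \<noteq> h" using that p p' P_def by auto
    from that p p' mem consider "e \<noteq> g" "e \<noteq> h" | "f \<noteq> g" "f \<noteq> h" by auto
    then show ?thesis
    proof cases
      case 1
      have "U p \<omega> * U p' \<omega> = u e f (\<omega> e) (\<omega> f) * u g h (\<omega> g) (\<omega> h)" for \<omega>
        by (simp add: p p' U_def)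
      moreover have "Ex (\<lambda>\<omega>. u e f (\<omega> e) (\<omega> f) * u g h (\<omega> g) (\<omega> h)) = 0"
        using Ex_resample[of e "\<lambda>x \<omega>. u e f x (\<omega> f) * u g h (\<omega> g) (\<omega> h)"] 1 mem left by simp
      ultimately show ?thesis by simp
    next
      case 2
      have "U p \<omega> * U p' \<omega> = u e f (\<omega> e) (\<omega> f) * u g h (\<omega> g) (\<omega> h)" for \<omega>
        by (simp add: p p' U_def)
      moreover have "Ex (\<lambda>\<omega>. u e f (\<omega> e) (\<omega> f) * u g h (\<omega> g) (\<omega> h)) = 0"
        using Ex_resample[of f "\<lambda>y \<omega>. u e f (\<omega> e) y * u g h (\<omega> g) (\<omega> h)"] 2 mem right by simp
      ultimately show ?thesis by simp
    qed
  qed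
  have le: "Ex (\<lambda>\<omega>. U p \<omega> * U p' \<omega>) \<le> (Ex (\<lambda>\<omega>. (U p \<omega>)\<^sup>2) + Ex (\<lambda>\<omega>. (U p' \<omega>)\<^sup>2)) / 2" for p p'
  proof -
    have "Ex (\<lambda>\<omega>. U p \<omega> * U p' \<omega>) \<le> Ex (\<lambda>\<omega>. ((U p \<omega>)\<^sup>2 + (U p' \<omega>)\<^sup>2) / 2)"
    proof (intro Ex_mono)
      show "U p \<omega> * U p' \<omega> \<le> ((U p \<omega>)\<^sup>2 + (U p' \<omega>)\<^sup>2) / 2" for \<omega>
        using sum_squares_bound[of "U p \<omega>" "U p' \<omega>"] by simp
    qed
    then show ?thesis by simp
  qed
  have "Ex (\<lambda>\<omega>. (\<Sum>p\<in>P. U p \<omega>)\<^sup>2) = (\<Sum>p\<in>P. \<Sum>p'\<in>P. Ex (\<lambda>\<omega>. U p \<omega> * U p' \<omega>))"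
    by (simp add: power2_eq_square sum_product)
  also have "\<dots> = (\<Sum>p\<in>P. \<Sum>p'\<in>{p, prod.swap p}. Ex (\<lambda>\<omega>. U p \<omega> * U p' \<omega>))"
    using fin swap(1) zero by (intro sum.cong refl sum.mono_neutral_right) auto
  also have "\<dots> = (\<Sum>p\<in>P. Ex (\<lambda>\<omega>. (U p \<omega>)\<^sup>2) + Ex (\<lambda>\<omega>. U p \<omega> * U (prod.swap p) \<omega>))"
  proof (intro sum.cong refl)
    fix p assume "p \<in> P"
    then have "p \<noteq> prod.swap p" unfolding P_def by auto
    then show "(\<Sum>p'\<in>{p, prod.swap p}. Ex (\<lambda>\<omega>. U p \<omega> * U p' \<omega>)) = Ex (\<lambda>\<omega>. (U p \<omega>)\<^sup>2) + Ex (\<lambda>\<omega>. U p \<omega> * U (prod.swap p) \<omega>)"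
      by (simp add: power2_eq_square)
  qed
  also have "\<dots> \<le> (\<Sum>p\<in>P. Ex (\<lambda>\<omega>. (U p \<omega>)\<^sup>2) + (Ex (\<lambda>\<omega>. (U p \<omega>)\<^sup>2) + Ex (\<lambda>\<omega>. (U (prod.swap p) \<omega>)\<^sup>2)) / 2)"
    using le by (intro sum_mono add_left_mono)
  also have "\<dots> = 3 / 2 * (\<Sum>p\<in>P. Ex (\<lambda>\<omega>. (U p \<omega>)\<^sup>2)) + 1 / 2 * (\<Sum>p\<in>P. Ex (\<lambda>\<omega>. (U (prod.swap p) \<omega>)\<^sup>2))"
    by (simp add: sum.distrib add_divide_distrib sum_divide_distrib[symmetric] sum_distrib_left[symmetric])
  also have "(\<Sum>p\<in>P. Ex (\<lambda>\<omega>. (U (prod.swap p) \<omega>)\<^sup>2)) = (\<Sum>p\<in>P. Ex (\<lambda>\<omega>. (U p \<omega>)\<^sup>2))"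
    using sum.reindex[OF swap(2), of "\<lambda>p. Ex (\<lambda>\<omega>. (U p \<omega>)\<^sup>2)"] swap(1) by simp
  finally show ?thesis unfolding sum_P U_def by simp
qed

end

section \<open>Sums over hyperedges\<close>

definition star :: "nat \<Rightarrow> nat \<Rightarrow> nat \<Rightarrow> nat set set" where
  "star n s v = {e \<in> ssubsets n s. v \<in> e}"

text \<open>The common degree of all vertices in the complete hypergraph, which sets the scale of
  the score variances and Fisher informations. \<open>costard\<close> is the common codegree of two
  vertices, smaller by a factor of order 1/n.\<close>

definition stard :: "nat \<Rightarrow> nat \<Rightarrow> real" where
  "stard n s = real ((n - 1) choose (s - 1))"

definition costard :: "nat \<Rightarrow> nat \<Rightarrow> real" where
  "costard n s = real ((n - 2) choose (s - 2))"

lemma finite_ssubsets [simp]: "finite (ssubsets n s)"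
  unfolding ssubsets_def by simp

lemma finite_star [simp]: "finite (star n s v)"
  unfolding star_def by simp

lemma ssubsetsD: "e \<in> ssubsets n s \<Longrightarrow> finite e \<and> e \<subseteq> {1..n} \<and> card e = s"
  unfolding ssubsets_def using finite_subset by auto

lemma ssubsets_mem: "e \<in> ssubsets n s \<Longrightarrow> v \<in> e \<Longrightarrow> v \<in> {1..n}"
  unfolding ssubsets_def by auto

lemma starD: "e \<in> star n s v \<Longrightarrow> e \<in> ssubsets n s \<and> v \<in> e"
  unfolding star_def by auto

lemma card_supersets:
  assumes "T \<subseteq> {1..n}" "card T \<le> s"
  shows "card {e \<in> ssubsets n s. T \<subseteq> e} = (n - card T) choose (s - card T)"
proof -
  have fT: "finite T" using assms(1) finite_subset by blast
  have "bij_betw (\<lambda>e. e - T) {e \<in> ssubsets n s. T \<subseteq> e} {B. B \<subseteq> {1..n} - T \<and> card B = s - card T}"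
  proof (rule bij_betw_byWitness[where f' = "\<lambda>e. e \<union> T"])
    show "(\<lambda>e. e - T) ` {e \<in> ssubsets n s. T \<subseteq> e} \<subseteq> {B. B \<subseteq> {1..n} - T \<and> card B = s - card T}"
      using fT by (auto simp: ssubsets_def card_Diff_subset)
    show "(\<lambda>e. e \<union> T) ` {B. B \<subseteq> {1..n} - T \<and> card B = s - card T} \<subseteq> {e \<in> ssubsets n s. T \<subseteq> e}"
    proof safe
      fix B assume B: "B \<subseteq> {1..n} - T" "card B = s - card T"
      have "finite B" using B(1) finite_subset by (metis finite_Diff finite_atLeastAtMost)
      then have "card (B \<union> T) = card B + card T" using B fT by (intro card_Un_disjoint) auto
      then show "B \<union> T \<in> ssubsets n s" using B assms by (auto simp: ssubsets_def)
    qed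
  qed auto
  then have "card {e \<in> ssubsets n s. T \<subseteq> e} = card {B. B \<subseteq> {1..n} - T \<and> card B = s - card T}"
    by (rule bij_betw_same_card)
  also have "\<dots> = (n - card T) choose (s - card T)"
    using assms fT by (subst n_subsets) (auto simp: card_Diff_subset)
  finally show ?thesis .
qed

lemma card_star: "v \<in> {1..n} \<Longrightarrow> 1 \<le> s \<Longrightarrow> real (card (star n s v)) = stard n s"
  using card_supersets[of "{v}" n s] by (simp add: star_def stard_def)

lemma card_star2:
  "u \<in> {1..n} \<Longrightarrow> v \<in> {1..n} \<Longrightarrow> u \<noteq> v \<Longrightarrow> 2 \<le> s \<Longrightarrow>
    real (card {e \<in> ssubsets n s. u \<in> e \<and> v \<in> e}) = costard n s"
  using card_supersets[of "{u, v}" n s] by (simp add: costard_def numeral_2_eq_2)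

text \<open>Double counting of incident vertex-edge pairs: the passage from vertex sums, in which
  scores are defined, to edge sums, in which the randomness is independent.\<close>

lemma sum_star_swap:
  "(\<Sum>v=1..n. \<Sum>e\<in>star n s v. f v e) = (\<Sum>e\<in>ssubsets n s. \<Sum>v\<in>e. (f v e :: real))"
proof -
  have "(\<Sum>v=1..n. \<Sum>e\<in>star n s v. f v e) = (\<Sum>e\<in>ssubsets n s. \<Sum>v\<in>{v \<in> {1..n}. v \<in> e}. f v e)"
    unfolding star_def by (rule sum.swap_restrict) auto
  also have "\<dots> = (\<Sum>e\<in>ssubsets n s. \<Sum>v\<in>e. f v e)"
    by (intro sum.cong refl) (use ssubsets_mem in blast)
  finally show ?thesis .
qed

lemma sum_edges_eq:
  assumes "1 \<le> s"
  shows "(\<Sum>e\<in>ssubsets n s. \<Sum>v\<in>e. (g v :: real)) = stard n s * (\<Sum>v=1..n. g v)"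
  unfolding sum_star_swap[symmetric] sum_distrib_left
  by (intro sum.cong refl) (use assms in \<open>auto simp: card_star\<close>)

lemma card_ssubsets:
  assumes "1 \<le> s"
  shows "real s * real (card (ssubsets n s)) = real n * stard n s"
proof -
  have "(\<Sum>e\<in>ssubsets n s. \<Sum>v\<in>e. (1 :: real)) = (\<Sum>e\<in>ssubsets n s. real s)"
    by (intro sum.cong refl) (auto dest: ssubsetsD)
  then show ?thesis using sum_edges_eq[OF assms, of "\<lambda>_. 1" n] by (simp add: mult_ac)
qed

lemma stard_nonneg [simp]: "0 \<le> stard n s" and costard_nonneg [simp]: "0 \<le> costard n s"
  unfolding stard_def costard_def by auto

lemma costard_eq:
  assumes "2 \<le> s" "2 * s \<le> n"
  shows "real (n - 1) * costard n s = real (s - 1) * stard n s"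
proof -
  have "Suc (s - 2) * ((n - 1) choose Suc (s - 2)) = (n - 1) * ((n - 1 - 1) choose (s - 2))"
    by (rule binomial_absorption)
  moreover have "Suc (s - 2) = s - 1" "n - 1 - 1 = n - 2" using assms by auto
  ultimately show ?thesis unfolding stard_def costard_def by (metis of_nat_mult)
qed

lemma stard_pos: "2 \<le> s \<Longrightarrow> 2 * s \<le> n \<Longrightarrow> 0 < stard n s"
  unfolding stard_def by (simp add: zero_less_binomial_iff)

text \<open>The first bound makes the edge-sum form coercive; the second supplies the factor 1/n by
  which off-diagonal information is smaller than diagonal information.\<close>

lemma costard_le:
  assumes "2 \<le> s" "2 * s \<le> n"
  shows "costard n s \<le> stard n s / 2" "costard n s \<le> 2 * real s * stard n s / real n"
proof -
  have n: "0 < real (n - 1)" "real n \<le> 2 * real (n - 1)" "2 * real (s - 1) \<le> real (n - 1)" using assms by auto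
  have c: "costard n s = real (s - 1) * stard n s / real (n - 1)"
    using costard_eq[OF assms] n by (simp add: field_simps)
  have "real (s - 1) / real (n - 1) \<le> 1 / 2" using n by (simp add: field_simps)
  then have "real (s - 1) / real (n - 1) * stard n s \<le> 1 / 2 * stard n s" by (rule mult_right_mono) simp
  then show "costard n s \<le> stard n s / 2" unfolding c by simp
  have "real (s - 1) / real (n - 1) \<le> real s / (real n / 2)"
    using n assms by (intro frac_le) auto
  then have "real (s - 1) / real (n - 1) * stard n s \<le> real s / (real n / 2) * stard n s" by (rule mult_right_mono) simp
  then show "costard n s \<le> 2 * real s * stard n s / real n" unfolding c by (simp add: mult_ac)
qed

lemma choose_ge_self: "1 \<le> k \<Longrightarrow> k < m \<Longrightarrow> m \<le> m choose k"
proof (induction m arbitrary: k)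
  case (Suc m)
  then obtain j where j: "k = Suc j" by (cases k) auto
  show ?case
  proof (cases "Suc j < m")
    case True
    moreover have "1 \<le> m choose j" using True by (simp add: Suc_le_eq zero_less_binomial_iff)
    ultimately show ?thesis using Suc.IH[of "Suc j"] j by simp
  next
    case False
    with Suc.prems j have "Suc j = m" by simp
    then show ?thesis using j by simp
  qed
qed simp

text \<open>A binomial coefficient away from both ends is at least its upper argument. Graphs are
  the extreme case: for s = 2 the ratio of \<open>n\<close> to \<open>stard n s\<close> is bounded
  but does not tend to zero.\<close>

lemma n_le_stard:
  assumes "2 \<le> s" "2 * s \<le> n" shows "real n \<le> 2 * stard n s"
proof -
  have "n - 1 \<le> (n - 1) choose (s - 1)" using assms by (intro choose_ge_self) auto
  then have "real (n - 1) \<le> stard n s" unfolding stard_def by (simp only: of_nat_le_iff)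
  moreover have "real n \<le> 2 * real (n - 1)" using assms by auto
  ultimately show ?thesis by linarith
qed

lemma abs_sum_edge_le:
  fixes h :: "nat \<Rightarrow> real"
  assumes "e \<in> ssubsets n s" "\<And>v. v \<in> {1..n} \<Longrightarrow> \<bar>h v\<bar> \<le> C"
  shows "\<bar>sum h e\<bar> \<le> real s * C"
proof -
  have "\<bar>sum h e\<bar> \<le> (\<Sum>v\<in>e. \<bar>h v\<bar>)" by (rule sum_abs)
  also have "\<dots> \<le> (\<Sum>v\<in>e. C)" using assms ssubsets_mem by (intro sum_mono) blast
  finally show ?thesis using assms ssubsetsD by auto
qed

lemma edge_sum_square_le:
  assumes "e \<in> ssubsets n s"
  shows "(\<Sum>v\<in>e. h v :: real)\<^sup>2 \<le> real s * (\<Sum>v\<in>e. (h v)\<^sup>2)"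
  using sum_squared_le_sum_of_squares[of h e] ssubsetsD[OF assms] by (simp add: mult.commute)

lemma sum_edge_square_le:
  assumes "1 \<le> s"
  shows "(\<Sum>e\<in>ssubsets n s. (\<Sum>v\<in>e. h v :: real)\<^sup>2) \<le> real s * stard n s * (\<Sum>v=1..n. (h v)\<^sup>2)"
proof -
  have "(\<Sum>e\<in>ssubsets n s. (\<Sum>v\<in>e. h v :: real)\<^sup>2) \<le> (\<Sum>e\<in>ssubsets n s. real s * (\<Sum>v\<in>e. (h v)\<^sup>2))"
    by (intro sum_mono edge_sum_square_le)
  then show ?thesis by (simp add: sum_distrib_left[symmetric] sum_edges_eq[OF assms] mult_ac)
qed

text \<open>The Gram matrix of the edge-vertex incidences is \<open>costard\<close> times the
  all-ones matrix plus \<open>stard - costard\<close> times the identity. The first part is positive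
  semidefinite, and in the second \<open>costard\<close> is at most half of
  \<open>stard\<close>.\<close>

lemma sum_edge_square_ge:
  fixes h :: "nat \<Rightarrow> real"
  assumes "2 \<le> s" "2 * s \<le> n"
  shows "stard n s / 2 * (\<Sum>v=1..n. (h v)\<^sup>2) \<le> (\<Sum>e\<in>ssubsets n s. (\<Sum>v\<in>e. h v)\<^sup>2)"
proof -
  have "(\<Sum>e\<in>ssubsets n s. (\<Sum>v\<in>e. h v)\<^sup>2) = (\<Sum>e\<in>ssubsets n s. \<Sum>v\<in>e. \<Sum>u\<in>e. h v * h u)"
    by (simp add: power2_eq_square sum_product)
  also have "\<dots> = (\<Sum>v=1..n. \<Sum>e\<in>star n s v. \<Sum>u\<in>e. h v * h u)"
    by (rule sum_star_swap[symmetric])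
  also have "\<dots> = (\<Sum>v=1..n. \<Sum>u=1..n. h v * h u * (if u = v then stard n s else costard n s))"
  proof (intro sum.cong refl)
    fix v assume v: "v \<in> {1..n}"
    have "(\<Sum>e\<in>star n s v. \<Sum>u\<in>e. h v * h u) = (\<Sum>e\<in>star n s v. \<Sum>u\<in>{u\<in>{1..n}. u \<in> e}. h v * h u)"
      by (intro sum.cong refl) (use starD ssubsets_mem in blast)
    also have "\<dots> = (\<Sum>u=1..n. \<Sum>e\<in>{e \<in> star n s v. u \<in> e}. h v * h u)"
      by (rule sum.swap_restrict) auto
    also have "\<dots> = (\<Sum>u=1..n. h v * h u * (if u = v then stard n s else costard n s))"
    proof (intro sum.cong refl)
      fix u assume u: "u \<in> {1..n}"
      have "{e \<in> star n s v. u \<in> e} = {e \<in> ssubsets n s. u \<in> e \<and> v \<in> e}" unfolding star_def by auto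
      moreover have "{e \<in> ssubsets n s. v \<in> e \<and> v \<in> e} = star n s v" unfolding star_def by auto
      ultimately show "(\<Sum>e\<in>{e \<in> star n s v. u \<in> e}. h v * h u) = h v * h u * (if u = v then stard n s else costard n s)"
        using card_star2[OF u v] card_star[OF v] assms by auto
    qed
    finally show "(\<Sum>e\<in>star n s v. \<Sum>u\<in>e. h v * h u) = (\<Sum>u=1..n. h v * h u * (if u = v then stard n s else costard n s))" .
  qed
  also have "\<dots> = (\<Sum>v=1..n. \<Sum>u=1..n. costard n s * (h v * h u) + (if u = v then (stard n s - costard n s) * (h v)\<^sup>2 else 0))"
    by (intro sum.cong refl) (auto simp: power2_eq_square algebra_simps)
  also have "\<dots> = costard n s * (\<Sum>v=1..n. h v)\<^sup>2 + (stard n s - costard n s) * (\<Sum>v=1..n. (h v)\<^sup>2)"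
    by (simp add: sum.distrib sum_distrib_left[symmetric] sum_distrib_right[symmetric] power2_eq_square sum.delta')
  also have "\<dots> \<ge> 0 + stard n s / 2 * (\<Sum>v=1..n. (h v)\<^sup>2)"
    using costard_le(1)[OF assms] by (intro add_mono mult_right_mono) (auto intro: sum_nonneg)
  finally show ?thesis by simp
qed

text \<open>Cauchy-Schwarz against the constant vector; this is the origin of the factor sqrt n in
  all coupling bounds.\<close>

lemma sum_edges_abs_le:
  assumes "1 \<le> s"
  shows "(\<Sum>e\<in>ssubsets n s. \<bar>\<Sum>v\<in>e. h v :: real\<bar>) \<le> stard n s * sqrt n * sqrt (\<Sum>v=1..n. (h v)\<^sup>2)"
proof -
  have "(\<Sum>e\<in>ssubsets n s. \<bar>\<Sum>v\<in>e. h v\<bar>) \<le> (\<Sum>e\<in>ssubsets n s. \<Sum>v\<in>e. \<bar>h v\<bar>)"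
    by (intro sum_mono sum_abs)
  also have "\<dots> = stard n s * (\<Sum>v=1..n. \<bar>1\<bar> * \<bar>h v\<bar>)" using sum_edges_eq[OF assms] by simp
  also have "\<dots> \<le> stard n s * (L2_set (\<lambda>_. 1) {1..n} * L2_set h {1..n})"
    by (intro mult_left_mono L2_set_mult_ineq) auto
  finally show ?thesis by (simp add: L2_set_def mult.assoc)
qed

section \<open>Convexity of the negative log-likelihood\<close>

definition score :: "nat \<Rightarrow> nat \<Rightarrow> nat set set \<Rightarrow> (nat \<Rightarrow> real) \<Rightarrow> nat \<Rightarrow> real" where
  "score n s H \<beta> v = (\<Sum>e\<in>star n s v. of_bool (e \<in> H) - sigmoid (sum \<beta> e))"

lemma edge_prob_sigmoid: "edge_prob \<beta> e = sigmoid (sum \<beta> e)"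
  unfolding edge_prob_def sigmoid_def by simp

lemma sdegree_eq_sum:
  assumes "H \<subseteq> ssubsets n s"
  shows "real (sdegree H v) = (\<Sum>e\<in>star n s v. of_bool (e \<in> H))"
proof -
  have "{e \<in> H. v \<in> e} = {e \<in> star n s v. e \<in> H}" using assms by (auto simp: star_def)
  then show ?thesis unfolding sdegree_def by (simp add: sum.If_cases of_bool_def Int_def)
qed

text \<open>The data enter the likelihood only linearly, so the expansion is exact and everything
  beyond the score term is deterministic for deterministic \<open>\<delta>\<close>. It serves both
  for the Newton step and for the passage from \<open>\<gamma>'\<close> to
  \<open>\<gamma>\<close>.\<close>

lemma neg_log_lik_expand:
  assumes "H \<subseteq> ssubsets n s"
  shows "neg_log_lik n s H (\<lambda>v. \<beta> v + \<delta> v) = neg_log_lik n s H \<beta> - (\<Sum>v=1..n. \<delta> v * score n s H \<beta> v)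
    + (\<Sum>e\<in>ssubsets n s. softplus_breg (sum \<beta> e) (sum \<delta> e))"
proof -
  have "(\<Sum>v=1..n. \<delta> v * (\<Sum>e\<in>star n s v. sigmoid (sum \<beta> e))) = (\<Sum>e\<in>ssubsets n s. sigmoid (sum \<beta> e) * sum \<delta> e)"
    by (simp only: sum_distrib_left sum_star_swap) (simp add: mult_ac sum_distrib_right)
  then have "(\<Sum>v=1..n. \<delta> v * score n s H \<beta> v) = (\<Sum>v=1..n. \<delta> v * real (sdegree H v))
     - (\<Sum>e\<in>ssubsets n s. sigmoid (sum \<beta> e) * sum \<delta> e)"
    by (simp add: score_def sum_subtractf sdegree_eq_sum[OF assms] algebra_simps)
  moreover have "(\<Sum>e\<in>ssubsets n s. softplus_breg (sum \<beta> e) (sum \<delta> e)) =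
      (\<Sum>e\<in>ssubsets n s. ln (1 + exp (\<Sum>v\<in>e. \<beta> v + \<delta> v)))
      - (\<Sum>e\<in>ssubsets n s. ln (1 + exp (\<Sum>v\<in>e. \<beta> v))) - (\<Sum>e\<in>ssubsets n s. sigmoid (sum \<beta> e) * sum \<delta> e)"
    unfolding softplus_breg_def softplus_def by (simp add: sum.distrib sum_subtractf)
  ultimately show ?thesis
    unfolding neg_log_lik_def by (simp add: sum.distrib distrib_right)
qed

lemma neg_log_lik_cong:
  assumes "\<And>v. v \<in> {1..n} \<Longrightarrow> \<beta> v = \<beta>' v"
  shows "neg_log_lik n s H \<beta> = neg_log_lik n s H \<beta>'"
proof -
  have "(\<Sum>v\<in>e. \<beta> v) = (\<Sum>v\<in>e. \<beta>' v)" if "e \<in> ssubsets n s" for e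
    using that assms ssubsets_mem by (intro sum.cong refl) blast
  moreover have "(\<Sum>v=1..n. \<beta> v * real (sdegree H v)) = (\<Sum>v=1..n. \<beta>' v * real (sdegree H v))"
    using assms by (intro sum.cong) auto
  ultimately show ?thesis unfolding neg_log_lik_def by simp
qed

lemma convex_softplus:
  assumes "0 \<le> c" "c \<le> 1"
  shows "softplus ((1 - c) * a + c * b) \<le> (1 - c) * softplus a + c * softplus b"
proof -
  have "convex_on UNIV softplus"
    by (rule f''_ge0_imp_convex[where f' = sigmoid and f'' = sigvar])
      (use has_real_derivative_softplus has_real_derivative_sigmoid sigvar_bounds in \<open>auto simp: less_imp_le\<close>)
  then show ?thesis using assms convex_onD[of UNIV softplus c a b] by simp
qed

lemma neg_log_lik_convex:
  assumes "0 \<le> c" "c \<le> 1"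
  shows "neg_log_lik n s H (\<lambda>v. (1 - c) * \<beta> v + c * \<beta>' v)
    \<le> (1 - c) * neg_log_lik n s H \<beta> + c * neg_log_lik n s H \<beta>'"
proof -
  have "(\<Sum>e\<in>ssubsets n s. softplus (\<Sum>v\<in>e. (1 - c) * \<beta> v + c * \<beta>' v))
      \<le> (\<Sum>e\<in>ssubsets n s. (1 - c) * softplus (sum \<beta> e) + c * softplus (sum \<beta>' e))"
    using convex_softplus[OF assms] by (intro sum_mono) (simp add: sum.distrib sum_distrib_left[symmetric])
  also have "\<dots> = (1 - c) * (\<Sum>e\<in>ssubsets n s. softplus (sum \<beta> e)) + c * (\<Sum>e\<in>ssubsets n s. softplus (sum \<beta>' e))"
    by (simp only: sum.distrib sum_distrib_left)
  finally have "(\<Sum>e\<in>ssubsets n s. softplus (\<Sum>v\<in>e. (1 - c) * \<beta> v + c * \<beta>' v)) \<le> \<dots>" .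
  moreover have "(\<Sum>v=1..n. ((1 - c) * \<beta> v + c * \<beta>' v) * real (sdegree H v))
    = (1 - c) * (\<Sum>v=1..n. \<beta> v * real (sdegree H v)) + c * (\<Sum>v=1..n. \<beta>' v * real (sdegree H v))"
    by (simp only: distrib_right sum.distrib sum_distrib_left mult.assoc)
  ultimately show ?thesis
    unfolding neg_log_lik_def softplus_def[symmetric] by (simp add: right_diff_distrib)
qed

text \<open>A lower bound for the smallest eigenvalue of the Hessian wherever all edge sums are at
  most \<open>K\<close> in absolute value: minimal edge variance times the coercivity constant
  \<open>stard n s / 2\<close>.\<close>

definition curvature :: "nat \<Rightarrow> nat \<Rightarrow> real \<Rightarrow> real" where
  "curvature n s K = sigvar_min K * stard n s / 2"

definition score_norm :: "nat \<Rightarrow> nat \<Rightarrow> nat set set \<Rightarrow> (nat \<Rightarrow> real) \<Rightarrow> real" where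
  "score_norm n s H \<beta> = L2_set (score n s H \<beta>) {1..n}"

lemma curvature_pos: "2 \<le> s \<Longrightarrow> 2 * s \<le> n \<Longrightarrow> 0 < curvature n s K"
  unfolding curvature_def by (intro divide_pos_pos mult_pos_pos sigvar_min_pos stard_pos) auto

lemma abs_le_L2_set: "finite A \<Longrightarrow> v \<in> A \<Longrightarrow> \<bar>h v\<bar> \<le> L2_set h A"
  using member_le_L2_set[of A v "\<lambda>v. \<bar>h v\<bar>"] by (simp add: L2_set_def)

text \<open>The edge variances decay at infinity, so strong convexity is only local: a step of norm
  at most one keeps coordinates below \<open>K + 1\<close>, hence edge sums below
  \<open>s * (K + 1)\<close>, at both ends of the segment.\<close>

lemma neg_log_lik_local_lower:
  assumes "2 \<le> s" "2 * s \<le> n" "H \<subseteq> ssubsets n s"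
    and y: "\<And>v. v \<in> {1..n} \<Longrightarrow> \<bar>y v\<bar> \<le> K" and h: "L2_set h {1..n} \<le> 1"
  shows "neg_log_lik n s H y - score_norm n s H y * L2_set h {1..n}
      + curvature n s (real s * (K + 1)) / 2 * (L2_set h {1..n})\<^sup>2
    \<le> neg_log_lik n s H (\<lambda>v. y v + h v)"
proof -
  let ?K = "real s * (K + 1)"
  have hv: "\<bar>h v\<bar> \<le> 1" if "v \<in> {1..n}" for v
    using abs_le_L2_set[OF finite_atLeastAtMost that, of h] h by linarith
  have hK: "0 \<le> K" using y[of 1] assms(1,2) by force
  have "sigvar_min ?K / 2 * (\<Sum>e\<in>ssubsets n s. (sum h e)\<^sup>2) \<le> (\<Sum>e\<in>ssubsets n s. softplus_breg (sum y e) (sum h e))"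
    unfolding sum_distrib_left
  proof (intro sum_mono softplus_breg_ge)
    fix e assume e: "e \<in> ssubsets n s"
    show "\<bar>sum y e\<bar> \<le> ?K" using e y by (intro abs_sum_edge_le) force+
    have "\<bar>\<Sum>v\<in>e. y v + h v\<bar> \<le> ?K" using e y hv by (intro abs_sum_edge_le) (auto intro!: order_trans[OF abs_triangle_ineq] add_mono)
    then show "\<bar>sum y e + sum h e\<bar> \<le> ?K" by (simp add: sum.distrib)
  qed
  moreover have "curvature n s ?K / 2 * (L2_set h {1..n})\<^sup>2 \<le> sigvar_min ?K / 2 * (\<Sum>e\<in>ssubsets n s. (sum h e)\<^sup>2)"
  proof -
    have "sigvar_min ?K / 2 * (stard n s / 2 * (\<Sum>v=1..n. (h v)\<^sup>2)) \<le> sigvar_min ?K / 2 * (\<Sum>e\<in>ssubsets n s. (sum h e)\<^sup>2)"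
      using sum_edge_square_ge[OF assms(1,2), of h] sigvar_min_pos[of ?K] by (intro mult_left_mono) auto
    then show ?thesis by (simp add: L2_set_def sum_nonneg curvature_def)
  qed
  moreover have "(\<Sum>v=1..n. h v * score n s H y v) \<le> score_norm n s H y * L2_set h {1..n}"
  proof -
    have "(\<Sum>v=1..n. h v * score n s H y v) \<le> (\<Sum>v=1..n. \<bar>score n s H y v\<bar> * \<bar>h v\<bar>)"
      by (intro sum_mono) (metis abs_ge_self abs_mult mult.commute)
    also have "\<dots> \<le> score_norm n s H y * L2_set h {1..n}"
      unfolding score_norm_def by (rule L2_set_mult_ineq)
    finally show ?thesis .
  qed
  ultimately show ?thesis unfolding neg_log_lik_expand[OF assms(3)] by linarith
qed

text \<open>Vectors are pinned to \<open>undefined\<close> outside \<open>{1..n}\<close>, so the box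
  is a product over all naturals of intervals and singletons, and Tychonoff applies.\<close>

lemma compact_vec_box:
  "compact {\<beta> \<in> vecs n. \<forall>v\<in>{1..n}. \<bar>\<beta> v - y v\<bar> \<le> (1::real)}"
proof -
  let ?S = "\<lambda>v. if v \<in> {1..n} then {y v - 1..y v + 1} else {undefined}"
  have "(\<beta> \<in> vecs n \<and> (\<forall>v\<in>{1..n}. \<bar>\<beta> v - y v\<bar> \<le> 1)) \<longleftrightarrow> (\<forall>v. \<beta> v \<in> ?S v)" for \<beta>
  proof -
    have "\<beta> v \<in> ?S v \<longleftrightarrow> (v \<notin> {1..n} \<longrightarrow> \<beta> v = undefined) \<and> (v \<in> {1..n} \<longrightarrow> \<bar>\<beta> v - y v\<bar> \<le> 1)" for v
      by (cases "v \<in> {1..n}") (auto simp: abs_le_iff)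
    then show ?thesis unfolding vecs_def extensional_def by blast
  qed
  then have "{\<beta> \<in> vecs n. \<forall>v\<in>{1..n}. \<bar>\<beta> v - y v\<bar> \<le> 1} = PiE UNIV ?S"
    unfolding PiE_UNIV_domain by (simp add: Pi_def)
  moreover have "compactin (product_topology (\<lambda>i. euclidean) UNIV) (PiE UNIV ?S)"
    unfolding compactin_PiE by (intro disjI2 ballI) simp
  ultimately show ?thesis by (simp add: euclidean_product_topology)
qed

lemma continuous_on_neg_log_lik: "continuous_on S (neg_log_lik n s H)"
proof -
  have c: "continuous_on S (\<lambda>\<beta>::nat \<Rightarrow> real. \<beta> v)" for v
    by (rule continuous_on_subset[OF continuous_on_product_coordinates subset_UNIV])
  have "1 + exp x \<noteq> (0::real)" for x using add_pos_pos[of 1 "exp x"] by auto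
  then show ?thesis unfolding neg_log_lik_def[abs_def] 
    by (intro continuous_on_diff continuous_on_sum continuous_on_ln continuous_on_add
        continuous_on_const continuous_on_exp continuous_on_mult c) auto
qed

text \<open>If the score at \<open>y\<close> is below half the curvature, the likelihood on the unit
  sphere around \<open>y\<close> exceeds its value at \<open>y\<close>, and convexity carries this
  to everything outside. Minimisation thus reduces to a compact box, and the gap between
  \<open>y\<close> and the minimum is at most that of the quadratic minorant.\<close>

lemma mle_near_small_score:
  assumes s: "2 \<le> s" "2 * s \<le> n" and H: "H \<subseteq> ssubsets n s"
    and y: "\<And>v. v \<in> {1..n} \<Longrightarrow> \<bar>y v\<bar> \<le> K"
    and small: "2 * score_norm n s H y < curvature n s (real s * (K + 1))"
  shows "\<exists>!\<beta>. is_mle n s H \<beta>"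
    and "is_mle n s H b \<Longrightarrow> neg_log_lik n s H b \<le> neg_log_lik n s H y"
    and "is_mle n s H b \<Longrightarrow> neg_log_lik n s H y - (score_norm n s H y)\<^sup>2 / (2 * curvature n s (real s * (K + 1)))
      \<le> neg_log_lik n s H b"
proof -
  let ?l = "neg_log_lik n s H" and ?k = "curvature n s (real s * (K + 1))" and ?g = "score_norm n s H y"
  let ?N = "\<lambda>h. L2_set h {1..n}"
  have k: "0 < ?k" using curvature_pos s .
  have outside: "?l y < ?l (\<lambda>v. y v + h v)" if "1 < ?N h" for h :: "nat \<Rightarrow> real"
  proof -
    \<comment> \<open>Scales \<open>h\<close> back to the unit sphere; the scaled point is a convex
      combination of \<open>y\<close> and \<open>y + h\<close>.\<close>
    define c where "c = 1 / ?N h"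
    have c: "0 \<le> c" "c \<le> 1" "0 < c" using that by (auto simp: c_def field_simps)
    have N1: "?N (\<lambda>v. c * h v) = 1"
      using L2_set_right_distrib[OF c(1), of h "{1..n}"] that by (simp add: c_def)
    have "?l y < ?l y - ?g * 1 + ?k / 2 * 1\<^sup>2" using small by simp
    also have "\<dots> \<le> ?l (\<lambda>v. y v + c * h v)"
      using neg_log_lik_local_lower[OF s H y, where h = "\<lambda>v. c * h v"] N1 by simp
    also have "(\<lambda>v. y v + c * h v) = (\<lambda>v. (1 - c) * y v + c * (y v + h v))"
      by (simp add: algebra_simps)
    also have "?l \<dots> \<le> (1 - c) * ?l y + c * ?l (\<lambda>v. y v + h v)"
      by (rule neg_log_lik_convex[OF c(1,2)])
    finally have "c * ?l y < c * ?l (\<lambda>v. y v + h v)" by (simp add: algebra_simps)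
    then show ?thesis using c by simp
  qed
  \<comment> \<open>This sup-norm box contains the Euclidean unit ball, so a vector outside the box
    is at Euclidean distance more than one.\<close>
  let ?B = "{\<beta> \<in> vecs n. \<forall>v\<in>{1..n}. \<bar>\<beta> v - y v\<bar> \<le> 1}"
  have y': "restrict y {1..n} \<in> ?B" by (auto simp: vecs_def)
  have ly: "?l (restrict y {1..n}) = ?l y" by (rule neg_log_lik_cong) auto
  obtain b0 where b0: "b0 \<in> ?B" "\<And>\<beta>. \<beta> \<in> ?B \<Longrightarrow> ?l b0 \<le> ?l \<beta>"
    using continuous_attains_inf[OF compact_vec_box _ continuous_on_neg_log_lik, of n y n s H] y' by blast
  have b0min: "?l b0 \<le> ?l \<beta>" if mem: "\<beta> \<in> vecs n" for \<beta>
  proof (cases "\<beta> \<in> ?B")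
    case False
    then obtain v where v: "v \<in> {1..n}" "1 < \<bar>\<beta> v - y v\<bar>" using mem by (auto simp: not_le)
    have "1 < ?N (\<lambda>v. \<beta> v - y v)"
      using abs_le_L2_set[of "{1..n}" v "\<lambda>v. \<beta> v - y v"] v by simp
    from outside[OF this] have "?l y < ?l \<beta>" by simp
    moreover have "?l b0 \<le> ?l y" using b0(2)[OF y'] ly by simp
    ultimately show ?thesis by linarith
  qed (use b0 in auto)
  have mle0: "is_mle n s H b0"
    unfolding is_mle_def is_arg_min_def 
  proof (intro conjI notI)
    show "b0 \<in> vecs n" using b0(1) by simp
    assume "\<exists>\<beta>. \<beta> \<in> vecs n \<and> ?l \<beta> < ?l b0"
    then show False using b0min by (auto simp: not_less[symmetric])
  qed
  have mle_min: "b \<in> vecs n" "\<And>\<beta>. \<beta> \<in> vecs n \<Longrightarrow> ?l b \<le> ?l \<beta>" if "is_mle n s H b" for b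
    using that unfolding is_mle_def is_arg_min_def by (auto simp: not_less)
  show "\<exists>!\<beta>. is_mle n s H \<beta>"
  proof (rule ex1I[where a = b0], rule mle0, rule ccontr)
    \<comment> \<open>the midpoint of two minimisers would be strictly better\<close>
    fix b1 assume b1: "is_mle n s H b1" "b1 \<noteq> b0"
    define d where "d v = b1 v - b0 v" for v
    have "\<exists>v\<in>{1..n}. d v \<noteq> 0"
    proof (rule ccontr)
      assume "\<not> ?thesis"
      then have "b1 v = b0 v" if "v \<in> {1..n}" for v using that by (auto simp: d_def)
      then have "b1 = b0"
        using mle_min(1)[OF b1(1)] mle_min(1)[OF mle0] unfolding vecs_def by (intro extensionalityI)
      with b1 show False by simp
    qed
    then obtain v where v: "v \<in> {1..n}" "d v \<noteq> 0" by blast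
    have "0 < (\<Sum>v=1..n. (d v)\<^sup>2)"
      using v by (intro sum_pos2[of _ v]) simp_all
    then have "0 < stard n s / 2 * (\<Sum>v=1..n. (d v)\<^sup>2)" using stard_pos[OF s] by simp
    then have "0 < (\<Sum>e\<in>ssubsets n s. (sum d e)\<^sup>2)"
      using sum_edge_square_ge[OF s, of d] by linarith
    then obtain e where e: "e \<in> ssubsets n s" "(sum d e)\<^sup>2 \<noteq> 0"
      using sum.not_neutral_contains_not_neutral[of "\<lambda>e. (sum d e)\<^sup>2" "ssubsets n s"] by (metis less_irrefl)
    define m where "m v = b0 v + d v / 2" for v
    have nn: "0 \<le> softplus_breg x t" for x t by (rule softplus_breg_nonneg)
    have exp0: "?l b0 = ?l m - (\<Sum>v=1..n. - d v / 2 * score n s H m v) + (\<Sum>e\<in>ssubsets n s. softplus_breg (sum m e) (sum (\<lambda>v. - d v / 2) e))"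
      using neg_log_lik_expand[OF H, of m "\<lambda>v. - d v / 2"] by (simp add: m_def)
    have exp1: "?l b1 = ?l m - (\<Sum>v=1..n. d v / 2 * score n s H m v) + (\<Sum>e\<in>ssubsets n s. softplus_breg (sum m e) (sum (\<lambda>v. d v / 2) e))"
      using neg_log_lik_expand[OF H, of m "\<lambda>v. d v / 2"] by (simp add: m_def d_def)
    have "0 < (\<Sum>e\<in>ssubsets n s. softplus_breg (sum m e) (sum (\<lambda>v. d v / 2) e))"
    proof (rule sum_pos2[OF _ e(1)])
      show "0 < softplus_breg (sum m e) (\<Sum>v\<in>e. d v / 2)"
        using e(2) by (intro softplus_breg_pos) (simp add: sum_divide_distrib[symmetric])
    qed (use nn in simp_all)
    moreover have "0 \<le> (\<Sum>e\<in>ssubsets n s. softplus_breg (sum m e) (sum (\<lambda>v. - d v / 2) e))"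
      by (intro sum_nonneg nn)
    moreover have "(\<Sum>v=1..n. - d v / 2 * score n s H m v) = - (\<Sum>v=1..n. d v / 2 * score n s H m v)"
      by (simp add: sum_negf)
    ultimately have "2 * ?l m < ?l b0 + ?l b1" using exp0 exp1 by linarith
    moreover have "?l b1 \<le> ?l b0" using mle_min[OF b1(1)] mle_min(1)[OF mle0] by blast
    moreover have "?l b0 \<le> ?l m"
    proof -
      have "?l b0 \<le> ?l (restrict m {1..n})" by (intro mle_min(2)[OF mle0]) (simp add: vecs_def)
      also have "\<dots> = ?l m" by (rule neg_log_lik_cong) auto
      finally show ?thesis .
    qed
    ultimately show False by linarith
  qed
  assume b: "is_mle n s H b"
  show le: "?l b \<le> ?l y" using mle_min(2)[OF b, of "restrict y {1..n}"] y' ly by simp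
  show "?l y - ?g\<^sup>2 / (2 * ?k) \<le> ?l b"
  proof -
    define r where "r = ?N (\<lambda>v. b v - y v)"
    have "r \<le> 1"
    proof (rule ccontr)
      assume "\<not> r \<le> 1"
      then have "1 < ?N (\<lambda>v. b v - y v)" unfolding r_def by simp
      from outside[OF this] le show False by simp
    qed
    then have "?l y - ?g * r + ?k / 2 * r\<^sup>2 \<le> ?l (\<lambda>v. y v + (b v - y v))"
      unfolding r_def by (intro neg_log_lik_local_lower[OF s H] y)
    then have "?l y - ?g * r + ?k / 2 * r\<^sup>2 \<le> ?l b" by simp
    \<comment> \<open>Completing the square: the minorant in \<open>r\<close> is smallest at
      \<open>?g / ?k\<close>.\<close>
    moreover have "0 \<le> ?k / 2 * (r - ?g / ?k)\<^sup>2" using k by simp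
    then have "- (?g\<^sup>2 / (2 * ?k)) \<le> - ?g * r + ?k / 2 * r\<^sup>2"
      using k by (simp add: power2_diff field_simps power2_eq_square)
    ultimately show ?thesis by linarith
  qed
qed

section \<open>One diagonal Newton step\<close>

text \<open>
  \<open>newton\<close> uses only the diagonal of the Fisher information, whose inverse is the dominant part of
  the inverse information matrix; \<open>cross\<close> is what the off-diagonal entries contribute to the score.
\<close>

definition info :: "nat \<Rightarrow> nat \<Rightarrow> (nat \<Rightarrow> real) \<Rightarrow> nat \<Rightarrow> real" where
  "info n s \<beta> v = (\<Sum>e\<in>star n s v. sigvar (sum \<beta> e))"

definition newton :: "nat \<Rightarrow> nat \<Rightarrow> nat set set \<Rightarrow> (nat \<Rightarrow> real) \<Rightarrow> nat \<Rightarrow> real" where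
  "newton n s H \<beta> v = score n s H \<beta> v / info n s \<beta> v"

definition cross :: "nat \<Rightarrow> nat \<Rightarrow> nat set set \<Rightarrow> (nat \<Rightarrow> real) \<Rightarrow> nat \<Rightarrow> real" where
  "cross n s H \<beta> v = (\<Sum>e\<in>star n s v. sigvar (sum \<beta> e) * sum (newton n s H \<beta>) (e - {v}))"

lemma sum_sigvar_newton:
  assumes "info n s \<beta> v \<noteq> 0"
  shows "(\<Sum>e\<in>star n s v. sigvar (sum \<beta> e) * sum (newton n s H \<beta>) e) = score n s H \<beta> v + cross n s H \<beta> v"
proof -
  have "sigvar (sum \<beta> e) * sum (newton n s H \<beta>) e
      = sigvar (sum \<beta> e) * newton n s H \<beta> v + sigvar (sum \<beta> e) * sum (newton n s H \<beta>) (e - {v})"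
    if "e \<in> star n s v" for e
  proof -
    have "finite e" "v \<in> e" using starD[OF that] ssubsetsD by auto
    then show ?thesis by (simp add: sum.remove distrib_left)
  qed
  then have "(\<Sum>e\<in>star n s v. sigvar (sum \<beta> e) * sum (newton n s H \<beta>) e) =
      info n s \<beta> v * newton n s H \<beta> v + cross n s H \<beta> v"
    by (simp add: sum.distrib info_def cross_def sum_distrib_right)
  then show ?thesis using assms by (simp add: newton_def)
qed

text \<open>The diagonal part of the linearised score cancels the old score exactly, by the choice
  of the step. What remains is the off-diagonal part and a quadratic Taylor error.\<close>

lemma score_newton_step:
  assumes "info n s \<beta> v \<noteq> 0"
  shows "\<bar>score n s H (\<lambda>v. \<beta> v + newton n s H \<beta> v) v\<bar>
    \<le> \<bar>cross n s H \<beta> v\<bar> + (\<Sum>e\<in>star n s v. (sum (newton n s H \<beta>) e)\<^sup>2)"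
proof -
  let ?x = "newton n s H \<beta>"
  have "score n s H (\<lambda>v. \<beta> v + ?x v) v = score n s H \<beta> v
      - (\<Sum>e\<in>star n s v. sigmoid (sum \<beta> e + sum ?x e) - sigmoid (sum \<beta> e))"
    unfolding score_def by (simp add: sum.distrib sum_subtractf)
  also have "\<dots> = - cross n s H \<beta> v
      - (\<Sum>e\<in>star n s v. sigmoid (sum \<beta> e + sum ?x e) - sigmoid (sum \<beta> e) - sigvar (sum \<beta> e) * sum ?x e)"
    using sum_sigvar_newton[OF assms, of H] by (simp add: sum_subtractf)
  finally have "\<bar>score n s H (\<lambda>v. \<beta> v + ?x v) v\<bar> \<le> \<bar>cross n s H \<beta> v\<bar>
      + \<bar>\<Sum>e\<in>star n s v. sigmoid (sum \<beta> e + sum ?x e) - sigmoid (sum \<beta> e) - sigvar (sum \<beta> e) * sum ?x e\<bar>"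
    by linarith
  also have "\<bar>\<Sum>e\<in>star n s v. sigmoid (sum \<beta> e + sum ?x e) - sigmoid (sum \<beta> e) - sigvar (sum \<beta> e) * sum ?x e\<bar>
      \<le> (\<Sum>e\<in>star n s v. (sum ?x e)\<^sup>2)"
    by (rule order_trans[OF sum_abs]) (intro sum_mono sigmoid_taylor2)
  finally show ?thesis by simp
qed

text \<open>The linear term contributes the sum of step times score once; the quadratic term takes
  half of it back and brings in half of step times \<open>cross\<close>.\<close>

lemma neg_log_lik_newton_step:
  assumes "H \<subseteq> ssubsets n s" "\<And>v. v \<in> {1..n} \<Longrightarrow> info n s \<beta> v \<noteq> 0"
  shows "neg_log_lik n s H \<beta> - neg_log_lik n s H (\<lambda>v. \<beta> v + newton n s H \<beta> v) =
    (\<Sum>v=1..n. (score n s H \<beta> v)\<^sup>2 / info n s \<beta> v) / 2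
    - (\<Sum>v=1..n. newton n s H \<beta> v * cross n s H \<beta> v) / 2
    - (\<Sum>e\<in>ssubsets n s. softplus_rem (sum \<beta> e) (sum (newton n s H \<beta>) e))"
proof -
  let ?x = "newton n s H \<beta>"
  have "(\<Sum>e\<in>ssubsets n s. sigvar (sum \<beta> e) * (sum ?x e)\<^sup>2)
      = (\<Sum>e\<in>ssubsets n s. \<Sum>v\<in>e. ?x v * (sigvar (sum \<beta> e) * sum ?x e))"
    by (simp add: power2_eq_square sum_distrib_right[symmetric]) (simp add: mult_ac)
  also have "\<dots> = (\<Sum>v=1..n. ?x v * (\<Sum>e\<in>star n s v. sigvar (sum \<beta> e) * sum ?x e))"
    by (simp only: sum_star_swap[symmetric] sum_distrib_left)
  also have "\<dots> = (\<Sum>v=1..n. ?x v * score n s H \<beta> v + ?x v * cross n s H \<beta> v)"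
    using assms(2) by (intro sum.cong) (auto simp: sum_sigvar_newton distrib_left)
  finally have q: "(\<Sum>e\<in>ssubsets n s. sigvar (sum \<beta> e) * (sum ?x e)\<^sup>2)
      = (\<Sum>v=1..n. ?x v * score n s H \<beta> v) + (\<Sum>v=1..n. ?x v * cross n s H \<beta> v)"
    by (simp add: sum.distrib)
  have "(\<Sum>e\<in>ssubsets n s. softplus_breg (sum \<beta> e) (sum ?x e)) =
     (\<Sum>e\<in>ssubsets n s. softplus_rem (sum \<beta> e) (sum ?x e))
      + (\<Sum>e\<in>ssubsets n s. sigvar (sum \<beta> e) * (sum ?x e)\<^sup>2) / 2"
    unfolding softplus_rem_def by (simp add: sum_subtractf sum_divide_distrib)
  moreover have "(\<Sum>v=1..n. ?x v * score n s H \<beta> v) = (\<Sum>v=1..n. (score n s H \<beta> v)\<^sup>2 / info n s \<beta> v)"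
    by (simp add: newton_def power2_eq_square)
  ultimately show ?thesis
    unfolding neg_log_lik_expand[OF assms(1), of \<beta> ?x] using q by argo
qed

lemma power4_sum_le:
  fixes f :: "'a \<Rightarrow> real"
  shows "(sum f A) ^ 4 \<le> real (card A) ^ 3 * (\<Sum>x\<in>A. f x ^ 4)"
proof -
  have "(sum f A) ^ 4 = ((sum f A)\<^sup>2)\<^sup>2" by simp
  also have "\<dots> \<le> ((\<Sum>x\<in>A. (f x)\<^sup>2) * card A)\<^sup>2"
    by (intro power_mono sum_squared_le_sum_of_squares) auto
  also have "\<dots> = real (card A) ^ 2 * (\<Sum>x\<in>A. (f x)\<^sup>2)\<^sup>2" by (simp add: power_mult_distrib)
  also have "\<dots> \<le> real (card A) ^ 2 * ((\<Sum>x\<in>A. ((f x)\<^sup>2)\<^sup>2) * card A)"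
    by (intro mult_left_mono sum_squared_le_sum_of_squares) auto
  finally show ?thesis by (simp add: power3_eq_cube power2_eq_square[of "real (card A)"] mult_ac)
qed

section \<open>Moments in the beta model\<close>

text \<open>
  The edge indicators are read off a richer product space through \<open>X\<close>, so that two layers with
  different parameters can later live on the same space.
\<close>

locale beta_layer = finite_product "ssubsets n s" d q
  for n s :: nat and d :: 'b and q :: "nat set \<Rightarrow> 'b pmf" +
  fixes \<beta> :: "nat \<Rightarrow> real" and X :: "'b \<Rightarrow> bool" and a :: real
  assumes s2: "2 \<le> s" and n2s: "2 * s \<le> n" and a_pos: "0 < a"
    and sigvar_ge: "\<And>e. e \<in> ssubsets n s \<Longrightarrow> a \<le> sigvar (sum \<beta> e)"
    and marginal: "\<And>e. e \<in> ssubsets n s \<Longrightarrow> map_pmf X (q e) = bernoulli_pmf (edge_prob \<beta> e)"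
begin

definition \<zeta> :: "nat set \<Rightarrow> 'b \<Rightarrow> real" where
  "\<zeta> e x = of_bool (X x) - sigmoid (sum \<beta> e)"

definition Hyp :: "(nat set \<Rightarrow> 'b) \<Rightarrow> nat set set" where
  "Hyp \<omega> = {e \<in> ssubsets n s. X (\<omega> e)}"

abbreviation b :: real where "b \<equiv> stard n s"
abbreviation D :: "nat \<Rightarrow> real" where "D \<equiv> info n s \<beta>"
abbreviation A :: "nat \<Rightarrow> (nat set \<Rightarrow> 'b) \<Rightarrow> real" where "A v \<omega> \<equiv> score n s (Hyp \<omega>) \<beta> v"
abbreviation x :: "nat \<Rightarrow> (nat set \<Rightarrow> 'b) \<Rightarrow> real" where "x v \<omega> \<equiv> newton n s (Hyp \<omega>) \<beta> v"
abbreviation xe :: "nat set \<Rightarrow> (nat set \<Rightarrow> 'b) \<Rightarrow> real" where "xe e \<omega> \<equiv> sum (newton n s (Hyp \<omega>) \<beta>) e"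
abbreviation L :: "nat \<Rightarrow> (nat set \<Rightarrow> 'b) \<Rightarrow> real" where "L v \<omega> \<equiv> cross n s (Hyp \<omega>) \<beta> v"

lemma Hyp_subset: "Hyp \<omega> \<subseteq> ssubsets n s"
  unfolding Hyp_def by auto

lemma s1: "1 \<le> s" and n_pos: "0 < real n" and b_pos: "0 < b" and n_le: "real n \<le> 2 * b"
  using s2 n2s stard_pos[OF s2 n2s] n_le_stard[OF s2 n2s] by auto

lemma a_le: "a \<le> 1 / 4"
proof -
  have "ssubsets n s \<noteq> {}"
    using card_ssubsets[OF s1, of n] n_pos b_pos s2 by auto
  then obtain e where "e \<in> ssubsets n s" by blast
  then show ?thesis using sigvar_ge sigvar_bounds(2)[of "sum \<beta> e"] by fastforce
qed

lemma \<zeta>_centered: "e \<in> ssubsets n s \<Longrightarrow> measure_pmf.expectation (q e) (\<zeta> e) = 0"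
proof -
  assume e: "e \<in> ssubsets n s"
  have "measure_pmf.expectation (q e) (\<lambda>x. of_bool (X x) :: real) = measure_pmf.expectation (map_pmf X (q e)) of_bool"
    by simp
  also have "\<dots> = sigmoid (sum \<beta> e)"
    unfolding marginal[OF e] edge_prob_sigmoid using sigmoid_bounds[of "sum \<beta> e"]
    by (subst integral_bernoulli_pmf) auto
  finally show ?thesis unfolding \<zeta>_def using e by simp
qed

lemma \<zeta>_abs_le: "\<bar>\<zeta> e y\<bar> \<le> 1"
  unfolding \<zeta>_def using sigmoid_bounds[of "sum \<beta> e"] by (cases "X y") auto

lemma \<zeta>_square: "(\<zeta> e y)\<^sup>2 = sigvar (sum \<beta> e) + (1 - 2 * sigmoid (sum \<beta> e)) * \<zeta> e y"
  unfolding \<zeta>_def sigvar_def by (cases "X y") (auto simp: power2_eq_square algebra_simps)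

lemma \<zeta>_variance: "e \<in> ssubsets n s \<Longrightarrow> measure_pmf.expectation (q e) (\<lambda>x. (\<zeta> e x)\<^sup>2) = sigvar (sum \<beta> e)"
  unfolding \<zeta>_square using \<zeta>_centered by simp

lemma second_moment_\<zeta>_le:
  assumes "I \<subseteq> ssubsets n s" and c: "\<And>e. e \<in> I \<Longrightarrow> \<bar>c e\<bar> \<le> C"
  shows "Ex (\<lambda>\<omega>. (\<Sum>e\<in>I. c e * \<zeta> e (\<omega> e))\<^sup>2) \<le> real (card I) * C\<^sup>2"
proof -
  have "Ex (\<lambda>\<omega>. (\<Sum>e\<in>I. c e * \<zeta> e (\<omega> e))\<^sup>2)
      = (\<Sum>e\<in>I. measure_pmf.expectation (q e) (\<lambda>y. (c e * \<zeta> e y)\<^sup>2))"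
    using assms(1) \<zeta>_centered by (intro second_moment_linear) (auto simp: subset_iff)
  also have "\<dots> \<le> (\<Sum>e\<in>I. C\<^sup>2)"
  proof (intro sum_mono)
    fix e assume e: "e \<in> I"
    then have "measure_pmf.expectation (q e) (\<lambda>y. (c e * \<zeta> e y)\<^sup>2) = (c e)\<^sup>2 * sigvar (sum \<beta> e)"
      using assms(1) by (auto simp: power_mult_distrib \<zeta>_variance)
    also have "\<dots> \<le> C\<^sup>2 * 1"
      using c[OF e] sigvar_bounds[of "sum \<beta> e"] by (intro mult_mono) (auto simp: abs_le_square_iff[symmetric])
    finally show "measure_pmf.expectation (q e) (\<lambda>y. (c e * \<zeta> e y)\<^sup>2) \<le> C\<^sup>2" by simp
  qed
  finally show ?thesis by simp
qed

lemma D_ge: "v \<in> {1..n} \<Longrightarrow> a * b \<le> D v"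
proof -
  assume v: "v \<in> {1..n}"
  have "(\<Sum>e\<in>star n s v. a) \<le> D v" unfolding info_def using sigvar_ge starD by (intro sum_mono) blast
  then show ?thesis using card_star[OF v s1] by (simp add: mult.commute)
qed

lemma D_pos: "v \<in> {1..n} \<Longrightarrow> 0 < D v"
  using D_ge[of v] mult_pos_pos[OF a_pos b_pos] by linarith

lemma inverse_D_le: "v \<in> {1..n} \<Longrightarrow> 1 / D v \<le> 1 / (a * b)"
  using D_ge[of v] mult_pos_pos[OF a_pos b_pos] by (intro divide_left_mono) auto

lemma A_eq: "A v \<omega> = (\<Sum>e\<in>star n s v. \<zeta> e (\<omega> e))"
  unfolding score_def \<zeta>_def Hyp_def by (intro sum.cong) (auto dest: starD)

lemma star_subset: "star n s v \<subseteq> ssubsets n s"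
  unfolding star_def by auto

text \<open>A score has size sqrt b and an information has order b, so a Newton coordinate has size
  b^(-1/2).\<close>

lemma Ex_x_power4: "v \<in> {1..n} \<Longrightarrow> Ex (\<lambda>\<omega>. x v \<omega> ^ 4) \<le> 3 / (a ^ 4 * b\<^sup>2)"
proof -
  assume v: "v \<in> {1..n}"
  have "Ex (\<lambda>\<omega>. x v \<omega> ^ 4) = Ex (\<lambda>\<omega>. (\<Sum>e\<in>star n s v. \<zeta> e (\<omega> e)) ^ 4) / D v ^ 4"
    unfolding newton_def A_eq by (simp add: power_divide)
  also have "\<dots> \<le> 3 * b\<^sup>2 / (a * b) ^ 4"
  proof (intro frac_le)
    show "Ex (\<lambda>\<omega>. (\<Sum>e\<in>star n s v. \<zeta> e (\<omega> e)) ^ 4) \<le> 3 * b\<^sup>2"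
      using fourth_moment_linear[OF star_subset, of v \<zeta>] \<zeta>_centered \<zeta>_abs_le card_star[OF v s1]
      by (auto dest: starD)
    show "(a * b) ^ 4 \<le> D v ^ 4"
      using D_ge[OF v] a_pos b_pos by (intro power_mono) auto
  qed (use a_pos b_pos in auto)
  also have "\<dots> = 3 / (a ^ 4 * b\<^sup>2)" using a_pos b_pos by (simp add: field_simps eval_nat_numeral)
  finally show ?thesis .
qed

lemma Ex_x_square: "v \<in> {1..n} \<Longrightarrow> Ex (\<lambda>\<omega>. (x v \<omega>)\<^sup>2) \<le> 1 / (a\<^sup>2 * b)"
proof -
  assume v: "v \<in> {1..n}"
  have "Ex (\<lambda>\<omega>. (x v \<omega>)\<^sup>2) = Ex (\<lambda>\<omega>. (\<Sum>e\<in>star n s v. 1 * \<zeta> e (\<omega> e))\<^sup>2) / (D v)\<^sup>2"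
    unfolding newton_def A_eq by (simp add: power_divide)
  also have "\<dots> \<le> (b * 1\<^sup>2) / (a * b)\<^sup>2"
  proof (intro frac_le)
    show "Ex (\<lambda>\<omega>. (\<Sum>e\<in>star n s v. 1 * \<zeta> e (\<omega> e))\<^sup>2) \<le> b * 1\<^sup>2"
      using second_moment_\<zeta>_le[OF star_subset, of v "\<lambda>_. 1" 1] card_star[OF v s1] by simp
    show "(a * b)\<^sup>2 \<le> (D v)\<^sup>2"
      using D_ge[OF v] a_pos b_pos by (intro power_mono) auto
  qed (use a_pos b_pos in auto)
  also have "\<dots> = 1 / (a\<^sup>2 * b)" using a_pos b_pos by (simp add: field_simps eval_nat_numeral)
  finally show ?thesis .
qed

lemma Ex_xe_power4: "e \<in> ssubsets n s \<Longrightarrow> Ex (\<lambda>\<omega>. xe e \<omega> ^ 4) \<le> 3 * real s ^ 4 / (a ^ 4 * b\<^sup>2)"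
proof -
  assume e: "e \<in> ssubsets n s"
  have "Ex (\<lambda>\<omega>. xe e \<omega> ^ 4) \<le> Ex (\<lambda>\<omega>. real s ^ 3 * (\<Sum>v\<in>e. x v \<omega> ^ 4))"
    using power4_sum_le[of _ e] ssubsetsD[OF e] by (intro Ex_mono) auto
  also have "\<dots> = real s ^ 3 * (\<Sum>v\<in>e. Ex (\<lambda>\<omega>. x v \<omega> ^ 4))" by simp
  also have "\<dots> \<le> real s ^ 3 * (\<Sum>v\<in>e. 3 / (a ^ 4 * b\<^sup>2))"
    using ssubsets_mem[OF e] by (intro mult_left_mono sum_mono Ex_x_power4) auto
  also have "\<dots> = 3 * real s ^ 4 / (a ^ 4 * b\<^sup>2)"
    using ssubsetsD[OF e] by (simp add: eval_nat_numeral)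
  finally show ?thesis .
qed

lemma Ex_xe_square: "e \<in> ssubsets n s \<Longrightarrow> Ex (\<lambda>\<omega>. (xe e \<omega>)\<^sup>2) \<le> real s ^ 2 / (a\<^sup>2 * b)"
proof -
  assume e: "e \<in> ssubsets n s"
  have "Ex (\<lambda>\<omega>. (xe e \<omega>)\<^sup>2) \<le> Ex (\<lambda>\<omega>. real s * (\<Sum>v\<in>e. (x v \<omega>)\<^sup>2))"
    by (intro Ex_mono edge_sum_square_le[OF e])
  also have "\<dots> = real s * (\<Sum>v\<in>e. Ex (\<lambda>\<omega>. (x v \<omega>)\<^sup>2))" by simp
  also have "\<dots> \<le> real s * (\<Sum>v\<in>e. 1 / (a\<^sup>2 * b))"
    using ssubsets_mem[OF e] by (intro mult_left_mono sum_mono Ex_x_square) auto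
  also have "\<dots> = real s ^ 2 / (a\<^sup>2 * b)"
    using ssubsetsD[OF e] by (simp add: eval_nat_numeral)
  finally show ?thesis .
qed

text \<open>For distinct vertices this is the off-diagonal entry of the Fisher information. Dividing
  by \<open>D u\<close> and summing over a hyperedge gives \<open>\<kappa> v f\<close>, the
  coefficient of the centred indicator of \<open>f\<close> in \<open>L v\<close>.\<close>

definition W :: "nat \<Rightarrow> nat \<Rightarrow> real" where
  "W v u = (\<Sum>e\<in>{e \<in> star n s v. u \<in> e}. sigvar (sum \<beta> e))"

definition \<kappa> :: "nat \<Rightarrow> nat set \<Rightarrow> real" where
  "\<kappa> v f = (\<Sum>u\<in>f. if u = v then 0 else W v u / D u)"

lemma W_bounds:
  assumes "u \<in> {1..n}" "v \<in> {1..n}" "u \<noteq> v"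
  shows "0 \<le> W v u" "W v u \<le> 2 * real s * b / real n"
proof -
  show "0 \<le> W v u" unfolding W_def by (intro sum_nonneg) (auto intro: less_imp_le sigvar_bounds)
  have "{e \<in> star n s v. u \<in> e} = {e \<in> ssubsets n s. u \<in> e \<and> v \<in> e}" unfolding star_def by auto
  then have c: "real (card {e \<in> star n s v. u \<in> e}) = costard n s" using card_star2[OF assms s2] by simp
  have "W v u \<le> (\<Sum>e\<in>{e \<in> star n s v. u \<in> e}. 1)"
    unfolding W_def using sigvar_bounds(2) by (intro sum_mono) (smt (verit) divide_le_eq_1)
  also have "\<dots> = costard n s" using c by simp
  also have "\<dots> \<le> 2 * real s * b / real n" by (rule costard_le(2)[OF s2 n2s])
  finally show "W v u \<le> 2 * real s * b / real n" .
qed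

lemma \<kappa>_bound:
  assumes "v \<in> {1..n}" "f \<in> ssubsets n s"
  shows "\<bar>\<kappa> v f\<bar> \<le> 2 * real s ^ 2 / (a * real n)"
proof -
  have "\<bar>\<kappa> v f\<bar> \<le> (\<Sum>u\<in>f. \<bar>if u = v then 0 else W v u / D u\<bar>)" unfolding \<kappa>_def by (rule sum_abs)
  also have "\<dots> \<le> (\<Sum>u\<in>f. 2 * real s * b / real n / (a * b))"
  proof (intro sum_mono)
    fix u assume u: "u \<in> f"
    then have u': "u \<in> {1..n}" using assms ssubsets_mem by blast
    have "W v u / D u \<le> 2 * real s * b / real n / (a * b)" if "u \<noteq> v"
      using W_bounds[OF u' assms(1) that] D_ge[OF u'] mult_pos_pos[OF a_pos b_pos] by (intro frac_le) auto
    moreover have "0 \<le> W v u / D u" if "u \<noteq> v"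
      using W_bounds[OF u' assms(1) that] D_pos[OF u'] by (intro divide_nonneg_pos) auto
    ultimately show "\<bar>if u = v then 0 else W v u / D u\<bar> \<le> 2 * real s * b / real n / (a * b)"
      using a_pos b_pos by auto
  qed
  also have "\<dots> = 2 * real s ^ 2 / (a * real n)"
    using ssubsetsD[OF assms(2)] b_pos by (simp add: power2_eq_square mult_ac)
  finally show ?thesis .
qed

text \<open>Each Newton coordinate is itself a linear form over its star; exchanging sums exhibits
  \<open>L v\<close> as a linear form in independent centred variables, whose second moment is a
  plain sum.\<close>

lemma L_eq:
  assumes "v \<in> {1..n}"
  shows "L v \<omega> = (\<Sum>f\<in>ssubsets n s. \<kappa> v f * \<zeta> f (\<omega> f))"
proof -
  have "L v \<omega> = (\<Sum>e\<in>star n s v. \<Sum>u\<in>{u \<in> {1..n}. u \<in> e}. if u = v then 0 else sigvar (sum \<beta> e) * x u \<omega>)"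
    unfolding cross_def sum_distrib_left
  proof (rule sum.cong[OF refl])
    fix e assume e: "e \<in> star n s v"
    then have "{u \<in> {1..n}. u \<in> e} = e" "finite e" using starD ssubsets_mem ssubsetsD by blast+
    then show "(\<Sum>u\<in>e - {v}. sigvar (sum \<beta> e) * x u \<omega>) = (\<Sum>u\<in>{u \<in> {1..n}. u \<in> e}. if u = v then 0 else sigvar (sum \<beta> e) * x u \<omega>)"
      by (simp only:) (intro sum.mono_neutral_cong_left, auto)
  qed
  also have "\<dots> = (\<Sum>u=1..n. \<Sum>e\<in>{e \<in> star n s v. u \<in> e}. if u = v then 0 else sigvar (sum \<beta> e) * x u \<omega>)"
    by (rule sum.swap_restrict) auto
  also have "\<dots> = (\<Sum>u=1..n. \<Sum>f\<in>star n s u. (if u = v then 0 else W v u / D u) * \<zeta> f (\<omega> f))"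
  proof (rule sum.cong[OF refl])
    fix u
    show "(\<Sum>e\<in>{e \<in> star n s v. u \<in> e}. if u = v then 0 else sigvar (sum \<beta> e) * x u \<omega>)
      = (\<Sum>f\<in>star n s u. (if u = v then 0 else W v u / D u) * \<zeta> f (\<omega> f))"
    proof (cases "u = v")
      case False
      have "(\<Sum>e\<in>{e \<in> star n s v. u \<in> e}. sigvar (sum \<beta> e) * x u \<omega>) = W v u * x u \<omega>"
        by (simp only: W_def sum_distrib_right)
      also have "\<dots> = W v u / D u * (\<Sum>f\<in>star n s u. \<zeta> f (\<omega> f))"
        by (simp add: newton_def A_eq)
      finally show ?thesis using False by (simp only: if_False sum_distrib_left)
    qed simp
  qed
  also have "\<dots> = (\<Sum>f\<in>ssubsets n s. \<Sum>u\<in>f. (if u = v then 0 else W v u / D u) * \<zeta> f (\<omega> f))"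
    by (rule sum_star_swap)
  finally show ?thesis by (simp add: \<kappa>_def sum_distrib_right)
qed

lemma card_edges_le: "real (card (ssubsets n s)) \<le> real n * b"
proof -
  have "1 * real (card (ssubsets n s)) \<le> real s * real (card (ssubsets n s))"
    using s1 by (intro mult_right_mono) auto
  then show ?thesis using card_ssubsets[OF s1, of n] by simp
qed

text \<open>At most n * b edges with squared coefficients of order n^(-2): the result is a factor n
  below the score variance, which is why inverting only the diagonal suffices.\<close>

lemma Ex_L_square:
  assumes "v \<in> {1..n}" shows "Ex (\<lambda>\<omega>. (L v \<omega>)\<^sup>2) \<le> 4 * real s ^ 4 * b / (a\<^sup>2 * real n)"
proof -
  have "Ex (\<lambda>\<omega>. (L v \<omega>)\<^sup>2) \<le> real (card (ssubsets n s)) * (2 * real s ^ 2 / (a * real n))\<^sup>2"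
    unfolding L_eq[OF assms] by (intro second_moment_\<zeta>_le \<kappa>_bound assms) auto
  also have "\<dots> \<le> real n * b * (2 * real s ^ 2 / (a * real n))\<^sup>2"
    by (intro mult_right_mono card_edges_le) auto
  also have "\<dots> = 4 * real s ^ 4 * b / (a\<^sup>2 * real n)"
    using n_pos a_pos by (simp add: power_divide power_mult_distrib field_simps) (simp add: eval_nat_numeral)
  finally show ?thesis .
qed

lemma chaos_split:
  "(\<Sum>e\<in>ssubsets n s. \<Sum>f\<in>ssubsets n s. \<theta> e f * (\<zeta> e (\<omega> e) * \<zeta> f (\<omega> f))) =
    (\<Sum>e\<in>ssubsets n s. \<theta> e e * (\<zeta> e (\<omega> e))\<^sup>2)
    + (\<Sum>e\<in>ssubsets n s. \<Sum>f\<in>ssubsets n s - {e}. \<theta> e f * (\<zeta> e (\<omega> e) * \<zeta> f (\<omega> f)))"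
proof -
  have "(\<Sum>f\<in>ssubsets n s. \<theta> e f * (\<zeta> e (\<omega> e) * \<zeta> f (\<omega> f))) =
     \<theta> e e * (\<zeta> e (\<omega> e))\<^sup>2 + (\<Sum>f\<in>ssubsets n s - {e}. \<theta> e f * (\<zeta> e (\<omega> e) * \<zeta> f (\<omega> f)))"
    if "e \<in> ssubsets n s" for e
    using that by (subst sum.remove[of _ e]) (auto simp: power2_eq_square)
  then show ?thesis by (simp add: sum.distrib)
qed

text \<open>A quadratic form over at most n * b edges with coefficients of order 1 / (n * b);
  \<open>T\<close> is the bound for \<open>\<kappa>\<close> times s / (a * b). The diagonal costs
  one multiple of the edge count times \<open>T\<close>, and the degenerate off-diagonal part has
  second moment of at most the order of that multiple squared, so the total stays bounded.\<close>

lemma Ex_abs_x_L: "Ex (\<lambda>\<omega>. \<bar>\<Sum>v=1..n. x v \<omega> * L v \<omega>\<bar>) \<le> 6 * real s ^ 3 / a\<^sup>2"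
proof -
  define \<theta> where "\<theta> e f = (\<Sum>v\<in>e. \<kappa> v f / D v)" for e f
  define T where "T = 2 * real s ^ 3 / (a\<^sup>2 * real n * b)"
  have T: "0 \<le> T" unfolding T_def using b_pos by simp
  have \<theta>_le: "\<bar>\<theta> e f\<bar> \<le> T" if "e \<in> ssubsets n s" "f \<in> ssubsets n s" for e f
  proof -
    have "\<bar>\<theta> e f\<bar> \<le> (\<Sum>v\<in>e. \<bar>\<kappa> v f / D v\<bar>)" unfolding \<theta>_def by (rule sum_abs)
    also have "\<dots> \<le> (\<Sum>v\<in>e. 2 * real s ^ 2 / (a * real n) / (a * b))"
    proof (intro sum_mono)
      fix v assume "v \<in> e"
      then have v: "v \<in> {1..n}" using that ssubsets_mem by blast
      show "\<bar>\<kappa> v f / D v\<bar> \<le> 2 * real s ^ 2 / (a * real n) / (a * b)"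
        unfolding abs_divide using \<kappa>_bound[OF v that(2)] D_ge[OF v] mult_pos_pos[OF a_pos b_pos]
        by (intro frac_le) auto
    qed
    also have "\<dots> = T" using ssubsetsD[OF that(1)] by (simp add: T_def power2_eq_square power3_eq_cube mult_ac)
    finally show ?thesis .
  qed
  have "(\<Sum>v=1..n. x v \<omega> * L v \<omega>) = (\<Sum>e\<in>ssubsets n s. \<Sum>f\<in>ssubsets n s. \<theta> e f * (\<zeta> e (\<omega> e) * \<zeta> f (\<omega> f)))" for \<omega>
  proof -
    have "(\<Sum>v=1..n. x v \<omega> * L v \<omega>) = (\<Sum>v=1..n. \<Sum>e\<in>star n s v. \<zeta> e (\<omega> e) / D v * L v \<omega>)"
      unfolding newton_def A_eq by (simp add: sum_divide_distrib sum_distrib_right)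
    also have "\<dots> = (\<Sum>e\<in>ssubsets n s. \<Sum>v\<in>e. \<zeta> e (\<omega> e) / D v * L v \<omega>)" by (rule sum_star_swap)
    also have "\<dots> = (\<Sum>e\<in>ssubsets n s. \<Sum>v\<in>e. \<Sum>f\<in>ssubsets n s. \<zeta> e (\<omega> e) / D v * (\<kappa> v f * \<zeta> f (\<omega> f)))"
      using ssubsets_mem by (intro sum.cong refl) (simp only: L_eq sum_distrib_left)
    also have "\<dots> = (\<Sum>e\<in>ssubsets n s. \<Sum>f\<in>ssubsets n s. \<theta> e f * (\<zeta> e (\<omega> e) * \<zeta> f (\<omega> f)))"
    proof (rule sum.cong[OF refl])
      fix e
      show "(\<Sum>v\<in>e. \<Sum>f\<in>ssubsets n s. \<zeta> e (\<omega> e) / D v * (\<kappa> v f * \<zeta> f (\<omega> f))) = (\<Sum>f\<in>ssubsets n s. \<theta> e f * (\<zeta> e (\<omega> e) * \<zeta> f (\<omega> f)))"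
        unfolding \<theta>_def by (subst sum.swap) (simp add: sum_distrib_right sum_distrib_left mult_ac)
    qed
    finally show ?thesis .
  qed
  then have expand: "(\<Sum>v=1..n. x v \<omega> * L v \<omega>) = (\<Sum>e\<in>ssubsets n s. \<theta> e e * (\<zeta> e (\<omega> e))\<^sup>2)
    + (\<Sum>e\<in>ssubsets n s. \<Sum>f\<in>ssubsets n s - {e}. \<theta> e f * (\<zeta> e (\<omega> e) * \<zeta> f (\<omega> f)))" for \<omega>
    using chaos_split[of \<theta> \<omega>] by simp
  have "Ex (\<lambda>\<omega>. \<bar>\<Sum>v=1..n. x v \<omega> * L v \<omega>\<bar>) \<le> Ex (\<lambda>\<omega>. real (card (ssubsets n s)) * T
     + \<bar>\<Sum>e\<in>ssubsets n s. \<Sum>f\<in>ssubsets n s - {e}. \<theta> e f * (\<zeta> e (\<omega> e) * \<zeta> f (\<omega> f))\<bar>)"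
  proof (rule Ex_mono)
    fix \<omega>
    have "\<bar>\<Sum>e\<in>ssubsets n s. \<theta> e e * (\<zeta> e (\<omega> e))\<^sup>2\<bar> \<le> (\<Sum>e\<in>ssubsets n s. \<bar>\<theta> e e * (\<zeta> e (\<omega> e))\<^sup>2\<bar>)" by (rule sum_abs)
    also have "\<dots> \<le> (\<Sum>e\<in>ssubsets n s. T * 1)"
      unfolding abs_mult using \<theta>_le \<zeta>_abs_le T by (intro sum_mono mult_mono) (auto simp: abs_square_le_1)
    finally have "\<bar>\<Sum>e\<in>ssubsets n s. \<theta> e e * (\<zeta> e (\<omega> e))\<^sup>2\<bar> \<le> real (card (ssubsets n s)) * T" by simp
    then show "\<bar>\<Sum>v=1..n. x v \<omega> * L v \<omega>\<bar> \<le> real (card (ssubsets n s)) * T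
       + \<bar>\<Sum>e\<in>ssubsets n s. \<Sum>f\<in>ssubsets n s - {e}. \<theta> e f * (\<zeta> e (\<omega> e) * \<zeta> f (\<omega> f))\<bar>"
      unfolding expand by linarith
  qed
  also have "\<dots> = real (card (ssubsets n s)) * T
      + Ex (\<lambda>\<omega>. \<bar>\<Sum>e\<in>ssubsets n s. \<Sum>f\<in>ssubsets n s - {e}. \<theta> e f * (\<zeta> e (\<omega> e) * \<zeta> f (\<omega> f))\<bar>)" by simp
  also have "Ex (\<lambda>\<omega>. \<bar>\<Sum>e\<in>ssubsets n s. \<Sum>f\<in>ssubsets n s - {e}. \<theta> e f * (\<zeta> e (\<omega> e) * \<zeta> f (\<omega> f))\<bar>)
    \<le> 2 * (real (card (ssubsets n s)) * T)"
  proof -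
    have "Ex (\<lambda>\<omega>. (\<Sum>e\<in>ssubsets n s. \<Sum>f\<in>ssubsets n s - {e}. \<theta> e f * (\<zeta> e (\<omega> e) * \<zeta> f (\<omega> f)))\<^sup>2)
      \<le> 2 * (\<Sum>e\<in>ssubsets n s. \<Sum>f\<in>ssubsets n s - {e}. Ex (\<lambda>\<omega>. (\<theta> e f * (\<zeta> e (\<omega> e) * \<zeta> f (\<omega> f)))\<^sup>2))"
      using \<zeta>_centered by (intro second_moment_chaos) auto
    also have "\<dots> \<le> 2 * (\<Sum>e\<in>ssubsets n s. real (card (ssubsets n s)) * T\<^sup>2)"
    proof (intro mult_left_mono sum_mono)
      fix e assume e: "e \<in> ssubsets n s"
      have "(\<Sum>f\<in>ssubsets n s - {e}. Ex (\<lambda>\<omega>. (\<theta> e f * (\<zeta> e (\<omega> e) * \<zeta> f (\<omega> f)))\<^sup>2))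
        \<le> (\<Sum>f\<in>ssubsets n s - {e}. T\<^sup>2)"
      proof (rule sum_mono)
        fix f assume f: "f \<in> ssubsets n s - {e}"
        have "Ex (\<lambda>\<omega>. (\<theta> e f * (\<zeta> e (\<omega> e) * \<zeta> f (\<omega> f)))\<^sup>2) \<le> Ex (\<lambda>\<omega>. T\<^sup>2)"
        proof (rule Ex_mono)
          fix \<omega>
          have "\<bar>\<theta> e f * (\<zeta> e (\<omega> e) * \<zeta> f (\<omega> f))\<bar> \<le> T * (1 * 1)"
            unfolding abs_mult using \<theta>_le e f \<zeta>_abs_le T by (intro mult_mono) auto
          then show "(\<theta> e f * (\<zeta> e (\<omega> e) * \<zeta> f (\<omega> f)))\<^sup>2 \<le> T\<^sup>2" using T by (simp add: abs_le_square_iff[symmetric])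
        qed
        then show "Ex (\<lambda>\<omega>. (\<theta> e f * (\<zeta> e (\<omega> e) * \<zeta> f (\<omega> f)))\<^sup>2) \<le> T\<^sup>2" by simp
      qed
      also have "\<dots> \<le> real (card (ssubsets n s)) * T\<^sup>2"
        by (simp add: card_Diff_subset_Int mult_right_mono)
      finally show "(\<Sum>f\<in>ssubsets n s - {e}. Ex (\<lambda>\<omega>. (\<theta> e f * (\<zeta> e (\<omega> e) * \<zeta> f (\<omega> f)))\<^sup>2))
        \<le> real (card (ssubsets n s)) * T\<^sup>2" .
    qed simp
    also have "\<dots> = 2 * (real (card (ssubsets n s)) * T)\<^sup>2" by (simp add: power2_eq_square)
    also have "\<dots> \<le> 4 * (real (card (ssubsets n s)) * T)\<^sup>2" by (intro mult_right_mono) auto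
    also have "\<dots> = (2 * (real (card (ssubsets n s)) * T))\<^sup>2" by (simp add: power_mult_distrib)
    finally have "sqrt (Ex (\<lambda>\<omega>. (\<Sum>e\<in>ssubsets n s. \<Sum>f\<in>ssubsets n s - {e}. \<theta> e f * (\<zeta> e (\<omega> e) * \<zeta> f (\<omega> f)))\<^sup>2))
      \<le> 2 * (real (card (ssubsets n s)) * T)"
      using T by (intro real_le_lsqrt Ex_nonneg) auto
    then show ?thesis by (rule order_trans[OF Ex_abs_le])
  qed
  also have "real (card (ssubsets n s)) * T + 2 * (real (card (ssubsets n s)) * T) \<le> 3 * (real n * b * T)"
    using mult_right_mono[OF card_edges_le T] by linarith
  also have "\<dots> = 6 * real s ^ 3 / a\<^sup>2" unfolding T_def using n_pos b_pos by simp
  finally show ?thesis by simp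
qed

end

section \<open>Squared scores as a quadratic form, and the score left after the Newton step\<close>

context beta_layer
begin

text \<open>The coefficient matrix of the normalised squared scores as a quadratic form in the
  centred indicators. It is symmetric, being a sum over \<open>e \<inter> f\<close>, and vanishes
  for disjoint hyperedges.\<close>

definition c :: "nat set \<Rightarrow> nat set \<Rightarrow> real" where
  "c e f = (\<Sum>v\<in>e. if v \<in> f then 1 / D v else 0)"

lemma c_bounds:
  assumes "e \<in> ssubsets n s" shows "0 \<le> c e f" "c e f \<le> real s / (a * b)"
proof -
  have D: "v \<in> {1..n}" if "v \<in> e" for v using ssubsets_mem[OF assms that] .
  show "0 \<le> c e f" unfolding c_def using D_pos[OF D] by (intro sum_nonneg) (auto intro: less_imp_le)
  have "c e f \<le> (\<Sum>v\<in>e. 1 / (a * b))"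
    unfolding c_def using inverse_D_le[OF D] a_pos b_pos by (intro sum_mono) auto
  then show "c e f \<le> real s / (a * b)" using ssubsetsD[OF assms] by simp
qed

text \<open>Every vertex of \<open>e\<close> spreads total weight \<open>b / D v\<close> over its
  star. Bounded row sums together with entries of order 1/b make the sum of squares in a row of
  order 1/b.\<close>

lemma sum_c_le:
  assumes "e \<in> ssubsets n s" shows "(\<Sum>f\<in>ssubsets n s. c e f) \<le> real s / a"
proof -
  have "(\<Sum>f\<in>ssubsets n s. c e f) = (\<Sum>v\<in>e. \<Sum>f\<in>ssubsets n s. if v \<in> f then 1 / D v else 0)"
    unfolding c_def by (rule sum.swap)
  also have "\<dots> = (\<Sum>v\<in>e. b / D v)"
  proof (rule sum.cong[OF refl])
    fix v assume "v \<in> e"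
    then have v: "v \<in> {1..n}" using ssubsets_mem[OF assms] by blast
    have "(\<Sum>f\<in>ssubsets n s. if v \<in> f then 1 / D v else 0) = (\<Sum>f\<in>star n s v. 1 / D v)"
      unfolding star_def by (simp add: sum.If_cases Int_def)
    then show "(\<Sum>f\<in>ssubsets n s. if v \<in> f then 1 / D v else 0) = b / D v"
      using card_star[OF v s1] by simp
  qed
  also have "\<dots> \<le> (\<Sum>v\<in>e. b / (a * b))"
    using D_ge[OF ssubsets_mem[OF assms]] a_pos b_pos by (intro sum_mono divide_left_mono) (auto intro!: mult_pos_pos D_pos[OF ssubsets_mem[OF assms]])
  also have "\<dots> = real s / a" using ssubsetsD[OF assms] b_pos by simp
  finally show ?thesis .
qed

lemma sum_A_square_eq:
  "(\<Sum>v=1..n. (A v \<omega>)\<^sup>2 / D v) = (\<Sum>e\<in>ssubsets n s. c e e * (\<zeta> e (\<omega> e))\<^sup>2)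
    + (\<Sum>e\<in>ssubsets n s. \<Sum>f\<in>ssubsets n s - {e}. c e f * (\<zeta> e (\<omega> e) * \<zeta> f (\<omega> f)))"
proof -
  have "(\<Sum>v=1..n. (A v \<omega>)\<^sup>2 / D v) = (\<Sum>v=1..n. \<Sum>e\<in>star n s v. \<zeta> e (\<omega> e) / D v * A v \<omega>)"
    by (simp add: power2_eq_square sum_divide_distrib[symmetric] sum_distrib_right[symmetric] A_eq)
  also have "\<dots> = (\<Sum>e\<in>ssubsets n s. \<Sum>v\<in>e. \<zeta> e (\<omega> e) / D v * A v \<omega>)" by (rule sum_star_swap)
  also have "\<dots> = (\<Sum>e\<in>ssubsets n s. \<Sum>f\<in>ssubsets n s. c e f * (\<zeta> e (\<omega> e) * \<zeta> f (\<omega> f)))"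
  proof (rule sum.cong[OF refl])
    fix e
    have "A v \<omega> = (\<Sum>f\<in>ssubsets n s. if v \<in> f then \<zeta> f (\<omega> f) else 0)" for v
      unfolding A_eq star_def by (simp add: sum.If_cases Int_def)
    then have "(\<Sum>v\<in>e. \<zeta> e (\<omega> e) / D v * A v \<omega>) = (\<Sum>v\<in>e. \<Sum>f\<in>ssubsets n s. (if v \<in> f then 1 / D v else 0) * (\<zeta> e (\<omega> e) * \<zeta> f (\<omega> f)))"
      by (auto simp: sum_distrib_left intro!: sum.cong)
    also have "\<dots> = (\<Sum>f\<in>ssubsets n s. c e f * (\<zeta> e (\<omega> e) * \<zeta> f (\<omega> f)))"
      unfolding c_def by (subst sum.swap) (simp only: sum_distrib_right)
    finally show "(\<Sum>v\<in>e. \<zeta> e (\<omega> e) / D v * A v \<omega>) = (\<Sum>f\<in>ssubsets n s. c e f * (\<zeta> e (\<omega> e) * \<zeta> f (\<omega> f)))" .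
  qed
  finally show ?thesis by (simp only: chaos_split)
qed

text \<open>\<open>D v\<close> is the sum of the edge variances in the star of \<open>v\<close>, so
  each vertex contributes exactly one to the mean; this explains the centring of the statistic by
  \<open>n\<close>. The fluctuation has variance of order n / b, which is bounded.\<close>

lemma Ex_abs_diagonal: "Ex (\<lambda>\<omega>. \<bar>(\<Sum>e\<in>ssubsets n s. c e e * (\<zeta> e (\<omega> e))\<^sup>2) - real n\<bar>) \<le> 2 * real s / a"
proof -
  have "(\<Sum>e\<in>ssubsets n s. c e e * sigvar (sum \<beta> e)) = (\<Sum>e\<in>ssubsets n s. \<Sum>v\<in>e. sigvar (sum \<beta> e) / D v)"
    unfolding c_def by (simp add: sum_distrib_right)
  also have "\<dots> = (\<Sum>v=1..n. \<Sum>e\<in>star n s v. sigvar (sum \<beta> e) / D v)" by (rule sum_star_swap[symmetric])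
  also have "\<dots> = (\<Sum>v=1..n. 1)"
  proof (rule sum.cong[OF refl])
    fix v assume "v \<in> {1..n}"
    then have "D v \<noteq> 0" using D_pos[of v] by simp
    then show "(\<Sum>e\<in>star n s v. sigvar (sum \<beta> e) / D v) = 1"
      by (simp add: sum_divide_distrib[symmetric] info_def[symmetric])
  qed
  finally have mean: "(\<Sum>e\<in>ssubsets n s. c e e * sigvar (sum \<beta> e)) = real n" by simp
  \<comment> \<open>squares of centred indicators are affine in them, so the diagonal is a linear form with mean \<open>n\<close>\<close>
  have lin: "(\<Sum>e\<in>ssubsets n s. c e e * (\<zeta> e (\<omega> e))\<^sup>2) - real n =
    (\<Sum>e\<in>ssubsets n s. (c e e * (1 - 2 * sigmoid (sum \<beta> e))) * \<zeta> e (\<omega> e))" for \<omega>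
    unfolding \<zeta>_square mean[symmetric] sum_subtractf[symmetric] by (intro sum.cong refl) (simp add: algebra_simps)
  have "Ex (\<lambda>\<omega>. ((\<Sum>e\<in>ssubsets n s. c e e * (\<zeta> e (\<omega> e))\<^sup>2) - real n)\<^sup>2) \<le> real (card (ssubsets n s)) * (real s / (a * b))\<^sup>2"
    unfolding lin
  proof (rule second_moment_\<zeta>_le[OF order_refl])
    fix e assume e: "e \<in> ssubsets n s"
    have "\<bar>c e e * (1 - 2 * sigmoid (sum \<beta> e))\<bar> \<le> real s / (a * b) * 1"
      unfolding abs_mult using c_bounds[OF e, of e] sigmoid_bounds[of "sum \<beta> e"] by (intro mult_mono) auto
    then show "\<bar>c e e * (1 - 2 * sigmoid (sum \<beta> e))\<bar> \<le> real s / (a * b)" by simp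
  qed
  also have "\<dots> \<le> real n * b * (real s / (a * b))\<^sup>2" by (intro mult_right_mono card_edges_le) auto
  also have "\<dots> = (real s / a)\<^sup>2 * (real n / b)"
    using b_pos by (simp add: power_divide power_mult_distrib) (simp add: power2_eq_square mult_ac)
  also have "\<dots> \<le> (real s / a)\<^sup>2 * 2"
    using n_le b_pos by (intro mult_left_mono) (auto simp: pos_divide_le_eq)
  also have "\<dots> \<le> (real s / a)\<^sup>2 * 4" by (intro mult_left_mono) auto
  also have "\<dots> = (2 * real s / a)\<^sup>2" by (simp add: power_divide power_mult_distrib)
  finally have "sqrt (Ex (\<lambda>\<omega>. ((\<Sum>e\<in>ssubsets n s. c e e * (\<zeta> e (\<omega> e))\<^sup>2) - real n)\<^sup>2)) \<le> 2 * real s / a"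
    using a_pos by (intro real_le_lsqrt Ex_nonneg) auto
  then show ?thesis by (rule order_trans[OF Ex_abs_le])
qed

abbreviation y :: "(nat set \<Rightarrow> 'b) \<Rightarrow> nat \<Rightarrow> real" where "y \<omega> \<equiv> (\<lambda>v. \<beta> v + x v \<omega>)"

text \<open>Per vertex, \<open>L\<close> contributes b / n and the Taylor error contributes b^2 *
  b^(-2), a constant; over n vertices this is b + n, of order b. Divided by a curvature of order b,
  the value at the minimiser differs from the Newton value by a bounded amount.\<close>

lemma Ex_score_norm_square:
  "Ex (\<lambda>\<omega>. (score_norm n s (Hyp \<omega>) (y \<omega>))\<^sup>2) \<le> 20 * real s ^ 4 / a ^ 4 * b"
proof -
  have pt: "(score_norm n s (Hyp \<omega>) (y \<omega>))\<^sup>2 \<le> (\<Sum>v=1..n. 2 * (L v \<omega>)\<^sup>2 + 2 * (b * (\<Sum>e\<in>star n s v. xe e \<omega> ^ 4)))" for \<omega>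
  proof -
    have "(score_norm n s (Hyp \<omega>) (y \<omega>))\<^sup>2 = (\<Sum>v=1..n. (score n s (Hyp \<omega>) (y \<omega>) v)\<^sup>2)"
      unfolding score_norm_def L2_set_def by (simp add: sum_nonneg)
    also have "\<dots> \<le> (\<Sum>v=1..n. 2 * (L v \<omega>)\<^sup>2 + 2 * (b * (\<Sum>e\<in>star n s v. xe e \<omega> ^ 4)))"
    proof (intro sum_mono)
      fix v assume v: "v \<in> {1..n}"
      let ?q = "\<Sum>e\<in>star n s v. (xe e \<omega>)\<^sup>2"
      have "\<bar>score n s (Hyp \<omega>) (y \<omega>) v\<bar> \<le> \<bar>L v \<omega>\<bar> + ?q" using D_pos[OF v] by (intro score_newton_step) auto
      then have "\<bar>score n s (Hyp \<omega>) (y \<omega>) v\<bar>\<^sup>2 \<le> (\<bar>L v \<omega>\<bar> + ?q)\<^sup>2" by (rule power_mono) simp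
      also have "\<dots> \<le> 2 * (L v \<omega>)\<^sup>2 + 2 * ?q\<^sup>2"
        using sum_squares_bound[of "\<bar>L v \<omega>\<bar>" ?q] by (simp add: power2_sum)
      also have "?q\<^sup>2 \<le> (\<Sum>e\<in>star n s v. ((xe e \<omega>)\<^sup>2)\<^sup>2) * card (star n s v)" by (rule sum_squared_le_sum_of_squares)
      finally show "(score n s (Hyp \<omega>) (y \<omega>) v)\<^sup>2 \<le> 2 * (L v \<omega>)\<^sup>2 + 2 * (b * (\<Sum>e\<in>star n s v. xe e \<omega> ^ 4))"
        using card_star[OF v s1] by (simp add: mult.commute)
    qed
    finally show ?thesis .
  qed
  have "Ex (\<lambda>\<omega>. (score_norm n s (Hyp \<omega>) (y \<omega>))\<^sup>2) \<le> Ex (\<lambda>\<omega>. (\<Sum>v=1..n. 2 * (L v \<omega>)\<^sup>2 + 2 * (b * (\<Sum>e\<in>star n s v. xe e \<omega> ^ 4))))"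
    by (intro Ex_mono pt)
  also have "\<dots> = (\<Sum>v=1..n. 2 * Ex (\<lambda>\<omega>. (L v \<omega>)\<^sup>2) + 2 * (b * (\<Sum>e\<in>star n s v. Ex (\<lambda>\<omega>. xe e \<omega> ^ 4))))" by simp
  also have "\<dots> \<le> (\<Sum>v=1..n. 2 * (4 * real s ^ 4 * b / (a\<^sup>2 * real n)) + 2 * (b * (b * (3 * real s ^ 4 / (a ^ 4 * b\<^sup>2)))))"
  proof (intro sum_mono add_mono mult_left_mono Ex_L_square)
    fix v assume v: "v \<in> {1..n}"
    have "(\<Sum>e\<in>star n s v. Ex (\<lambda>\<omega>. xe e \<omega> ^ 4)) \<le> (\<Sum>e\<in>star n s v. 3 * real s ^ 4 / (a ^ 4 * b\<^sup>2))"
      using starD by (intro sum_mono Ex_xe_power4) blast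
    then show "(\<Sum>e\<in>star n s v. Ex (\<lambda>\<omega>. xe e \<omega> ^ 4)) \<le> b * (3 * real s ^ 4 / (a ^ 4 * b\<^sup>2))"
      using card_star[OF v s1] by simp
  qed (use b_pos in auto)
  also have "\<dots> = 8 * real s ^ 4 * b / a\<^sup>2 + 6 * real s ^ 4 / a ^ 4 * real n"
    using n_pos b_pos a_pos by (simp add: field_simps power2_eq_square)
  also have "\<dots> \<le> 8 * real s ^ 4 * b / a ^ 4 + 6 * real s ^ 4 / a ^ 4 * (2 * b)"
  proof (intro add_mono mult_left_mono n_le divide_left_mono)
    show "a ^ 4 \<le> a\<^sup>2" using a_pos a_le by (intro power_decreasing) auto
  qed (use a_pos b_pos in auto)
  also have "\<dots> = 20 * real s ^ 4 / a ^ 4 * b" by (simp add: add_divide_distrib[symmetric])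
  finally show ?thesis .
qed

end

section \<open>Coupling two parameters\<close>

text \<open>The constant of a 1/n bound by Markov: 12 = 3 * 2 * 2 comes from fourth moments of
  Newton coordinates and 640 = 4 * 20 * 4 * 2 from the score after the step, with b replaced through
  \<open>n \<le> 2 * b\<close>.\<close>

definition bad_const :: "nat \<Rightarrow> real \<Rightarrow> real \<Rightarrow> real" where
  "bad_const s a m = 12 / a ^ 4 + 640 * real s ^ 4 / (a ^ 4 * m\<^sup>2)"

context beta_layer
begin

text \<open>One unit is added to \<open>K\<close> for the Newton step, whose coordinates are at most
  one on the good event, and a second for the unit ball around the Newton point.\<close>

definition curv :: "real \<Rightarrow> real" where
  "curv K = curvature n s (real s * (K + 1 + 1))"

text \<open>On this event the minimiser exists and is unique, so the estimator is that minimiser;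
  its arbitrary values on other hypergraphs are confined to the complement.\<close>

definition Good :: "real \<Rightarrow> (nat set \<Rightarrow> 'b) \<Rightarrow> bool" where
  "Good K \<omega> \<longleftrightarrow> (\<forall>v\<in>{1..n}. \<bar>x v \<omega>\<bar> \<le> 1) \<and> 2 * score_norm n s (Hyp \<omega>) (y \<omega>) < curv K"

lemma curv_pos: "0 < curv K"
  unfolding curv_def by (rule curvature_pos[OF s2 n2s])

lemma Good_mle:
  assumes K: "\<And>v. v \<in> {1..n} \<Longrightarrow> \<bar>\<beta> v\<bar> \<le> K" and good: "Good K \<omega>" and mle: "mle_estimator n s bhat"
  shows "\<bar>neg_log_lik n s (Hyp \<omega>) (y \<omega>) - neg_log_lik n s (Hyp \<omega>) (bhat (Hyp \<omega>))\<bar>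
    \<le> (score_norm n s (Hyp \<omega>) (y \<omega>))\<^sup>2 / (2 * curv K)"
proof -
  have y: "\<bar>y \<omega> v\<bar> \<le> K + 1" if "v \<in> {1..n}" for v
    using K[OF that] good that unfolding Good_def by (intro order_trans[OF abs_triangle_ineq]) (auto intro: add_mono)
  have small: "2 * score_norm n s (Hyp \<omega>) (y \<omega>) < curvature n s (real s * (K + 1 + 1))"
    using good unfolding Good_def curv_def by simp
  note near = mle_near_small_score[OF s2 n2s Hyp_subset, where y = "y \<omega>", OF y small]
  have m: "is_mle n s (Hyp \<omega>) (bhat (Hyp \<omega>))"
    using mle near(1) Hyp_subset unfolding mle_estimator_def by blast
  have "neg_log_lik n s (Hyp \<omega>) (bhat (Hyp \<omega>)) \<le> neg_log_lik n s (Hyp \<omega>) (y \<omega>)"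
    by (rule near(2)[OF _ m])
  moreover have "neg_log_lik n s (Hyp \<omega>) (y \<omega>) - (score_norm n s (Hyp \<omega>) (y \<omega>))\<^sup>2 / (2 * curv K)
      \<le> neg_log_lik n s (Hyp \<omega>) (bhat (Hyp \<omega>))"
    unfolding curv_def by (rule near(3)[OF _ m])
  ultimately show ?thesis by (simp add: abs_if)
qed

text \<open>Markov with fourth powers: a union over n coordinates costs n / b^2, which is at most of
  order 1/n. Second moments would give n / b, which does not vanish for s = 2.\<close>

lemma prob_not_Good:
  "measure_pmf.prob prodP {\<omega>. \<not> Good K \<omega>} \<le> bad_const s a (sigvar_min (real s * (K + 1 + 1))) / real n"
proof -
  let ?m = "sigvar_min (real s * (K + 1 + 1))"
  let ?g = "\<lambda>\<omega>. score_norm n s (Hyp \<omega>) (y \<omega>)"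
  let ?f = "\<lambda>\<omega>. (\<Sum>v=1..n. x v \<omega> ^ 4) + 4 / (curv K)\<^sup>2 * (?g \<omega>)\<^sup>2"
  have m: "0 < ?m" by (rule sigvar_min_pos)
  have "measure_pmf.prob prodP {\<omega>. \<not> Good K \<omega>} = Ex (indicator {\<omega>. \<not> Good K \<omega>})" by simp
  also have "\<dots> \<le> Ex ?f"
  proof (rule Ex_mono)
    fix \<omega>
    have sn: "0 \<le> (\<Sum>v=1..n. x v \<omega> ^ 4)" by (intro sum_nonneg) simp
    have gn: "0 \<le> 4 / (curv K)\<^sup>2 * (?g \<omega>)\<^sup>2" by simp
    have "1 \<le> ?f \<omega>" if "\<not> Good K \<omega>"
    proof (cases "\<forall>v\<in>{1..n}. \<bar>x v \<omega>\<bar> \<le> 1")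
      case True
      then have "curv K \<le> 2 * ?g \<omega>" using that unfolding Good_def by auto
      then have "(curv K)\<^sup>2 \<le> (2 * ?g \<omega>)\<^sup>2" using curv_pos[of K] by (intro power_mono) auto
      then have "1 \<le> 4 / (curv K)\<^sup>2 * (?g \<omega>)\<^sup>2"
        using curv_pos[of K] by (simp add: power_mult_distrib pos_le_divide_eq)
      with sn show ?thesis by linarith
    next
      case False
      then obtain v where v: "v \<in> {1..n}" "1 < \<bar>x v \<omega>\<bar>" by (auto simp: not_le)
      have "1 \<le> \<bar>x v \<omega>\<bar> ^ 4" using v(2) by (intro one_le_power) simp
      also have "\<dots> = x v \<omega> ^ 4" by simp
      also have "\<dots> \<le> (\<Sum>v=1..n. x v \<omega> ^ 4)" using v(1) by (intro member_le_sum) auto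
      finally show ?thesis using gn by linarith
    qed
    then show "indicator {\<omega>. \<not> Good K \<omega>} \<omega> \<le> ?f \<omega>" using sn gn by (auto simp: indicator_def)
  qed
  also have "\<dots> = (\<Sum>v=1..n. Ex (\<lambda>\<omega>. x v \<omega> ^ 4)) + 4 / (curv K)\<^sup>2 * Ex (\<lambda>\<omega>. (?g \<omega>)\<^sup>2)" by simp
  also have "\<dots> \<le> (\<Sum>v=1..n. 3 / (a ^ 4 * b\<^sup>2)) + 4 / (curv K)\<^sup>2 * (20 * real s ^ 4 / a ^ 4 * b)"
    by (intro add_mono sum_mono Ex_x_power4 mult_left_mono Ex_score_norm_square) auto
  also have "\<dots> = 3 / a ^ 4 * (real n / b) * (1 / b) + 320 * real s ^ 4 / (a ^ 4 * ?m\<^sup>2) * (1 / b)"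
    using b_pos m unfolding curv_def curvature_def
    by (simp add: power_mult_distrib power_divide) (simp add: power2_eq_square mult_ac)
  also have "\<dots> \<le> 3 / a ^ 4 * 2 * (2 / real n) + 320 * real s ^ 4 / (a ^ 4 * ?m\<^sup>2) * (2 / real n)"
    using n_le n_pos b_pos m a_pos
    by (intro add_mono mult_mono mult_left_mono) (auto simp: field_simps)
  also have "\<dots> = bad_const s a ?m / real n" unfolding bad_const_def by (simp add: add_divide_distrib)
  finally show ?thesis .
qed

lemma Ex_mle_error:
  "Ex (\<lambda>\<omega>. (score_norm n s (Hyp \<omega>) (y \<omega>))\<^sup>2 / (2 * curv K))
    \<le> 20 * real s ^ 4 / (a ^ 4 * sigvar_min (real s * (K + 1 + 1)))"
proof -
  have "Ex (\<lambda>\<omega>. (score_norm n s (Hyp \<omega>) (y \<omega>))\<^sup>2 / (2 * curv K))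
    \<le> 20 * real s ^ 4 / a ^ 4 * b / (2 * curv K)"
  proof -
    have "Ex (\<lambda>\<omega>. (score_norm n s (Hyp \<omega>) (y \<omega>))\<^sup>2 / (2 * curv K))
      = Ex (\<lambda>\<omega>. (score_norm n s (Hyp \<omega>) (y \<omega>))\<^sup>2) / (2 * curv K)" by simp
    also have "\<dots> \<le> 20 * real s ^ 4 / a ^ 4 * b / (2 * curv K)"
      using curv_pos[of K] by (intro divide_right_mono Ex_score_norm_square) simp
    finally show ?thesis .
  qed
  also have "\<dots> = 20 * real s ^ 4 / (a ^ 4 * sigvar_min (real s * (K + 1 + 1)))"
    using b_pos unfolding curv_def curvature_def by simp
  finally show ?thesis .
qed

text \<open>Regrouped by edges, the form is a sum of independent centred terms. It bounds the
  first-order term of the likelihood between the two parameters, of order n^(1/4) at the critical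
  distance.\<close>

lemma Ex_abs_linear_score:
  "Ex (\<lambda>\<omega>. \<bar>\<Sum>v=1..n. h v * A v \<omega>\<bar>) \<le> sqrt (real s * b) * L2_set h {1..n}"
proof -
  have lin: "(\<Sum>v=1..n. h v * A v \<omega>) = (\<Sum>e\<in>ssubsets n s. sum h e * \<zeta> e (\<omega> e))" for \<omega>
    unfolding A_eq by (simp only: sum_distrib_left sum_star_swap sum_distrib_right)
  have "Ex (\<lambda>\<omega>. (\<Sum>v=1..n. h v * A v \<omega>)\<^sup>2) =
     (\<Sum>e\<in>ssubsets n s. measure_pmf.expectation (q e) (\<lambda>z. (sum h e * \<zeta> e z)\<^sup>2))"
    unfolding lin using \<zeta>_centered by (intro second_moment_linear) auto
  also have "\<dots> \<le> (\<Sum>e\<in>ssubsets n s. (sum h e)\<^sup>2)"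
  proof (rule sum_mono)
    fix e assume "e \<in> ssubsets n s"
    then have "measure_pmf.expectation (q e) (\<lambda>z. (sum h e * \<zeta> e z)\<^sup>2) = (sum h e)\<^sup>2 * sigvar (sum \<beta> e)"
      by (simp add: power_mult_distrib \<zeta>_variance)
    also have "\<dots> \<le> (sum h e)\<^sup>2 * 1" using sigvar_bounds(2)[of "sum \<beta> e"] by (intro mult_left_mono) auto
    finally show "measure_pmf.expectation (q e) (\<lambda>z. (sum h e * \<zeta> e z)\<^sup>2) \<le> (sum h e)\<^sup>2" by simp
  qed
  also have "\<dots> \<le> real s * b * (\<Sum>v=1..n. (h v)\<^sup>2)" by (rule sum_edge_square_le[OF s1])
  finally have "sqrt (Ex (\<lambda>\<omega>. (\<Sum>v=1..n. h v * A v \<omega>)\<^sup>2)) \<le> sqrt (real s * b * (\<Sum>v=1..n. (h v)\<^sup>2))"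
    by (rule real_sqrt_le_mono)
  also have "\<dots> = sqrt (real s * b) * L2_set h {1..n}" by (simp add: L2_set_def real_sqrt_mult)
  finally show ?thesis by (rule order_trans[OF Ex_abs_le])
qed

end

text \<open>Both layers live on one product space of pairs of indicators, \<open>\<gamma>\<close> in
  the first component and \<open>\<gamma>'\<close> in the second. The bound \<open>coupled\<close>
  is linear in the difference of edge sums, not quadratic, because indicators that differ with
  probability p have squared difference of mean p.\<close>

locale coupled_layers =
  A: beta_layer n s d q \<gamma> fst a + B: beta_layer n s d q \<gamma>' snd a
  for n s :: nat and d :: "bool \<times> bool" and q :: "nat set \<Rightarrow> (bool \<times> bool) pmf"
    and \<gamma> \<gamma>' :: "nat \<Rightarrow> real" and a :: real +
  assumes coupled: "\<And>e. e \<in> ssubsets n s \<Longrightarrow>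
    measure_pmf.expectation (q e) (\<lambda>z. (B.\<zeta> e z - A.\<zeta> e z)\<^sup>2) \<le> \<bar>sum \<gamma>' e - sum \<gamma> e\<bar>"
begin

definition \<delta> :: "nat \<Rightarrow> real" where "\<delta> v = \<gamma>' v - \<gamma> v"

text \<open>Dominates the change of the information at \<open>v\<close>, since \<open>sigvar\<close>
  is 1-Lipschitz, and also collects the coupling errors of the edges in its star.\<close>

definition h :: "nat \<Rightarrow> real" where "h v = (\<Sum>e\<in>star n s v. \<bar>sum \<delta> e\<bar>)"

abbreviation N2 :: real where "N2 \<equiv> L2_set \<delta> {1..n}"

abbreviation b :: real where "b \<equiv> stard n s"

lemma sum_\<delta>: "sum \<delta> e = sum \<gamma>' e - sum \<gamma> e"
  unfolding \<delta>_def by (simp add: sum_subtractf)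

lemma h_nonneg: "0 \<le> h v"
  unfolding h_def by (intro sum_nonneg) auto

lemma sum_abs_\<delta>_le: "(\<Sum>e\<in>ssubsets n s. \<bar>sum \<delta> e\<bar>) \<le> b * sqrt n * N2"
  using sum_edges_abs_le[OF A.s1] by (simp add: L2_set_def)

lemma sum_h_le: "(\<Sum>v=1..n. h v) \<le> real s * (b * sqrt n * N2)"
proof -
  have "(\<Sum>v=1..n. h v) = (\<Sum>e\<in>ssubsets n s. \<Sum>v\<in>e. \<bar>sum \<delta> e\<bar>)"
    unfolding h_def by (rule sum_star_swap)
  also have "\<dots> = real s * (\<Sum>e\<in>ssubsets n s. \<bar>sum \<delta> e\<bar>)"
    unfolding sum_distrib_left by (intro sum.cong refl) (auto dest: ssubsetsD)
  finally show ?thesis using sum_abs_\<delta>_le by (simp add: mult_left_mono)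
qed

lemma ab_pos: "0 < a * b"
  using A.a_pos A.b_pos by simp

text \<open>In the second bound one factor is estimated trivially by 1 / (a * b). The square is then
  still linear in \<open>h v\<close>, so the bound for the total of \<open>h\<close> applies and no
  second moment of \<open>h\<close> arises.\<close>

lemma inverse_D_diff:
  assumes "v \<in> {1..n}"
  shows "\<bar>1 / B.D v - 1 / A.D v\<bar> \<le> h v / (a * b)\<^sup>2"
    and "(1 / B.D v - 1 / A.D v)\<^sup>2 \<le> h v / (a * b) ^ 3"
proof -
  note D = A.D_pos[OF assms] B.D_pos[OF assms] A.D_ge[OF assms] B.D_ge[OF assms]
  have "\<bar>A.D v - B.D v\<bar> \<le> h v"
  proof -
    have "\<bar>A.D v - B.D v\<bar> \<le> (\<Sum>e\<in>star n s v. \<bar>sigvar (sum \<gamma> e) - sigvar (sum \<gamma>' e)\<bar>)"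
      unfolding info_def sum_subtractf[symmetric] by (rule sum_abs)
    also have "\<dots> \<le> h v"
      unfolding h_def sum_\<delta>
    proof (rule sum_mono)
      show "\<bar>sigvar (sum \<gamma> e) - sigvar (sum \<gamma>' e)\<bar> \<le> \<bar>sum \<gamma>' e - sum \<gamma> e\<bar>" for e
        using sigvar_lipschitz[of "sum \<gamma>' e" "sum \<gamma> e"] by (simp add: abs_minus_commute)
    qed
    finally show ?thesis .
  qed
  moreover have "(a * b)\<^sup>2 \<le> B.D v * A.D v"
    unfolding power2_eq_square using D ab_pos by (intro mult_mono) auto
  moreover have "\<bar>1 / B.D v - 1 / A.D v\<bar> = \<bar>A.D v - B.D v\<bar> / (B.D v * A.D v)"
    using D by (simp add: diff_frac_eq abs_divide abs_mult)
  ultimately show 1: "\<bar>1 / B.D v - 1 / A.D v\<bar> \<le> h v / (a * b)\<^sup>2"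
    using ab_pos h_nonneg by (simp only:) (intro frac_le, auto)
  have "\<bar>1 / B.D v - 1 / A.D v\<bar> \<le> 1 / (a * b)"
  proof -
    have "0 < 1 / A.D v" "0 < 1 / B.D v" using D by simp_all
    then show ?thesis
      using A.inverse_D_le[OF assms] B.inverse_D_le[OF assms] by linarith
  qed
  then have "\<bar>1 / B.D v - 1 / A.D v\<bar> * \<bar>1 / B.D v - 1 / A.D v\<bar> \<le> 1 / (a * b) * (h v / (a * b)\<^sup>2)"
    using 1 ab_pos by (intro mult_mono) auto
  then show "(1 / B.D v - 1 / A.D v)\<^sup>2 \<le> h v / (a * b) ^ 3"
    by (simp add: power2_eq_square power3_eq_cube)
qed

text \<open>Change the indicators with the new normalisation fixed, then the normalisation with the
  old indicators fixed. Summed over the star, both errors have order h v / b^2.\<close>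

lemma Ex_x_diff_square:
  assumes "v \<in> {1..n}"
  shows "A.Ex (\<lambda>\<omega>. (B.x v \<omega> - A.x v \<omega>)\<^sup>2) \<le> 4 * h v / (a ^ 3 * b\<^sup>2)"
proof -
  let ?i = "1 / B.D v - 1 / A.D v"
  have "A.Ex (\<lambda>\<omega>. (B.x v \<omega> - A.x v \<omega>)\<^sup>2) = A.Ex (\<lambda>\<omega>. (\<Sum>e\<in>star n s v. B.\<zeta> e (\<omega> e) / B.D v - A.\<zeta> e (\<omega> e) / A.D v)\<^sup>2)"
    unfolding newton_def A.A_eq B.A_eq by (simp add: sum_subtractf sum_divide_distrib)
  also have "\<dots> = (\<Sum>e\<in>star n s v. measure_pmf.expectation (q e) (\<lambda>z. (B.\<zeta> e z / B.D v - A.\<zeta> e z / A.D v)\<^sup>2))"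
    using A.\<zeta>_centered B.\<zeta>_centered starD by (intro A.second_moment_linear A.star_subset) auto
  also have "\<dots> \<le> (\<Sum>e\<in>star n s v. 2 * \<bar>sum \<delta> e\<bar> / (a * b)\<^sup>2 + 2 * h v / (a * b) ^ 3)"
  proof (rule sum_mono)
    fix e assume "e \<in> star n s v"
    then have e: "e \<in> ssubsets n s" using starD by blast
    have "measure_pmf.expectation (q e) (\<lambda>z. (B.\<zeta> e z / B.D v - A.\<zeta> e z / A.D v)\<^sup>2)
      \<le> measure_pmf.expectation (q e) (\<lambda>z. 2 * (1 / B.D v)\<^sup>2 * (B.\<zeta> e z - A.\<zeta> e z)\<^sup>2 + 2 * ?i\<^sup>2)"
    proof (rule integral_mono)
      fix z
      have "B.\<zeta> e z / B.D v - A.\<zeta> e z / A.D v = 1 / B.D v * (B.\<zeta> e z - A.\<zeta> e z) + ?i * A.\<zeta> e z"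
        by (simp add: algebra_simps)
      moreover have "(u + w)\<^sup>2 \<le> 2 * u\<^sup>2 + 2 * w\<^sup>2" for u w :: real
        using sum_squares_bound[of u w] by (simp add: power2_sum)
      ultimately have "(B.\<zeta> e z / B.D v - A.\<zeta> e z / A.D v)\<^sup>2
        \<le> 2 * (1 / B.D v * (B.\<zeta> e z - A.\<zeta> e z))\<^sup>2 + 2 * (?i * A.\<zeta> e z)\<^sup>2" by simp
      moreover have "?i\<^sup>2 * (A.\<zeta> e z)\<^sup>2 \<le> ?i\<^sup>2 * 1"
        using A.\<zeta>_abs_le[of e z] by (intro mult_left_mono) (auto simp: abs_square_le_1)
      ultimately show "(B.\<zeta> e z / B.D v - A.\<zeta> e z / A.D v)\<^sup>2 \<le> 2 * (1 / B.D v)\<^sup>2 * (B.\<zeta> e z - A.\<zeta> e z)\<^sup>2 + 2 * ?i\<^sup>2"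
        unfolding power_mult_distrib by linarith
    qed (use e in simp_all)
    also have "\<dots> = 2 * (1 / B.D v)\<^sup>2 * measure_pmf.expectation (q e) (\<lambda>z. (B.\<zeta> e z - A.\<zeta> e z)\<^sup>2) + 2 * ?i\<^sup>2"
      using e by simp
    also have "\<dots> \<le> 2 * (1 / (a * b))\<^sup>2 * \<bar>sum \<delta> e\<bar> + 2 * (h v / (a * b) ^ 3)"
      using coupled[OF e] inverse_D_diff(2)[OF assms] B.inverse_D_le[OF assms] B.D_pos[OF assms]
      by (intro add_mono mult_mono mult_left_mono power_mono) (auto simp: sum_\<delta>)
    finally show "measure_pmf.expectation (q e) (\<lambda>z. (B.\<zeta> e z / B.D v - A.\<zeta> e z / A.D v)\<^sup>2)
      \<le> 2 * \<bar>sum \<delta> e\<bar> / (a * b)\<^sup>2 + 2 * h v / (a * b) ^ 3" by (simp add: power_divide)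
  qed
  also have "\<dots> = 2 * h v / (a * b)\<^sup>2 + b * (2 * h v / (a * b) ^ 3)"
    unfolding sum.distrib h_def sum_divide_distrib[symmetric] sum_distrib_left[symmetric]
    using card_star[OF assms A.s1] by simp
  also have "\<dots> = 2 * h v * (a + 1) / (a ^ 3 * b\<^sup>2)"
    using A.a_pos A.b_pos by (simp add: field_simps power2_eq_square power3_eq_cube)
  also have "\<dots> \<le> 2 * h v * 2 / (a ^ 3 * b\<^sup>2)"
    using A.a_pos A.b_pos A.a_le h_nonneg[of v] by (intro divide_right_mono mult_left_mono) auto
  finally show ?thesis by simp
qed

lemma sum_Ex_xe_diff_square:
  "(\<Sum>e\<in>ssubsets n s. A.Ex (\<lambda>\<omega>. (B.xe e \<omega> - A.xe e \<omega>)\<^sup>2)) \<le> 4 * real s ^ 2 / a ^ 3 * (sqrt n * N2)"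
proof -
  have "(\<Sum>e\<in>ssubsets n s. A.Ex (\<lambda>\<omega>. (B.xe e \<omega> - A.xe e \<omega>)\<^sup>2))
    \<le> (\<Sum>e\<in>ssubsets n s. \<Sum>v\<in>e. real s * (4 * h v / (a ^ 3 * b\<^sup>2)))"
  proof (rule sum_mono)
    fix e assume e: "e \<in> ssubsets n s"
    have "A.Ex (\<lambda>\<omega>. (B.xe e \<omega> - A.xe e \<omega>)\<^sup>2) \<le> A.Ex (\<lambda>\<omega>. real s * (\<Sum>v\<in>e. (B.x v \<omega> - A.x v \<omega>)\<^sup>2))"
      using edge_sum_square_le[OF e] by (intro A.Ex_mono) (simp add: sum_subtractf[symmetric])
    also have "\<dots> = (\<Sum>v\<in>e. real s * A.Ex (\<lambda>\<omega>. (B.x v \<omega> - A.x v \<omega>)\<^sup>2))" by (simp add: sum_distrib_left)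
    also have "\<dots> \<le> (\<Sum>v\<in>e. real s * (4 * h v / (a ^ 3 * b\<^sup>2)))"
      using ssubsets_mem[OF e] by (intro sum_mono mult_left_mono Ex_x_diff_square) auto
    finally show "A.Ex (\<lambda>\<omega>. (B.xe e \<omega> - A.xe e \<omega>)\<^sup>2) \<le> (\<Sum>v\<in>e. real s * (4 * h v / (a ^ 3 * b\<^sup>2)))" .
  qed
  also have "\<dots> = 4 * real s / (a ^ 3 * b) * (\<Sum>v=1..n. h v)"
    unfolding sum_edges_eq[OF A.s1] sum_distrib_left using A.b_pos
    by (intro sum.cong refl) (simp add: power2_eq_square)
  also have "\<dots> \<le> 4 * real s / (a ^ 3 * b) * (real s * (b * sqrt n * N2))"
    using A.a_pos A.b_pos by (intro mult_left_mono sum_h_le) auto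
  also have "\<dots> = 4 * real s ^ 2 / a ^ 3 * (sqrt n * N2)"
    using A.b_pos by (simp add: power2_eq_square)
  finally show ?thesis .
qed

end

section \<open>Comparison of the two Newton drops under the coupling\<close>

definition compare_const :: "nat \<Rightarrow> real \<Rightarrow> real \<Rightarrow> real" where
  "compare_const s a R = 2 * real s / a + 18 * real s ^ 2 / a ^ 3 * (1 + R) + 6 * real s ^ 3 / a\<^sup>2
    + 4 * real s ^ 2 * R / a ^ 3 + 24 * real s ^ 4 / a ^ 4 + real s ^ 3 * R\<^sup>2 / a\<^sup>2 + 6 * real s ^ 4 / a ^ 4"

context coupled_layers
begin

lemma Ex_rem_diff:
  assumes "N2 \<le> R" "0 < t" "t\<^sup>2 = sqrt n"
  shows "A.Ex (\<lambda>\<omega>. \<bar>(\<Sum>e\<in>ssubsets n s. softplus_rem (sum \<gamma>' e) (B.xe e \<omega>)) - (\<Sum>e\<in>ssubsets n s. softplus_rem (sum \<gamma> e) (A.xe e \<omega>))\<bar>)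
    \<le> 4 * real s ^ 2 * R / a ^ 3 * t + 24 * real s ^ 4 / a ^ 4 * t + real s ^ 3 * R\<^sup>2 / a\<^sup>2 + 6 * real s ^ 4 / a ^ 4"
proof -
  let ?P = "\<lambda>e \<omega>. 1 / t * (B.xe e \<omega> - A.xe e \<omega>)\<^sup>2 + 2 * t * (B.xe e \<omega> ^ 4 + A.xe e \<omega> ^ 4)
    + ((sum \<delta> e)\<^sup>2 * (A.xe e \<omega>)\<^sup>2 + A.xe e \<omega> ^ 4)"
  have N2: "0 \<le> N2" by simp
  have pt: "\<bar>softplus_rem (sum \<gamma>' e) u - softplus_rem (sum \<gamma> e) w\<bar>
    \<le> 1 / t * (u - w)\<^sup>2 + 2 * t * (u ^ 4 + w ^ 4) + ((sum \<delta> e)\<^sup>2 * w\<^sup>2 + w ^ 4)" for e u w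
  proof -
    \<comment> \<open>AM-GM with weight \<open>t = n\<^bsup>1/4\<^esup>\<close>, which balances the squared difference, of order
      \<open>\<surd>n\<close> in total, against the bounded fourth moments\<close>
    have amgm: "x * y \<le> 1 / t * x\<^sup>2 + t * y\<^sup>2" for x y
    proof -
      have "0 \<le> 1 / t * (x - t * y)\<^sup>2 + (1 / t * x\<^sup>2 + t * y\<^sup>2)" using assms(2) by (intro add_nonneg_nonneg mult_nonneg_nonneg) auto
      also have "\<dots> = 2 * (1 / t * x\<^sup>2 + t * y\<^sup>2 - x * y)"
        using assms(2) by (simp add: power2_eq_square field_simps)
      finally show ?thesis by simp
    qed
    have "\<bar>u - w\<bar> * (u\<^sup>2 + w\<^sup>2) \<le> 1 / t * \<bar>u - w\<bar>\<^sup>2 + t * (u\<^sup>2 + w\<^sup>2)\<^sup>2" by (rule amgm)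
    also have "(u\<^sup>2 + w\<^sup>2)\<^sup>2 \<le> 2 * (u ^ 4 + w ^ 4)"
      using sum_squares_bound[of "u\<^sup>2" "w\<^sup>2"] by (simp add: power2_sum)
    finally have 1: "\<bar>u - w\<bar> * (u\<^sup>2 + w\<^sup>2) \<le> 1 / t * (u - w)\<^sup>2 + 2 * t * (u ^ 4 + w ^ 4)"
      using assms(2) by (simp add: mult_left_mono mult_ac)
    \<comment> \<open>Changing the base point needs no weight: squares of
      \<open>sum \<delta> e\<close> total at most order b against second moments of order 1/b, and
      fourth moments of order b^(-2) over n * b edges total n / b. Both are bounded.\<close>
    have "\<bar>sum \<delta> e\<bar> * \<bar>w\<bar> ^ 3 = (\<bar>sum \<delta> e\<bar> * \<bar>w\<bar>) * w\<^sup>2" by (simp add: power2_eq_square power3_eq_cube)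
    also have "\<dots> \<le> (\<bar>sum \<delta> e\<bar> * \<bar>w\<bar>)\<^sup>2 + (w\<^sup>2)\<^sup>2"
    proof -
      have "2 * (x * y) \<le> x\<^sup>2 + y\<^sup>2" "0 \<le> x\<^sup>2 + y\<^sup>2" for x y :: real
        using sum_squares_bound[of x y] by (simp_all add: mult_ac)
      then show ?thesis by (smt (verit))
    qed
    also have "\<dots> = (sum \<delta> e)\<^sup>2 * w\<^sup>2 + w ^ 4" by (simp add: power_mult_distrib)
    finally have 2: "\<bar>sum \<delta> e\<bar> * \<bar>w\<bar> ^ 3 \<le> (sum \<delta> e)\<^sup>2 * w\<^sup>2 + w ^ 4" .
    have "\<bar>softplus_rem (sum \<gamma>' e) u - softplus_rem (sum \<gamma> e) w\<bar>
      \<le> \<bar>softplus_rem (sum \<gamma>' e) u - softplus_rem (sum \<gamma>' e) w\<bar> + \<bar>softplus_rem (sum \<gamma>' e) w - softplus_rem (sum \<gamma> e) w\<bar>"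
      by linarith
    also have "\<dots> \<le> \<bar>u - w\<bar> * (u\<^sup>2 + w\<^sup>2) + \<bar>sum \<delta> e\<bar> * \<bar>w\<bar> ^ 3"
      unfolding sum_\<delta> by (intro add_mono softplus_rem_diff softplus_rem_base_diff)
    finally show ?thesis using 1 2 by linarith
  qed
  have "A.Ex (\<lambda>\<omega>. \<bar>(\<Sum>e\<in>ssubsets n s. softplus_rem (sum \<gamma>' e) (B.xe e \<omega>)) - (\<Sum>e\<in>ssubsets n s. softplus_rem (sum \<gamma> e) (A.xe e \<omega>))\<bar>)
    \<le> A.Ex (\<lambda>\<omega>. \<Sum>e\<in>ssubsets n s. ?P e \<omega>)"
  proof (rule A.Ex_mono)
    fix \<omega>
    have "\<bar>(\<Sum>e\<in>ssubsets n s. softplus_rem (sum \<gamma>' e) (B.xe e \<omega>)) - (\<Sum>e\<in>ssubsets n s. softplus_rem (sum \<gamma> e) (A.xe e \<omega>))\<bar>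
      = \<bar>\<Sum>e\<in>ssubsets n s. softplus_rem (sum \<gamma>' e) (B.xe e \<omega>) - softplus_rem (sum \<gamma> e) (A.xe e \<omega>)\<bar>"
      by (simp only: sum_subtractf)
    also have "\<dots> \<le> (\<Sum>e\<in>ssubsets n s. \<bar>softplus_rem (sum \<gamma>' e) (B.xe e \<omega>) - softplus_rem (sum \<gamma> e) (A.xe e \<omega>)\<bar>)"
      by (rule sum_abs)
    also have "\<dots> \<le> (\<Sum>e\<in>ssubsets n s. ?P e \<omega>)" by (rule sum_mono) (rule pt)
    finally show "\<bar>(\<Sum>e\<in>ssubsets n s. softplus_rem (sum \<gamma>' e) (B.xe e \<omega>)) - (\<Sum>e\<in>ssubsets n s. softplus_rem (sum \<gamma> e) (A.xe e \<omega>))\<bar>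
      \<le> (\<Sum>e\<in>ssubsets n s. ?P e \<omega>)" .
  qed
  also have "\<dots> = (\<Sum>e\<in>ssubsets n s. 1 / t * A.Ex (\<lambda>\<omega>. (B.xe e \<omega> - A.xe e \<omega>)\<^sup>2)
    + 2 * t * (A.Ex (\<lambda>\<omega>. B.xe e \<omega> ^ 4) + A.Ex (\<lambda>\<omega>. A.xe e \<omega> ^ 4))
    + ((sum \<delta> e)\<^sup>2 * A.Ex (\<lambda>\<omega>. (A.xe e \<omega>)\<^sup>2) + A.Ex (\<lambda>\<omega>. A.xe e \<omega> ^ 4)))" by simp
  also have "\<dots> \<le> (\<Sum>e\<in>ssubsets n s. 1 / t * A.Ex (\<lambda>\<omega>. (B.xe e \<omega> - A.xe e \<omega>)\<^sup>2)
    + 2 * t * (3 * real s ^ 4 / (a ^ 4 * b\<^sup>2) + 3 * real s ^ 4 / (a ^ 4 * b\<^sup>2))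
    + ((sum \<delta> e)\<^sup>2 * (real s ^ 2 / (a\<^sup>2 * b)) + 3 * real s ^ 4 / (a ^ 4 * b\<^sup>2)))"
    using assms(2) by (intro sum_mono add_mono mult_left_mono A.Ex_xe_power4 B.Ex_xe_power4 A.Ex_xe_square order_refl) auto
  also have "\<dots> = 1 / t * (\<Sum>e\<in>ssubsets n s. A.Ex (\<lambda>\<omega>. (B.xe e \<omega> - A.xe e \<omega>)\<^sup>2))
    + real (card (ssubsets n s)) / b\<^sup>2 * (12 * real s ^ 4 / a ^ 4 * t)
    + real s ^ 2 / (a\<^sup>2 * b) * (\<Sum>e\<in>ssubsets n s. (sum \<delta> e)\<^sup>2)
    + real (card (ssubsets n s)) / b\<^sup>2 * (3 * real s ^ 4 / a ^ 4)"
    by (simp add: sum.distrib sum_distrib_left[symmetric] sum_distrib_right[symmetric] sum_divide_distrib[symmetric] mult_ac)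
  also have "\<dots> \<le> 1 / t * (4 * real s ^ 2 / a ^ 3 * (sqrt n * R)) + 2 * (12 * real s ^ 4 / a ^ 4 * t)
    + real s ^ 2 / (a\<^sup>2 * b) * (real s * b * R\<^sup>2) + 2 * (3 * real s ^ 4 / a ^ 4)"
  proof -
    have "real (card (ssubsets n s)) \<le> (2 * b) * b"
      using A.card_edges_le mult_right_mono[OF A.n_le, of b] by simp
    then have cd: "real (card (ssubsets n s)) / b\<^sup>2 \<le> 2"
      using A.b_pos by (simp add: pos_divide_le_eq power2_eq_square)
    have "(\<Sum>e\<in>ssubsets n s. A.Ex (\<lambda>\<omega>. (B.xe e \<omega> - A.xe e \<omega>)\<^sup>2)) \<le> 4 * real s ^ 2 / a ^ 3 * (sqrt n * R)"
      using A.a_pos assms(1) by (intro order_trans[OF sum_Ex_xe_diff_square] mult_left_mono) auto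
    moreover have "(\<Sum>e\<in>ssubsets n s. (sum \<delta> e)\<^sup>2) \<le> real s * b * R\<^sup>2"
    proof -
      have "(\<Sum>e\<in>ssubsets n s. (sum \<delta> e)\<^sup>2) \<le> real s * b * N2\<^sup>2"
        using sum_edge_square_le[OF A.s1] by (simp add: L2_set_def sum_nonneg)
      also have "\<dots> \<le> real s * b * R\<^sup>2" using assms(1) N2 by (intro mult_left_mono power_mono) auto
      finally show ?thesis .
    qed
    ultimately show ?thesis
      using cd assms(2) A.a_pos A.b_pos by (intro add_mono mult_left_mono mult_right_mono) auto
  qed
  also have "\<dots> = 4 * real s ^ 2 * R / a ^ 3 * t + 24 * real s ^ 4 / a ^ 4 * t + real s ^ 3 * R\<^sup>2 / a\<^sup>2 + 6 * real s ^ 4 / a ^ 4"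
    unfolding assms(3)[symmetric] using assms(2) A.b_pos by (simp add: power2_eq_square power3_eq_cube mult_ac)
  finally show ?thesis .
qed

text \<open>Allows the error from changing the indicator of \<open>f\<close> to be handled by row
  sums, like that of \<open>e\<close>.\<close>

lemma c_sym: "e \<in> ssubsets n s \<Longrightarrow> f \<in> ssubsets n s \<Longrightarrow> A.c e f = A.c f e"
  unfolding A.c_def by (simp add: sum.If_cases ssubsetsD Int_commute)

text \<open>One factor of each square is bounded by the maximal entry, of order 1/b, the other by
  the change of the inverse informations; this keeps the estimate linear in
  \<open>h\<close>.\<close>

lemma sum_c_diff_square:
  "(\<Sum>e\<in>ssubsets n s. \<Sum>f\<in>ssubsets n s. (B.c e f - A.c e f)\<^sup>2) \<le> real s ^ 2 / a ^ 3 * (sqrt n * N2)"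
proof -
  have "(B.c e f - A.c e f)\<^sup>2 \<le> real s / (a * b) * (\<Sum>v\<in>e. if v \<in> f then h v / (a * b)\<^sup>2 else 0)"
    if e: "e \<in> ssubsets n s" for e f
  proof -
    have "\<bar>B.c e f - A.c e f\<bar> \<le> (\<Sum>v\<in>e. \<bar>(if v \<in> f then 1 / B.D v else 0) - (if v \<in> f then 1 / A.D v else 0)\<bar>)"
      unfolding A.c_def B.c_def sum_subtractf[symmetric] by (rule sum_abs)
    also have "\<dots> \<le> (\<Sum>v\<in>e. if v \<in> f then h v / (a * b)\<^sup>2 else 0)"
      using inverse_D_diff(1)[OF ssubsets_mem[OF e]] by (intro sum_mono) auto
    finally have 1: "\<bar>B.c e f - A.c e f\<bar> \<le> (\<Sum>v\<in>e. if v \<in> f then h v / (a * b)\<^sup>2 else 0)" .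
    have 2: "\<bar>B.c e f - A.c e f\<bar> \<le> real s / (a * b)"
      using A.c_bounds[OF e, of f] B.c_bounds[OF e, of f] by linarith
    have "\<bar>B.c e f - A.c e f\<bar> * \<bar>B.c e f - A.c e f\<bar> \<le> real s / (a * b) * (\<Sum>v\<in>e. if v \<in> f then h v / (a * b)\<^sup>2 else 0)"
      using 1 2 ab_pos by (intro mult_mono) auto
    then show ?thesis by (simp add: power2_eq_square)
  qed
  then have "(\<Sum>e\<in>ssubsets n s. \<Sum>f\<in>ssubsets n s. (B.c e f - A.c e f)\<^sup>2)
    \<le> (\<Sum>e\<in>ssubsets n s. \<Sum>f\<in>ssubsets n s. real s / (a * b) * (\<Sum>v\<in>e. if v \<in> f then h v / (a * b)\<^sup>2 else 0))"
    by (intro sum_mono)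
  also have "\<dots> = real s / (a * b) * (\<Sum>e\<in>ssubsets n s. \<Sum>f\<in>ssubsets n s. \<Sum>v\<in>e. if v \<in> f then h v / (a * b)\<^sup>2 else 0)"
    by (simp only: sum_distrib_left)
  also have "\<dots> = real s / (a * b) * (\<Sum>e\<in>ssubsets n s. \<Sum>v\<in>e. b * (h v / (a * b)\<^sup>2))"
  proof (rule arg_cong[where f = "\<lambda>z. real s / (a * b) * z"], rule sum.cong[OF refl])
    fix e assume e: "e \<in> ssubsets n s"
    have "(\<Sum>f\<in>ssubsets n s. \<Sum>v\<in>e. if v \<in> f then h v / (a * b)\<^sup>2 else 0)
      = (\<Sum>v\<in>e. \<Sum>f\<in>ssubsets n s. if v \<in> f then h v / (a * b)\<^sup>2 else 0)" by (rule sum.swap)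
    also have "\<dots> = (\<Sum>v\<in>e. b * (h v / (a * b)\<^sup>2))"
    proof (rule sum.cong[OF refl])
      fix v assume "v \<in> e"
      then have v: "v \<in> {1..n}" using ssubsets_mem[OF e] by blast
      have "(\<Sum>f\<in>ssubsets n s. if v \<in> f then h v / (a * b)\<^sup>2 else 0) = (\<Sum>f\<in>star n s v. h v / (a * b)\<^sup>2)"
        unfolding star_def by (simp add: sum.If_cases Int_def)
      then show "(\<Sum>f\<in>ssubsets n s. if v \<in> f then h v / (a * b)\<^sup>2 else 0) = b * (h v / (a * b)\<^sup>2)"
        using card_star[OF v A.s1] by simp
    qed
    finally show "(\<Sum>f\<in>ssubsets n s. \<Sum>v\<in>e. if v \<in> f then h v / (a * b)\<^sup>2 else 0) = (\<Sum>v\<in>e. b * (h v / (a * b)\<^sup>2))" .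
  qed
  also have "\<dots> = real s / (a ^ 3 * b) * (\<Sum>v=1..n. h v)"
    unfolding sum_edges_eq[OF A.s1] using A.b_pos
    by (simp add: sum_distrib_left[symmetric] sum_divide_distrib[symmetric]) (simp add: power2_eq_square power3_eq_cube mult_ac)
  also have "\<dots> \<le> real s / (a ^ 3 * b) * (real s * (b * sqrt n * N2))"
    using A.a_pos A.b_pos by (intro mult_left_mono sum_h_le) auto
  also have "\<dots> = real s ^ 2 / a ^ 3 * (sqrt n * N2)"
    using A.b_pos by (simp add: power2_eq_square)
  finally show ?thesis .
qed

text \<open>In each row one factor is bounded by the maximal entry and the other summed, giving
  order 1/b; the remaining sum over edges has order b * sqrt n.\<close>

lemma sum_c_square_\<delta>:
  "(\<Sum>e\<in>ssubsets n s. \<Sum>f\<in>ssubsets n s. (A.c e f)\<^sup>2 * \<bar>sum \<delta> e\<bar>) \<le> real s ^ 2 / a ^ 3 * (sqrt n * N2)"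
proof -
  have "(\<Sum>e\<in>ssubsets n s. \<Sum>f\<in>ssubsets n s. (A.c e f)\<^sup>2 * \<bar>sum \<delta> e\<bar>)
    \<le> (\<Sum>e\<in>ssubsets n s. real s / (a * b) * (real s / a) * \<bar>sum \<delta> e\<bar>)"
  proof (rule sum_mono)
    fix e assume e: "e \<in> ssubsets n s"
    have "(\<Sum>f\<in>ssubsets n s. (A.c e f)\<^sup>2 * \<bar>sum \<delta> e\<bar>) \<le> (\<Sum>f\<in>ssubsets n s. real s / (a * b) * A.c e f * \<bar>sum \<delta> e\<bar>)"
      using A.c_bounds[OF e] unfolding power2_eq_square by (intro sum_mono mult_right_mono) auto
    also have "\<dots> = real s / (a * b) * (\<Sum>f\<in>ssubsets n s. A.c e f) * \<bar>sum \<delta> e\<bar>"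
      by (simp only: sum_distrib_left sum_distrib_right)
    also have "\<dots> \<le> real s / (a * b) * (real s / a) * \<bar>sum \<delta> e\<bar>"
      using ab_pos by (intro mult_right_mono mult_left_mono A.sum_c_le e) auto
    finally show "(\<Sum>f\<in>ssubsets n s. (A.c e f)\<^sup>2 * \<bar>sum \<delta> e\<bar>) \<le> real s / (a * b) * (real s / a) * \<bar>sum \<delta> e\<bar>" .
  qed
  also have "\<dots> = real s / (a * b) * (real s / a) * (\<Sum>e\<in>ssubsets n s. \<bar>sum \<delta> e\<bar>)" by (simp only: sum_distrib_left)
  also have "\<dots> \<le> real s / (a * b) * (real s / a) * (b * sqrt n * N2)"
    using ab_pos A.a_pos by (intro mult_left_mono sum_abs_\<delta>_le) auto
  also have "\<dots> = real s ^ 2 / a\<^sup>2 * (sqrt n * N2)" using A.b_pos by (simp add: power2_eq_square)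
  also have "\<dots> \<le> real s ^ 2 / a ^ 3 * (sqrt n * N2)"
  proof (intro mult_right_mono divide_left_mono)
    show "a ^ 3 \<le> a\<^sup>2" using A.a_pos A.a_le by (intro power_decreasing) auto
  qed (use A.a_pos in auto)
  finally show ?thesis .
qed

text \<open>Each of the two forms fluctuates on the scale sqrt n of the normalisation, so only their
  difference can be controlled. It is again a degenerate quadratic form, with second moment of order
  sqrt n, hence mean absolute value of order n^(1/4). The 18 is the factor 2 of the variance bound
  times 3 + 3 + 3 from three replacements.\<close>

lemma Ex_offdiagonal_diff:
  assumes "N2 \<le> R" "0 < t" "t\<^sup>2 = sqrt n"
  shows "A.Ex (\<lambda>\<omega>. \<bar>(\<Sum>e\<in>ssubsets n s. \<Sum>f\<in>ssubsets n s - {e}. B.c e f * (B.\<zeta> e (\<omega> e) * B.\<zeta> f (\<omega> f)))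
      - (\<Sum>e\<in>ssubsets n s. \<Sum>f\<in>ssubsets n s - {e}. A.c e f * (A.\<zeta> e (\<omega> e) * A.\<zeta> f (\<omega> f)))\<bar>)
    \<le> 18 * real s ^ 2 / a ^ 3 * (1 + R) * t"
proof -
  let ?E = "ssubsets n s"
  define u where "u e f x y = B.c e f * (B.\<zeta> e x * B.\<zeta> f y) - A.c e f * (A.\<zeta> e x * A.\<zeta> f y)" for e f x y
  let ?K = "real s ^ 2 / a ^ 3 * (sqrt n * N2)"
  have eq: "(\<Sum>e\<in>?E. \<Sum>f\<in>?E - {e}. B.c e f * (B.\<zeta> e (\<omega> e) * B.\<zeta> f (\<omega> f)))
      - (\<Sum>e\<in>?E. \<Sum>f\<in>?E - {e}. A.c e f * (A.\<zeta> e (\<omega> e) * A.\<zeta> f (\<omega> f)))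
    = (\<Sum>e\<in>?E. \<Sum>f\<in>?E - {e}. u e f (\<omega> e) (\<omega> f))" for \<omega>
    unfolding u_def by (simp add: sum_subtractf)
  have pt: "A.Ex (\<lambda>\<omega>. (u e f (\<omega> e) (\<omega> f))\<^sup>2) \<le> 3 * (B.c e f - A.c e f)\<^sup>2
      + 3 * ((A.c e f)\<^sup>2 * \<bar>sum \<delta> e\<bar>) + 3 * ((A.c f e)\<^sup>2 * \<bar>sum \<delta> f\<bar>)"
    if e: "e \<in> ?E" and f: "f \<in> ?E" for e f
  proof -
    have "A.Ex (\<lambda>\<omega>. (u e f (\<omega> e) (\<omega> f))\<^sup>2) \<le> A.Ex (\<lambda>\<omega>. 3 * (B.c e f - A.c e f)\<^sup>2
      + 3 * (A.c e f)\<^sup>2 * (B.\<zeta> e (\<omega> e) - A.\<zeta> e (\<omega> e))\<^sup>2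
      + 3 * (A.c e f)\<^sup>2 * (B.\<zeta> f (\<omega> f) - A.\<zeta> f (\<omega> f))\<^sup>2)"
    proof (rule A.Ex_mono)
      fix \<omega>
      let ?be = "B.\<zeta> e (\<omega> e)" and ?bf = "B.\<zeta> f (\<omega> f)" and ?ae = "A.\<zeta> e (\<omega> e)" and ?af = "A.\<zeta> f (\<omega> f)"
      have three: "(x + y + z)\<^sup>2 \<le> 3 * x\<^sup>2 + 3 * y\<^sup>2 + 3 * z\<^sup>2" for x y z :: real
      proof -
        have "0 \<le> (x - y)\<^sup>2 + (y - z)\<^sup>2 + (x - z)\<^sup>2" by simp
        then show ?thesis by (simp add: power2_eq_square algebra_simps)
      qed
      have sq: "?be\<^sup>2 \<le> 1" "?bf\<^sup>2 \<le> 1" "?ae\<^sup>2 \<le> 1"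
        using A.\<zeta>_abs_le B.\<zeta>_abs_le by (simp_all add: abs_square_le_1)
      have bnd: "(p * z)\<^sup>2 \<le> p\<^sup>2" if "z\<^sup>2 \<le> 1" for p z :: real
        using mult_left_mono[OF that, of "p\<^sup>2"] by (simp add: power_mult_distrib)
      have bb: "(?be * ?bf)\<^sup>2 \<le> 1" using bnd[OF sq(2), of ?be] sq(1) by linarith
      \<comment> \<open>Telescoping: coefficient, first indicator and second indicator are replaced
        one at a time, the other factors being at most one.\<close>
      have "u e f (\<omega> e) (\<omega> f) = (B.c e f - A.c e f) * (?be * ?bf) + (A.c e f * (?be - ?ae)) * ?bf
          + (A.c e f * (?bf - ?af)) * ?ae"
        unfolding u_def by (simp add: algebra_simps)
      then have "(u e f (\<omega> e) (\<omega> f))\<^sup>2 \<le> 3 * ((B.c e f - A.c e f) * (?be * ?bf))\<^sup>2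
          + 3 * ((A.c e f * (?be - ?ae)) * ?bf)\<^sup>2 + 3 * ((A.c e f * (?bf - ?af)) * ?ae)\<^sup>2"
        using three by simp
      also have "\<dots> \<le> 3 * (B.c e f - A.c e f)\<^sup>2 + 3 * (A.c e f * (?be - ?ae))\<^sup>2 + 3 * (A.c e f * (?bf - ?af))\<^sup>2"
        by (intro add_mono mult_left_mono bnd bb sq) auto
      finally show "(u e f (\<omega> e) (\<omega> f))\<^sup>2 \<le> 3 * (B.c e f - A.c e f)\<^sup>2
          + 3 * (A.c e f)\<^sup>2 * (?be - ?ae)\<^sup>2 + 3 * (A.c e f)\<^sup>2 * (?bf - ?af)\<^sup>2"
        by (simp add: power_mult_distrib mult.assoc)
    qed
    also have "\<dots> = 3 * (B.c e f - A.c e f)\<^sup>2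
      + 3 * (A.c e f)\<^sup>2 * A.Ex (\<lambda>\<omega>. (B.\<zeta> e (\<omega> e) - A.\<zeta> e (\<omega> e))\<^sup>2)
      + 3 * (A.c e f)\<^sup>2 * A.Ex (\<lambda>\<omega>. (B.\<zeta> f (\<omega> f) - A.\<zeta> f (\<omega> f))\<^sup>2)" by simp
    also have "\<dots> = 3 * (B.c e f - A.c e f)\<^sup>2
      + 3 * (A.c e f)\<^sup>2 * measure_pmf.expectation (q e) (\<lambda>z. (B.\<zeta> e z - A.\<zeta> e z)\<^sup>2)
      + 3 * (A.c e f)\<^sup>2 * measure_pmf.expectation (q f) (\<lambda>z. (B.\<zeta> f z - A.\<zeta> f z)\<^sup>2)"
      using A.Ex_component[OF e, of "\<lambda>z. (B.\<zeta> e z - A.\<zeta> e z)\<^sup>2"] A.Ex_component[OF f, of "\<lambda>z. (B.\<zeta> f z - A.\<zeta> f z)\<^sup>2"] by simp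
    also have "\<dots> \<le> 3 * (B.c e f - A.c e f)\<^sup>2 + 3 * (A.c e f)\<^sup>2 * \<bar>sum \<delta> e\<bar> + 3 * (A.c e f)\<^sup>2 * \<bar>sum \<delta> f\<bar>"
      using coupled[OF e] coupled[OF f] by (intro add_mono mult_left_mono order_refl) (auto simp: sum_\<delta>)
    finally show ?thesis using c_sym[OF e f] by (simp add: mult.assoc)
  qed
  have "A.Ex (\<lambda>\<omega>. (\<Sum>e\<in>?E. \<Sum>f\<in>?E - {e}. u e f (\<omega> e) (\<omega> f))\<^sup>2)
     \<le> 2 * (\<Sum>e\<in>?E. \<Sum>f\<in>?E - {e}. A.Ex (\<lambda>\<omega>. (u e f (\<omega> e) (\<omega> f))\<^sup>2))"
    using A.\<zeta>_centered B.\<zeta>_centered by (intro A.second_moment_chaos) (auto simp: u_def)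
  also have "\<dots> \<le> 2 * (\<Sum>e\<in>?E. \<Sum>f\<in>?E. A.Ex (\<lambda>\<omega>. (u e f (\<omega> e) (\<omega> f))\<^sup>2))"
    by (intro mult_left_mono sum_mono sum_mono2) (auto intro!: A.Ex_nonneg)
  also have "\<dots> \<le> 2 * (\<Sum>e\<in>?E. \<Sum>f\<in>?E. 3 * (B.c e f - A.c e f)\<^sup>2
      + 3 * ((A.c e f)\<^sup>2 * \<bar>sum \<delta> e\<bar>) + 3 * ((A.c f e)\<^sup>2 * \<bar>sum \<delta> f\<bar>))"
    by (intro mult_left_mono sum_mono pt) auto
  also have "\<dots> = 2 * (3 * (\<Sum>e\<in>?E. \<Sum>f\<in>?E. (B.c e f - A.c e f)\<^sup>2)
      + 3 * (\<Sum>e\<in>?E. \<Sum>f\<in>?E. (A.c e f)\<^sup>2 * \<bar>sum \<delta> e\<bar>) + 3 * (\<Sum>e\<in>?E. \<Sum>f\<in>?E. (A.c f e)\<^sup>2 * \<bar>sum \<delta> f\<bar>))"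
    by (simp only: sum.distrib sum_distrib_left)
  also have "(\<Sum>e\<in>?E. \<Sum>f\<in>?E. (A.c f e)\<^sup>2 * \<bar>sum \<delta> f\<bar>) = (\<Sum>e\<in>?E. \<Sum>f\<in>?E. (A.c e f)\<^sup>2 * \<bar>sum \<delta> e\<bar>)"
    by (rule sum.swap)
  also have "2 * (3 * (\<Sum>e\<in>?E. \<Sum>f\<in>?E. (B.c e f - A.c e f)\<^sup>2)
      + 3 * (\<Sum>e\<in>?E. \<Sum>f\<in>?E. (A.c e f)\<^sup>2 * \<bar>sum \<delta> e\<bar>) + 3 * (\<Sum>e\<in>?E. \<Sum>f\<in>?E. (A.c e f)\<^sup>2 * \<bar>sum \<delta> e\<bar>))
    \<le> 2 * (3 * ?K + 3 * ?K + 3 * ?K)"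
    by (intro mult_left_mono add_mono sum_c_diff_square sum_c_square_\<delta>) auto
  also have "\<dots> = 18 * real s ^ 2 / a ^ 3 * N2 * t\<^sup>2" unfolding assms(3) by simp
  \<comment> \<open>\<open>?Q\<close> and \<open>1 + R\<close> are both at least one, so squaring
    them only enlarges the bound and the constant stays free of square roots.\<close>
  also have "\<dots> \<le> (18 * real s ^ 2 / a ^ 3 * (1 + R) * t)\<^sup>2"
  proof -
    let ?Q = "18 * real s ^ 2 / a ^ 3"
    have "a ^ 3 \<le> 1" using A.a_pos A.a_le by (intro power_le_one) auto
    moreover have "1 \<le> real s ^ 2" using A.s1 by (intro one_le_power) simp
    ultimately have Q: "1 \<le> ?Q" using A.a_pos by (simp add: pos_le_divide_eq)
    have R: "0 \<le> N2" "N2 \<le> R" "0 \<le> R" using assms(1) order_trans[OF L2_set_nonneg assms(1)] by auto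
    have "?Q * N2 \<le> ?Q * ((1 + R) * 1)" using Q R by (intro mult_left_mono) auto
    also have "\<dots> \<le> ?Q * ((1 + R) * (?Q * (1 + R)))"
      using Q R mult_mono[of 1 ?Q 1 "1 + R"] by (intro mult_left_mono) auto
    finally have "?Q * N2 * t\<^sup>2 \<le> ?Q * ((1 + R) * (?Q * (1 + R))) * t\<^sup>2" by (rule mult_right_mono) simp
    moreover have "Q * ((1 + R) * (Q * (1 + R))) * t\<^sup>2 = (Q * (1 + R) * t)\<^sup>2" for Q
      by (simp only: power2_eq_square mult_ac)
    ultimately show ?thesis by (simp only:)
  qed
  finally have "sqrt (A.Ex (\<lambda>\<omega>. (\<Sum>e\<in>?E. \<Sum>f\<in>?E - {e}. u e f (\<omega> e) (\<omega> f))\<^sup>2)) \<le> 18 * real s ^ 2 / a ^ 3 * (1 + R) * t"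
    using assms A.a_pos order_trans[OF L2_set_nonneg assms(1)] by (intro real_le_lsqrt A.Ex_nonneg) auto
  then show ?thesis unfolding eq by (rule order_trans[OF A.Ex_abs_le])
qed

text \<open>The diagonals are compared with their common mean \<open>n\<close> and the
  \<open>cross\<close> terms with zero, each at bounded cost; the off-diagonal forms and the
  third-order remainders only with each other, at cost \<open>t\<close>, the fourth root of
  n.\<close>

lemma Ex_newton_value_diff:
  assumes "N2 \<le> R" "1 \<le> t" "t\<^sup>2 = sqrt n"
  shows "A.Ex (\<lambda>\<omega>. \<bar>(neg_log_lik n s (B.Hyp \<omega>) \<gamma>' - neg_log_lik n s (B.Hyp \<omega>) (B.y \<omega>))
      - (neg_log_lik n s (A.Hyp \<omega>) \<gamma> - neg_log_lik n s (A.Hyp \<omega>) (A.y \<omega>))\<bar>) \<le> compare_const s a R * t"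
proof -
  let ?E = "ssubsets n s"
  let ?dA = "\<lambda>\<omega>. \<bar>(\<Sum>e\<in>?E. A.c e e * (A.\<zeta> e (\<omega> e))\<^sup>2) - real n\<bar>"
  let ?dB = "\<lambda>\<omega>. \<bar>(\<Sum>e\<in>?E. B.c e e * (B.\<zeta> e (\<omega> e))\<^sup>2) - real n\<bar>"
  let ?off = "\<lambda>\<omega>. \<bar>(\<Sum>e\<in>?E. \<Sum>f\<in>?E - {e}. B.c e f * (B.\<zeta> e (\<omega> e) * B.\<zeta> f (\<omega> f)))
      - (\<Sum>e\<in>?E. \<Sum>f\<in>?E - {e}. A.c e f * (A.\<zeta> e (\<omega> e) * A.\<zeta> f (\<omega> f)))\<bar>"
  let ?lA = "\<lambda>\<omega>. \<bar>\<Sum>v=1..n. A.x v \<omega> * A.L v \<omega>\<bar>"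
  let ?lB = "\<lambda>\<omega>. \<bar>\<Sum>v=1..n. B.x v \<omega> * B.L v \<omega>\<bar>"
  let ?r = "\<lambda>\<omega>. \<bar>(\<Sum>e\<in>?E. softplus_rem (sum \<gamma>' e) (B.xe e \<omega>)) - (\<Sum>e\<in>?E. softplus_rem (sum \<gamma> e) (A.xe e \<omega>))\<bar>"
  have tri: "\<bar>(dB + oB) / 2 - lB / 2 - rB - ((dA + oA) / 2 - lA / 2 - rA)\<bar>
      \<le> 1 / 2 * \<bar>dA - m\<bar> + 1 / 2 * \<bar>dB - m\<bar> + \<bar>oB - oA\<bar> + 1 / 2 * \<bar>lA\<bar> + 1 / 2 * \<bar>lB\<bar> + \<bar>rB - rA\<bar>"
    for dA dB oA oB lA lB rA rB m :: real
  proof -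
    \<comment> \<open>Every absolute value becomes a variable dominating both signs, which leaves
      linear arithmetic. The off-diagonal difference occurs with weight 1/2 but is bounded with
      weight 1, so \<open>0 \<le> p3\<close> has to be supplied.\<close>
    have aux: "\<bar>(dB + oB) / 2 - lB / 2 - rB - ((dA + oA) / 2 - lA / 2 - rA)\<bar>
        \<le> 1 / 2 * p1 + 1 / 2 * p2 + p3 + 1 / 2 * p4 + 1 / 2 * p5 + p6"
      if "dA - m \<le> p1" "- (dA - m) \<le> p1" "dB - m \<le> p2" "- (dB - m) \<le> p2" "oB - oA \<le> p3" "- (oB - oA) \<le> p3"
        "lA \<le> p4" "- lA \<le> p4" "lB \<le> p5" "- lB \<le> p5" "rB - rA \<le> p6" "- (rB - rA) \<le> p6"
      for p1 p2 p3 p4 p5 p6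
    proof -
      have "0 \<le> p3" using that by linarith
      then show ?thesis unfolding abs_le_iff using that by (simp add: field_simps)
    qed
    show ?thesis by (rule aux) (rule abs_ge_self abs_ge_minus_self)+
  qed
  have "A.Ex (\<lambda>\<omega>. \<bar>(neg_log_lik n s (B.Hyp \<omega>) \<gamma>' - neg_log_lik n s (B.Hyp \<omega>) (B.y \<omega>))
      - (neg_log_lik n s (A.Hyp \<omega>) \<gamma> - neg_log_lik n s (A.Hyp \<omega>) (A.y \<omega>))\<bar>)
    \<le> A.Ex (\<lambda>\<omega>. 1 / 2 * ?dA \<omega> + 1 / 2 * ?dB \<omega> + ?off \<omega> + 1 / 2 * ?lA \<omega> + 1 / 2 * ?lB \<omega> + ?r \<omega>)"
  proof (rule A.Ex_mono)
    fix \<omega>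
    have nzA: "A.D v \<noteq> 0" and nzB: "B.D v \<noteq> 0" if "v \<in> {1..n}" for v
      using A.D_pos[OF that] B.D_pos[OF that] by auto
    have eA: "neg_log_lik n s (A.Hyp \<omega>) \<gamma> - neg_log_lik n s (A.Hyp \<omega>) (A.y \<omega>) =
      (\<Sum>v=1..n. (A.A v \<omega>)\<^sup>2 / A.D v) / 2 - (\<Sum>v=1..n. A.x v \<omega> * A.L v \<omega>) / 2
      - (\<Sum>e\<in>?E. softplus_rem (sum \<gamma> e) (A.xe e \<omega>))"
      by (rule neg_log_lik_newton_step[OF A.Hyp_subset nzA])
    have eB: "neg_log_lik n s (B.Hyp \<omega>) \<gamma>' - neg_log_lik n s (B.Hyp \<omega>) (B.y \<omega>) =
      (\<Sum>v=1..n. (B.A v \<omega>)\<^sup>2 / B.D v) / 2 - (\<Sum>v=1..n. B.x v \<omega> * B.L v \<omega>) / 2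
      - (\<Sum>e\<in>?E. softplus_rem (sum \<gamma>' e) (B.xe e \<omega>))"
      by (rule neg_log_lik_newton_step[OF B.Hyp_subset nzB])
    show "\<bar>(neg_log_lik n s (B.Hyp \<omega>) \<gamma>' - neg_log_lik n s (B.Hyp \<omega>) (B.y \<omega>))
      - (neg_log_lik n s (A.Hyp \<omega>) \<gamma> - neg_log_lik n s (A.Hyp \<omega>) (A.y \<omega>))\<bar>
      \<le> 1 / 2 * ?dA \<omega> + 1 / 2 * ?dB \<omega> + ?off \<omega> + 1 / 2 * ?lA \<omega> + 1 / 2 * ?lB \<omega> + ?r \<omega>"
      unfolding eA eB A.sum_A_square_eq B.sum_A_square_eq by (rule tri)
  qed
  also have "\<dots> = 1 / 2 * A.Ex ?dA + 1 / 2 * A.Ex ?dB + A.Ex ?off + 1 / 2 * A.Ex ?lA + 1 / 2 * A.Ex ?lB + A.Ex ?r"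
    by simp
  also have "\<dots> \<le> 1 / 2 * (2 * real s / a) + 1 / 2 * (2 * real s / a) + 18 * real s ^ 2 / a ^ 3 * (1 + R) * t
    + 1 / 2 * (6 * real s ^ 3 / a\<^sup>2) + 1 / 2 * (6 * real s ^ 3 / a\<^sup>2)
    + (4 * real s ^ 2 * R / a ^ 3 * t + 24 * real s ^ 4 / a ^ 4 * t + real s ^ 3 * R\<^sup>2 / a\<^sup>2 + 6 * real s ^ 4 / a ^ 4)"
    using assms
    by (intro add_mono mult_left_mono A.Ex_abs_diagonal B.Ex_abs_diagonal A.Ex_abs_x_L B.Ex_abs_x_L
        Ex_offdiagonal_diff Ex_rem_diff) auto
  also have "\<dots> \<le> compare_const s a R * t"
  proof -
    \<comment> \<open>Since \<open>t\<close> is at least one, the bounded contributions are also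
      absorbed into multiples of \<open>t\<close>.\<close>
    have mono: "z \<le> z * t" if "0 \<le> z" for z using mult_left_mono[OF assms(2) that] by simp
    have "2 * real s / a \<le> 2 * real s / a * t" "6 * real s ^ 3 / a\<^sup>2 \<le> 6 * real s ^ 3 / a\<^sup>2 * t"
      "real s ^ 3 * R\<^sup>2 / a\<^sup>2 \<le> real s ^ 3 * R\<^sup>2 / a\<^sup>2 * t" "6 * real s ^ 4 / a ^ 4 \<le> 6 * real s ^ 4 / a ^ 4 * t"
      by (intro mono; use A.a_pos in simp)+
    then show ?thesis unfolding compare_const_def distrib_right by linarith
  qed
  finally show ?thesis .
qed

end

text \<open>The Kullback-Leibler divergence of the model at \<open>\<gamma>\<close> from the model
  at \<open>\<gamma>'\<close>: for Bernoulli laws in logit form it is the Bregman divergence of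
  softplus based at the parameter generating the data.\<close>

definition LR_shift :: "nat \<Rightarrow> nat \<Rightarrow> (nat \<Rightarrow> real) \<Rightarrow> (nat \<Rightarrow> real) \<Rightarrow> real" where
  "LR_shift n s \<gamma> \<gamma>' = (\<Sum>e\<in>ssubsets n s. softplus_breg (sum \<gamma>' e) (sum \<gamma> e - sum \<gamma>' e))"

context coupled_layers
begin

text \<open>Expanding the likelihood of the second hypergraph from \<open>\<gamma>'\<close> to
  \<open>\<gamma>\<close> writes its ratio as a drop from its own true parameter, plus a linear
  score term, plus \<open>LR_shift\<close>. On the two good events both drops from the truth may be
  replaced by Newton drops, which the coupling makes close.\<close>

lemma LR_transfer:
  assumes K: "\<And>v. v \<in> {1..n} \<Longrightarrow> \<bar>\<gamma> v\<bar> \<le> K" "\<And>v. v \<in> {1..n} \<Longrightarrow> \<bar>\<gamma>' v\<bar> \<le> K"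
    and mle: "mle_estimator n s bhat"
    and R: "N2 \<le> R" and t: "1 \<le> t" "t\<^sup>2 = sqrt n" and u: "0 < u"
  defines "m \<equiv> sigvar_min (real s * (K + 1 + 1))"
  shows "measure_pmf.prob A.prodP {\<omega>. u < \<bar>log_LR n s \<gamma> bhat (B.Hyp \<omega>) - log_LR n s \<gamma> bhat (A.Hyp \<omega>) - LR_shift n s \<gamma> \<gamma>'\<bar>}
    \<le> 2 * bad_const s a m / n + (compare_const s a R * t + 40 * real s ^ 4 / (a ^ 4 * m) + sqrt (real s * b) * N2) / u"
proof -
  let ?l = "neg_log_lik n s"
  let ?S = "{\<omega>. u < \<bar>log_LR n s \<gamma> bhat (B.Hyp \<omega>) - log_LR n s \<gamma> bhat (A.Hyp \<omega>) - LR_shift n s \<gamma> \<gamma>'\<bar>}"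
  let ?d = "\<lambda>\<omega>. \<bar>(?l (B.Hyp \<omega>) \<gamma>' - ?l (B.Hyp \<omega>) (B.y \<omega>)) - (?l (A.Hyp \<omega>) \<gamma> - ?l (A.Hyp \<omega>) (A.y \<omega>))\<bar>"
  let ?eA = "\<lambda>\<omega>. (score_norm n s (A.Hyp \<omega>) (A.y \<omega>))\<^sup>2 / (2 * A.curv K)"
  let ?eB = "\<lambda>\<omega>. (score_norm n s (B.Hyp \<omega>) (B.y \<omega>))\<^sup>2 / (2 * B.curv K)"
  let ?n = "\<lambda>\<omega>. \<bar>\<Sum>v=1..n. \<delta> v * B.A v \<omega>\<bar>"
  let ?Y = "\<lambda>\<omega>. ?d \<omega> + ?eA \<omega> + ?eB \<omega> + ?n \<omega>"
  have sub: "?S \<subseteq> {\<omega>. \<not> A.Good K \<omega>} \<union> {\<omega>. \<not> B.Good K \<omega>} \<union> {\<omega>. u < ?Y \<omega>}"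
  proof
    fix \<omega> assume w: "\<omega> \<in> ?S"
    have "u < ?Y \<omega>" if "A.Good K \<omega>" "B.Good K \<omega>"
    proof -
      have "?l (B.Hyp \<omega>) (\<lambda>v. \<gamma>' v + - \<delta> v) = ?l (B.Hyp \<omega>) \<gamma>' - (\<Sum>v=1..n. - \<delta> v * B.A v \<omega>)
        + (\<Sum>e\<in>ssubsets n s. softplus_breg (sum \<gamma>' e) (sum (\<lambda>v. - \<delta> v) e))"
        by (rule neg_log_lik_expand[OF B.Hyp_subset])
      moreover have "(\<lambda>v. \<gamma>' v + - \<delta> v) = \<gamma>" unfolding \<delta>_def by auto
      moreover have "sum (\<lambda>v. - \<delta> v) e = sum \<gamma> e - sum \<gamma>' e" for e unfolding sum_negf sum_\<delta> by simp
      ultimately have l: "?l (B.Hyp \<omega>) \<gamma> = ?l (B.Hyp \<omega>) \<gamma>' + (\<Sum>v=1..n. \<delta> v * B.A v \<omega>) + LR_shift n s \<gamma> \<gamma>'"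
        unfolding LR_shift_def by (simp add: sum_negf)
      have tri: "\<bar>(p + w + z - q) - (p' - q') - z\<bar> \<le> \<bar>(p - r) - (p' - r')\<bar> + e' + e + \<bar>w\<bar>"
        if "\<bar>r - q\<bar> \<le> e" "\<bar>r' - q'\<bar> \<le> e'" for p w z q p' q' r r' e e' :: real
        using that by linarith
      have "\<bar>log_LR n s \<gamma> bhat (B.Hyp \<omega>) - log_LR n s \<gamma> bhat (A.Hyp \<omega>) - LR_shift n s \<gamma> \<gamma>'\<bar> \<le> ?Y \<omega>"
        unfolding log_LR_def l
      proof (rule tri)
        show "\<bar>?l (B.Hyp \<omega>) (B.y \<omega>) - ?l (B.Hyp \<omega>) (bhat (B.Hyp \<omega>))\<bar> \<le> ?eB \<omega>"
          by (rule B.Good_mle[OF K(2) that(2) mle])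
        show "\<bar>?l (A.Hyp \<omega>) (A.y \<omega>) - ?l (A.Hyp \<omega>) (bhat (A.Hyp \<omega>))\<bar> \<le> ?eA \<omega>"
          by (rule A.Good_mle[OF K(1) that(1) mle])
      qed
      with w show ?thesis by simp
    qed
    then show "\<omega> \<in> {\<omega>. \<not> A.Good K \<omega>} \<union> {\<omega>. \<not> B.Good K \<omega>} \<union> {\<omega>. u < ?Y \<omega>}" by auto
  qed
  have "measure_pmf.prob A.prodP ?S \<le> measure_pmf.prob A.prodP ({\<omega>. \<not> A.Good K \<omega>} \<union> {\<omega>. \<not> B.Good K \<omega>} \<union> {\<omega>. u < ?Y \<omega>})"
    by (rule measure_pmf.finite_measure_mono[OF sub]) simp
  also have "\<dots> \<le> measure_pmf.prob A.prodP ({\<omega>. \<not> A.Good K \<omega>} \<union> {\<omega>. \<not> B.Good K \<omega>}) + measure_pmf.prob A.prodP {\<omega>. u < ?Y \<omega>}"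
    by (rule measure_Un_le) auto
  also have "measure_pmf.prob A.prodP ({\<omega>. \<not> A.Good K \<omega>} \<union> {\<omega>. \<not> B.Good K \<omega>})
      \<le> measure_pmf.prob A.prodP {\<omega>. \<not> A.Good K \<omega>} + measure_pmf.prob A.prodP {\<omega>. \<not> B.Good K \<omega>}"
    by (rule measure_Un_le) auto
  also have "\<dots> \<le> bad_const s a m / n + bad_const s a m / n"
    unfolding m_def by (intro add_mono A.prob_not_Good B.prob_not_Good)
  also have "measure_pmf.prob A.prodP {\<omega>. u < ?Y \<omega>} \<le> A.Ex ?Y / u"
    using A.curv_pos[of K] B.curv_pos[of K] by (intro A.Markov_Ex u) simp
  also have "A.Ex ?Y = A.Ex ?d + A.Ex ?eA + A.Ex ?eB + A.Ex ?n" by simp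
  also have "\<dots> \<le> compare_const s a R * t + 20 * real s ^ 4 / (a ^ 4 * m) + 20 * real s ^ 4 / (a ^ 4 * m) + sqrt (real s * b) * N2"
    unfolding m_def
    by (intro add_mono Ex_newton_value_diff[OF R t] A.Ex_mle_error B.Ex_mle_error B.Ex_abs_linear_score)
  finally show ?thesis using u by (simp add: divide_right_mono mult_ac add_ac)
qed

end

section \<open>Coupling of Bernoulli variables and of the two hypergraphs\<close>

lemma bernoulli_coupling_aux:
  fixes p p' :: real
  assumes "0 < p" "p \<le> p'" "p' < 1"
  shows "\<exists>q :: (bool \<times> bool) pmf. map_pmf fst q = bernoulli_pmf p \<and> map_pmf snd q = bernoulli_pmf p'
    \<and> measure_pmf.expectation q (\<lambda>z. (of_bool (snd z) - of_bool (fst z))\<^sup>2) = p' - p"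
proof -
  \<comment> \<open>Thinning: a success of the larger variable is kept with independent probability
    \<open>p / p'\<close>. The first indicator then never exceeds the second, so the squared
    difference is the difference itself, with mean \<open>p' - p\<close>.\<close>
  let ?Q = "pair_pmf (bernoulli_pmf p') (bernoulli_pmf (p / p'))"
  let ?q = "map_pmf (\<lambda>(x, u). (x \<and> u, x)) ?Q"
  have snd: "map_pmf snd ?q = bernoulli_pmf p'"
  proof -
    have "map_pmf snd ?q = map_pmf fst ?Q"
      unfolding map_pmf_comp by (rule map_pmf_cong[OF refl]) (simp add: case_prod_unfold)
    then show ?thesis by (simp only: map_fst_pair_pmf)
  qed
  have r: "0 \<le> p / p'" "p / p' \<le> 1" using assms by auto
  have fst_True: "pmf (map_pmf fst ?q) True = p"
  proof -
    have "map_pmf fst ?q = map_pmf (\<lambda>z. fst z \<and> snd z) ?Q"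
      unfolding map_pmf_comp by (rule map_pmf_cong[OF refl]) (simp only: case_prod_unfold fst_conv)
    also have "pmf \<dots> True = measure_pmf.prob ?Q {(True, True)}"
    proof -
      have "(\<lambda>z. fst z \<and> snd z) -` {True} = {(True, True)}"
        unfolding vimage_def by (simp add: prod_eq_iff set_eq_iff)
      then show ?thesis unfolding pmf_map by (simp only:)
    qed
    also have "\<dots> = pmf ?Q (True, True)" by (rule measure_pmf_single)
    also have "\<dots> = p' * (p / p')"
    proof -
      have "0 \<le> p'" "p' \<le> 1" using assms by auto
      then show ?thesis unfolding pmf_pair using r by simp
    qed
    also have "\<dots> = p" using assms by simp
    finally show ?thesis .
  qed
  have bern: "M = bernoulli_pmf c" if "pmf M True = c" "0 \<le> c" "c \<le> 1" for M :: "bool pmf" and c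
  proof (rule pmf_eqI)
    fix i
    have "pmf M True + pmf M False = 1"
      using sum_pmf_eq_1[OF finite subset_UNIV, of M] by (simp add: UNIV_bool add.commute)
    then show "pmf M i = pmf (bernoulli_pmf c) i" using that by (cases i) auto
  qed
  have fst: "map_pmf fst ?q = bernoulli_pmf p" by (rule bern[OF fst_True]) (use assms in auto)
  have fin: "finite (set_pmf ?q)" by (rule finite_subset[OF subset_UNIV]) simp
  have "measure_pmf.expectation ?q (\<lambda>z. (of_bool (snd z) - of_bool (fst z))\<^sup>2)
    = measure_pmf.expectation ?q (\<lambda>z. of_bool (snd z) - of_bool (fst z) :: real)"
    unfolding integral_map_pmf by (rule Bochner_Integration.integral_cong[OF refl]) (auto split: prod.splits)
  also have "\<dots> = measure_pmf.expectation ?q (\<lambda>z. of_bool (snd z)) - measure_pmf.expectation ?q (\<lambda>z. of_bool (fst z))"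
    by (intro Bochner_Integration.integral_diff integrable_measure_pmf_finite fin)
  also have "\<dots> = measure_pmf.expectation (map_pmf snd ?q) of_bool - measure_pmf.expectation (map_pmf fst ?q) of_bool"
    by (simp only: integral_map_pmf)
  also have "\<dots> = p' - p" unfolding fst snd using assms by (simp add: integral_bernoulli_pmf)
  finally show ?thesis using fst snd by blast
qed

lemma bernoulli_coupling:
  fixes p p' :: real
  assumes "0 < p" "p < 1" "0 < p'" "p' < 1"
  shows "\<exists>q :: (bool \<times> bool) pmf. map_pmf fst q = bernoulli_pmf p \<and> map_pmf snd q = bernoulli_pmf p'
    \<and> measure_pmf.expectation q (\<lambda>z. (of_bool (snd z) - of_bool (fst z))\<^sup>2) = \<bar>p' - p\<bar>"
proof (cases "p \<le> p'")
  case True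
  then show ?thesis using bernoulli_coupling_aux[of p p'] assms by simp
next
  case False
  then obtain q :: "(bool \<times> bool) pmf" where q: "map_pmf fst q = bernoulli_pmf p'" "map_pmf snd q = bernoulli_pmf p"
    "measure_pmf.expectation q (\<lambda>z. (of_bool (snd z) - of_bool (fst z))\<^sup>2) = p - p'"
    using bernoulli_coupling_aux[of p' p] assms by auto
  show ?thesis
    using q False
    by (intro exI[of _ "map_pmf prod.swap q"]) (simp add: map_pmf_comp power2_commute)
qed

text \<open>Edgewise couplings are multiplied over all hyperedges. One \<open>Q\<close> serves every
  threshold \<open>u\<close>, which allows the threshold to grow with the shift in the regime of
  large distances.\<close>

lemma LR_coupling:
  assumes s: "2 \<le> s" "2 * s \<le> n"
    and K: "\<And>v. v \<in> {1..n} \<Longrightarrow> \<bar>\<gamma> v\<bar> \<le> K" "\<And>v. v \<in> {1..n} \<Longrightarrow> \<bar>\<gamma>' v\<bar> \<le> K"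
    and mle: "mle_estimator n s bhat"
    and R: "l2_dist n \<gamma>' \<gamma> \<le> R"
  defines "m \<equiv> sigvar_min (real s * (K + 1 + 1))" and "a \<equiv> sigvar_min (real s * K)"
  shows "\<exists>Q. map_pmf fst Q = beta_model n s \<gamma> \<and> map_pmf snd Q = beta_model n s \<gamma>' \<and>
    (\<forall>u>0. measure_pmf.prob Q {z. u < \<bar>log_LR n s \<gamma> bhat (snd z) - log_LR n s \<gamma> bhat (fst z) - LR_shift n s \<gamma> \<gamma>'\<bar>}
      \<le> 2 * bad_const s a m / n + (compare_const s a R * sqrt (sqrt n) + 40 * real s ^ 4 / (a ^ 4 * m)
          + sqrt (real s * stard n s) * l2_dist n \<gamma>' \<gamma>) / u)"
proof -
  have "\<forall>e. \<exists>q :: (bool \<times> bool) pmf. map_pmf fst q = bernoulli_pmf (edge_prob \<gamma> e) \<and> map_pmf snd q = bernoulli_pmf (edge_prob \<gamma>' e)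
    \<and> measure_pmf.expectation q (\<lambda>z. (of_bool (snd z) - of_bool (fst z))\<^sup>2) = \<bar>edge_prob \<gamma>' e - edge_prob \<gamma> e\<bar>"
    unfolding edge_prob_sigmoid by (intro allI bernoulli_coupling sigmoid_bounds)
  then have "\<exists>q :: nat set \<Rightarrow> (bool \<times> bool) pmf. \<forall>e. map_pmf fst (q e) = bernoulli_pmf (edge_prob \<gamma> e) \<and> map_pmf snd (q e) = bernoulli_pmf (edge_prob \<gamma>' e)
    \<and> measure_pmf.expectation (q e) (\<lambda>z. (of_bool (snd z) - of_bool (fst z))\<^sup>2) = \<bar>edge_prob \<gamma>' e - edge_prob \<gamma> e\<bar>"
    by (rule choice)
  then obtain q :: "nat set \<Rightarrow> (bool \<times> bool) pmf" where qq: "\<forall>e. map_pmf fst (q e) = bernoulli_pmf (edge_prob \<gamma> e) \<and> map_pmf snd (q e) = bernoulli_pmf (edge_prob \<gamma>' e)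
    \<and> measure_pmf.expectation (q e) (\<lambda>z. (of_bool (snd z) - of_bool (fst z))\<^sup>2) = \<bar>edge_prob \<gamma>' e - edge_prob \<gamma> e\<bar>"
    by (rule exE)
  note q = qq[rule_format, THEN conjunct1] qq[rule_format, THEN conjunct2, THEN conjunct1]
    qq[rule_format, THEN conjunct2, THEN conjunct2]
  have fin: "finite (set_pmf (q e))" for e by (rule finite_subset[OF subset_UNIV]) simp
  interpret finite_product "ssubsets n s" "(False, False)" q by unfold_locales (simp_all add: fin)
  have a: "0 < a" unfolding a_def by (rule sigvar_min_pos)
  have lower: "a \<le> sigvar (sum \<gamma> e)" if "e \<in> ssubsets n s" for e
    unfolding a_def by (rule sigvar_ge_min, rule abs_sum_edge_le[OF that K(1)])
  have lower': "a \<le> sigvar (sum \<gamma>' e)" if "e \<in> ssubsets n s" for e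
    unfolding a_def by (rule sigvar_ge_min, rule abs_sum_edge_le[OF that K(2)])
  interpret A: beta_layer n s "(False, False)" q \<gamma> fst a
    by unfold_locales (rule s a lower q(1) | assumption)+
  interpret B: beta_layer n s "(False, False)" q \<gamma>' snd a
    by unfold_locales (rule s a lower' q(2) | assumption)+
  interpret coupled_layers n s "(False, False)" q \<gamma> \<gamma>' a
  proof unfold_locales
    fix e assume e: "e \<in> ssubsets n s"
    let ?E = "measure_pmf.expectation (q e)"
    let ?Y = "\<lambda>z. of_bool (snd z) - of_bool (fst z) :: real"
    define c where "c = edge_prob \<gamma>' e - edge_prob \<gamma> e"
    have int: "integrable (q e) f" for f :: "_ \<Rightarrow> real" by (intro integrable_measure_pmf_finite fin)
    have mean: "?E ?Y = c"
    proof -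
      have "?E (\<lambda>z. B.\<zeta> e z - A.\<zeta> e z) = 0" using A.\<zeta>_centered[OF e] B.\<zeta>_centered[OF e] int by simp
      moreover have "B.\<zeta> e z - A.\<zeta> e z = ?Y z - c" for z
        by (simp add: A.\<zeta>_def B.\<zeta>_def c_def edge_prob_sigmoid)
      ultimately show ?thesis using int by simp
    qed
    \<comment> \<open>The centred indicators differ by \<open>?Y - c\<close>, and subtracting the
      mean can only lower the second moment; the Lipschitz bound for \<open>sigmoid\<close> does the
      rest.\<close>
    have "?E (\<lambda>z. (B.\<zeta> e z - A.\<zeta> e z)\<^sup>2) = ?E (\<lambda>z. (?Y z)\<^sup>2 - 2 * c * ?Y z + c\<^sup>2)"
      by (rule Bochner_Integration.integral_cong[OF refl])
        (simp add: A.\<zeta>_def B.\<zeta>_def c_def edge_prob_sigmoid power2_eq_square algebra_simps)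
    also have "\<dots> = ?E (\<lambda>z. (?Y z)\<^sup>2) - 2 * c * ?E ?Y + c\<^sup>2"
      by (simp only: Bochner_Integration.integral_add[OF int int] Bochner_Integration.integral_diff[OF int int]
          integral_mult_right_zero measure_pmf.prob_space integral_const scaleR_one real_scaleR_def mult_1) simp
    also have "\<dots> \<le> ?E (\<lambda>z. (?Y z)\<^sup>2)" unfolding mean by (simp add: power2_eq_square)
    also have "\<dots> \<le> \<bar>sum \<gamma>' e - sum \<gamma> e\<bar>" unfolding q(3) edge_prob_sigmoid by (rule sigmoid_lipschitz)
    finally show "?E (\<lambda>z. (B.\<zeta> e z - A.\<zeta> e z)\<^sup>2) \<le> \<bar>sum \<gamma>' e - sum \<gamma> e\<bar>" .
  qed
  have N2: "N2 = l2_dist n \<gamma>' \<gamma>" unfolding l2_dist_def \<delta>_def by simp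
  have t: "1 \<le> sqrt (sqrt (real n))" "(sqrt (sqrt (real n)))\<^sup>2 = sqrt n" using s by auto
  define Q where "Q = map_pmf (\<lambda>\<omega>. (A.Hyp \<omega>, B.Hyp \<omega>)) prodP"
  have "Pi_pmf (ssubsets n s) False (\<lambda>e. bernoulli_pmf (edge_prob \<gamma> e)) = map_pmf (\<lambda>h. fst \<circ> h) prodP"
    unfolding prodP_def q(1)[symmetric] by (rule Pi_pmf_map) auto
  then have 1: "map_pmf fst Q = beta_model n s \<gamma>"
    unfolding Q_def beta_model_def by (simp add: map_pmf_comp A.Hyp_def)
  have "Pi_pmf (ssubsets n s) False (\<lambda>e. bernoulli_pmf (edge_prob \<gamma>' e)) = map_pmf (\<lambda>h. snd \<circ> h) prodP"
    unfolding prodP_def q(2)[symmetric] by (rule Pi_pmf_map) auto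
  then have 2: "map_pmf snd Q = beta_model n s \<gamma>'"
    unfolding Q_def beta_model_def by (simp add: map_pmf_comp B.Hyp_def)
  show ?thesis
  proof (intro exI[of _ Q] conjI 1 2 allI impI)
    fix u :: real assume u: "0 < u"
    show "measure_pmf.prob Q {z. u < \<bar>log_LR n s \<gamma> bhat (snd z) - log_LR n s \<gamma> bhat (fst z) - LR_shift n s \<gamma> \<gamma>'\<bar>}
      \<le> 2 * bad_const s a m / n + (compare_const s a R * sqrt (sqrt n) + 40 * real s ^ 4 / (a ^ 4 * m)
          + sqrt (real s * stard n s) * l2_dist n \<gamma>' \<gamma>) / u"
      using LR_transfer[OF K mle _ t u, of R] R unfolding N2 Q_def m_def measure_map_pmf by (simp add: vimage_def)
  qed
qed

section \<open>Normal limits\<close>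

abbreviation (input) shifted_normal :: "real \<Rightarrow> real measure" where
  "shifted_normal \<mu> \<equiv> density lborel (\<lambda>x. ennreal (normal_density \<mu> 1 x))"

lemma real_distribution_shifted_normal: "real_distribution (shifted_normal \<mu>)"
  unfolding real_distribution_def real_distribution_axioms_def
  by (auto intro: prob_space_normal_density)

lemma shifted_normal_singleton: "emeasure (shifted_normal \<mu>) {x} = 0"
  by (subst emeasure_density) (auto intro!: nn_integral_null_set simp: emeasure_lborel_singleton null_sets_def)

lemma shifted_normal_finite:
  assumes "finite S" shows "emeasure (shifted_normal \<mu>) S = 0"
proof -
  have "S \<in> null_sets lborel" using assms by (simp add: finite_imp_null_set_lborel)
  then show ?thesis
    by (subst emeasure_density) (auto intro!: nn_integral_null_set)
qed

text \<open>With slope of absolute value one this covers precisely translations and reflections, the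
  maps that preserve unit variance.\<close>

lemma shifted_normal_affine:
  assumes "c \<noteq> 0" "\<bar>c\<bar> = 1"
  shows "shifted_normal (d + c * \<mu>) = distr (shifted_normal \<mu>) borel (\<lambda>x. d + c * x)"
proof -
  interpret prob_space "shifted_normal \<mu>" by (rule prob_space_normal_density) simp
  have "distributed (shifted_normal \<mu>) lborel (\<lambda>x. x) (\<lambda>x. ennreal (normal_density \<mu> 1 x))"
    unfolding distributed_def by (auto simp: distr_id2)
  from normal_density_affine[OF this _ assms(1), of d]
  have "distributed (shifted_normal \<mu>) lborel (\<lambda>x. d + x * c) (\<lambda>x. ennreal (normal_density (d + c * \<mu>) 1 x))"
    using assms(2) by (simp add: mult.commute)
  then have "distr (shifted_normal \<mu>) lborel (\<lambda>x. d + c * x) = shifted_normal (d + c * \<mu>)"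
    unfolding distributed_def by (simp add: mult.commute)
  moreover have "distr (shifted_normal \<mu>) lborel (\<lambda>x. d + c * x) = distr (shifted_normal \<mu>) borel (\<lambda>x. d + c * x)"
    by (rule distr_cong) auto
  ultimately show ?thesis by simp
qed

lemma cdf_shifted_normal: "cdf (shifted_normal \<mu>) y = cdf std_normal_distribution (y - \<mu>)"
proof -
  have "cdf (shifted_normal \<mu>) y = measure (distr (shifted_normal 0) borel (\<lambda>x. \<mu> + 1 * x)) {..y}"
    unfolding cdf_def using shifted_normal_affine[of 1 \<mu> 0] by simp
  also have "\<dots> = measure (shifted_normal 0) ((\<lambda>x. \<mu> + 1 * x) -` {..y} \<inter> space (shifted_normal 0))"
    by (rule measure_distr) auto
  also have "(\<lambda>x. \<mu> + 1 * x) -` {..y} \<inter> space (shifted_normal 0) = {..y - \<mu>}" by auto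
  finally show ?thesis unfolding cdf_def .
qed

lemma shifted_normal_symmetric:
  "measure (shifted_normal \<mu>) {x. z < \<bar>x\<bar>} = measure (shifted_normal (- \<mu>)) {x. z < \<bar>x\<bar>}"
proof -
  have "measure (shifted_normal (- \<mu>)) {x. z < \<bar>x\<bar>} = measure (distr (shifted_normal \<mu>) borel (\<lambda>x. 0 + -1 * x)) {x. z < \<bar>x\<bar>}"
    using shifted_normal_affine[of "-1" 0 \<mu>] by simp
  also have "\<dots> = measure (shifted_normal \<mu>) ((\<lambda>x. 0 + -1 * x) -` {x. z < \<bar>x\<bar>} \<inter> space (shifted_normal \<mu>))"
    by (rule measure_distr) auto
  also have "(\<lambda>x. 0 + -1 * x) -` {x. z < \<bar>x\<bar>} \<inter> space (shifted_normal \<mu>) = {x. z < \<bar>x\<bar>}" by auto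
  finally show ?thesis by simp
qed

lemma isCont_cdf_std_normal: "isCont (cdf std_normal_distribution) y"
proof -
  interpret real_distribution std_normal_distribution by (rule real_distribution_shifted_normal)
  show ?thesis unfolding isCont_cdf by (simp add: measure_def shifted_normal_singleton)
qed

text \<open>Continuity of the distribution function makes the infimum attained, with value exactly
  \<open>1 - \<alpha> / 2\<close>. As this exceeds 1/2, symmetry forces the quantile to be
  nonnegative; the two tails are then disjoint, of mass \<open>\<alpha> / 2\<close> each.\<close>

lemma std_normal_two_sided:
  assumes "0 < \<alpha>" "\<alpha> < 1"
  shows "measure std_normal_distribution {x. std_normal_quantile (1 - \<alpha> / 2) < \<bar>x\<bar>} = \<alpha>"
proof -
  interpret real_distribution std_normal_distribution by (rule real_distribution_shifted_normal)
  let ?F = "cdf std_normal_distribution" and ?p = "1 - \<alpha> / 2"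
  let ?S = "{x. ?p \<le> ?F x}"
  define z where "z = std_normal_quantile ?p"
  have z_def': "z = Inf ?S" unfolding z_def std_normal_quantile_def ..
  have ev1: "eventually (\<lambda>x. ?p < ?F x) at_top"
    using order_tendstoD(1)[OF cdf_lim_at_top_prob] assms by simp
  then obtain x1 where x1: "?p < ?F x1" by (auto simp: eventually_at_top_linorder)
  have ev2: "eventually (\<lambda>x. ?F x < ?p) at_bot"
    using order_tendstoD(2)[OF cdf_lim_at_bot] assms by simp
  then obtain x2 where x2: "\<And>x. x \<le> x2 \<Longrightarrow> ?F x < ?p" by (auto simp: eventually_at_bot_linorder)
  have bdd: "bdd_below ?S"
    using x2 by (intro bdd_belowI[of _ x2]) (metis linear mem_Collect_eq not_le)
  have ne: "?S \<noteq> {}" using x1 less_imp_le by auto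
  have closed: "closed ?S"
    using isCont_cdf_std_normal
    by (intro closed_Collect_le continuous_intros) (simp_all add: continuous_at_imp_continuous_on)
  have "z \<in> ?S" unfolding z_def' by (rule closed_contains_Inf[OF ne bdd closed])
  moreover have "?F z \<le> ?p"
  proof (rule ccontr)
    assume "\<not> ?F z \<le> ?p"
    then have "?p < ?F z" by simp
    then have "eventually (\<lambda>x. ?p < ?F x) (at z)"
      using order_tendstoD(1)[OF isCont_cdf_std_normal[unfolded isCont_def, of z]] by simp
    then obtain d where d: "0 < d" "\<And>x. x \<noteq> z \<Longrightarrow> dist x z < d \<Longrightarrow> ?p < ?F x"
      unfolding eventually_at by blast
    have "?p < ?F (z - d / 2)" using d(1) by (intro d(2)) (auto simp: dist_real_def)
    then have "z \<le> z - d / 2" unfolding z_def' using bdd by (intro cInf_lower) auto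
    with d(1) show False by simp
  qed
  ultimately have Fz: "?F z = ?p" by auto
  have sym: "measure std_normal_distribution {..< -y} = measure std_normal_distribution {y<..}" for y
  proof -
    have "measure (shifted_normal 0) {y<..} = measure (distr (shifted_normal 0) borel (\<lambda>x. 0 + -1 * x)) {y<..}"
      using shifted_normal_affine[of "-1" 0 0] by simp
    also have "\<dots> = measure (shifted_normal 0) ((\<lambda>x. 0 + -1 * x) -` {y<..} \<inter> space (shifted_normal 0))"
      by (rule measure_distr) auto
    also have "(\<lambda>x. 0 + -1 * x) -` {y<..} \<inter> space (shifted_normal 0) = {..< -y}" by auto
    finally show ?thesis by simp
  qed
  have tail: "measure std_normal_distribution {y<..} = 1 - ?F y" for y
  proof -
    have "measure std_normal_distribution (space std_normal_distribution - {..y}) = 1 - measure std_normal_distribution {..y}"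
      by (rule prob_compl) simp
    moreover have "space std_normal_distribution - {..y} = {y<..}" by auto
    ultimately show ?thesis unfolding cdf_def by simp
  qed
  have "0 \<le> z"
  proof (rule ccontr)
    assume "\<not> 0 \<le> z"
    then have "?F z = measure std_normal_distribution {..z}" "measure std_normal_distribution {..z} \<le> measure std_normal_distribution {..< -z}"
      unfolding cdf_def by (auto intro!: finite_measure_mono)
    then have "?p \<le> 1 - ?p" using Fz sym[of z] tail[of z] by simp
    then show False using assms by simp
  qed
  then have "{x. z < \<bar>x\<bar>} = {z<..} \<union> {..< -z}" by auto
  moreover have "measure std_normal_distribution ({z<..} \<union> {..< -z}) = measure std_normal_distribution {z<..} + measure std_normal_distribution {..< -z}"
    using \<open>0 \<le> z\<close> by (intro finite_measure_Union) auto
  ultimately show ?thesis using sym[of z] tail[of z] Fz unfolding z_def by simp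
qed

section \<open>Transfer of distributional limits through a coupling\<close>

lemma prob_coupled:
  assumes "map_pmf fst Q = P" "map_pmf snd Q = P'"
  shows "measure_pmf.prob P S = measure_pmf.prob Q {z. fst z \<in> S}"
    and "measure_pmf.prob P' S = measure_pmf.prob Q {z. snd z \<in> S}"
  unfolding assms[symmetric] measure_map_pmf by (simp_all add: vimage_def)

lemma prob_le_Un:
  assumes "A \<subseteq> B \<union> C"
  shows "measure_pmf.prob Q A \<le> measure_pmf.prob Q B + measure_pmf.prob Q C"
proof -
  have "measure_pmf.prob Q A \<le> measure_pmf.prob Q (B \<union> C)"
    by (rule measure_pmf.finite_measure_mono[OF assms]) simp
  also have "\<dots> \<le> measure_pmf.prob Q B + measure_pmf.prob Q C" by (rule measure_Un_le) auto
  finally show ?thesis .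
qed

lemma cdf_distr_pmf: "cdf (distr (measure_pmf P) borel T) y = measure_pmf.prob P {H. T H \<le> y}"
  unfolding cdf_def by (subst measure_distr) (auto simp: vimage_def)

text \<open>Apart from the exceptional event of the coupling, the distribution function under
  \<open>P'\<close> at \<open>y\<close> lies between those under \<open>P\<close> at
  \<open>y - \<kappa>0 - h\<close> and \<open>y - \<kappa>0 + h\<close>; continuity of the normal
  limit closes the gap.\<close>

lemma slutsky_pmf:
  fixes T :: "nat \<Rightarrow> 'a \<Rightarrow> real"
  assumes Q: "\<forall>\<^sub>F k in sequentially. map_pmf fst (Q k) = P k \<and> map_pmf snd (Q k) = P' k"
    and weak: "\<And>y. (\<lambda>k. measure_pmf.prob (P k) {H. T k H \<le> y}) \<longlonglongrightarrow> cdf std_normal_distribution y"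
    and \<kappa>: "\<kappa> \<longlonglongrightarrow> \<kappa>0"
    and close: "\<And>\<epsilon>. 0 < \<epsilon> \<Longrightarrow> (\<lambda>k. measure_pmf.prob (Q k) {z. \<epsilon> < \<bar>T k (snd z) - T k (fst z) - \<kappa> k\<bar>}) \<longlonglongrightarrow> 0"
  shows "(\<lambda>k. measure_pmf.prob (P' k) {H. z < \<bar>T k H\<bar>}) \<longlonglongrightarrow> measure (shifted_normal \<kappa>0) {x. z < \<bar>x\<bar>}"
proof -
  let ?F = "cdf std_normal_distribution"
  have aux1: "\<not> t \<le> y - \<kappa>0 + h \<Longrightarrow> \<bar>l - \<kappa>0\<bar> < h / 2 \<Longrightarrow> t' \<le> y \<Longrightarrow> h / 2 < \<bar>t' - t - l\<bar>" for t t' y h l :: real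
    by linarith
  have aux2: "\<not> t' \<le> y \<Longrightarrow> \<bar>l - \<kappa>0\<bar> < h / 2 \<Longrightarrow> t \<le> y - \<kappa>0 - h \<Longrightarrow> h / 2 < \<bar>t' - t - l\<bar>" for t t' y h l :: real
    by linarith
  have aux3: "\<bar>p - f\<bar> < e"
    if "p \<le> p1 + r" "p2 \<le> p + r" "\<bar>r - 0\<bar> < e / 3" "\<bar>p1 - f1\<bar> < e / 3" "\<bar>p2 - f2\<bar> < e / 3"
      "\<bar>f1 - f\<bar> < e / 3" "\<bar>f2 - f\<bar> < e / 3" for p f p1 p2 r e f1 f2 :: real
  proof -
    have "r < e / 3" "p1 - f1 < e / 3" "f1 - f < e / 3" "f2 - p2 < e / 3" "f - f2 < e / 3"
      using that(3-7)[unfolded abs_less_iff] by linarith+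
    then have "p - f < e" "f - p < e" using that(1,2) by linarith+
    then show ?thesis by simp
  qed
  have cdf_lim: "(\<lambda>k. measure_pmf.prob (P' k) {H. T k H \<le> y}) \<longlonglongrightarrow> ?F (y - \<kappa>0)" for y
  proof (rule tendstoI)
    fix e :: real assume e: "0 < e"
    obtain d where d: "0 < d" "\<And>x. \<bar>x - (y - \<kappa>0)\<bar> < d \<Longrightarrow> \<bar>?F x - ?F (y - \<kappa>0)\<bar> < e / 3"
      using isCont_cdf_std_normal[of "y - \<kappa>0", unfolded continuous_at_eps_delta] e
      by (metis divide_pos_pos dist_real_def zero_less_numeral)
    \<comment> \<open>Strictly inside the continuity radius \<open>d\<close>. Half of
      \<open>h\<close> pays for the drift of \<open>\<kappa> k\<close>, the other half for the
      coupling error.\<close>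
    define h where "h = d / 2"
    have h: "0 < h" "h < d" using d(1) by (auto simp: h_def)
    let ?bad = "\<lambda>k. measure_pmf.prob (Q k) {z. h / 2 < \<bar>T k (snd z) - T k (fst z) - \<kappa> k\<bar>}"
    have "\<forall>\<^sub>F k in sequentially. dist (?bad k) 0 < e / 3" using close[of "h / 2"] h e by (intro tendstoD) auto
    moreover have "\<forall>\<^sub>F k in sequentially. dist (\<kappa> k) \<kappa>0 < h / 2" using \<kappa> h by (intro tendstoD) auto
    moreover have "\<forall>\<^sub>F k in sequentially. dist (measure_pmf.prob (P k) {H. T k H \<le> y - \<kappa>0 + h}) (?F (y - \<kappa>0 + h)) < e / 3"
      using weak e by (intro tendstoD) auto
    moreover have "\<forall>\<^sub>F k in sequentially. dist (measure_pmf.prob (P k) {H. T k H \<le> y - \<kappa>0 - h}) (?F (y - \<kappa>0 - h)) < e / 3"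
      using weak e by (intro tendstoD) auto
    ultimately show "\<forall>\<^sub>F k in sequentially. dist (measure_pmf.prob (P' k) {H. T k H \<le> y}) (?F (y - \<kappa>0)) < e"
      using Q
    proof eventually_elim
      case (elim k)
      then have q: "map_pmf fst (Q k) = P k" "map_pmf snd (Q k) = P' k" by auto
      have k: "\<bar>\<kappa> k - \<kappa>0\<bar> < h / 2" using elim by (simp add: dist_real_def)
      have "measure_pmf.prob (P' k) {H. T k H \<le> y} \<le> measure_pmf.prob (P k) {H. T k H \<le> y - \<kappa>0 + h} + ?bad k"
        unfolding prob_coupled[OF q]
      proof (rule prob_le_Un, rule subsetI)
        fix z :: "'a \<times> 'a" assume "z \<in> {z. snd z \<in> {H. T k H \<le> y}}"
        then show "z \<in> {z. fst z \<in> {H. T k H \<le> y - \<kappa>0 + h}} \<union> {z. h / 2 < \<bar>T k (snd z) - T k (fst z) - \<kappa> k\<bar>}"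
          using aux1[OF _ k] by auto
      qed
      note upper = this
      have lower: "measure_pmf.prob (P k) {H. T k H \<le> y - \<kappa>0 - h} \<le> measure_pmf.prob (P' k) {H. T k H \<le> y} + ?bad k"
        unfolding prob_coupled[OF q]
      proof (rule prob_le_Un, rule subsetI)
        fix z :: "'a \<times> 'a" assume "z \<in> {z. fst z \<in> {H. T k H \<le> y - \<kappa>0 - h}}"
        then show "z \<in> {z. snd z \<in> {H. T k H \<le> y}} \<union> {z. h / 2 < \<bar>T k (snd z) - T k (fst z) - \<kappa> k\<bar>}"
          using aux2[OF _ k] by auto
      qed
      have cont: "\<bar>?F (y - \<kappa>0 + h) - ?F (y - \<kappa>0)\<bar> < e / 3" "\<bar>?F (y - \<kappa>0 - h) - ?F (y - \<kappa>0)\<bar> < e / 3"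
        by (rule d(2), use h in simp)+
      show ?case
        using aux3[OF upper lower _ _ _ cont] elim unfolding dist_real_def by blast
    qed
  qed
  \<comment> \<open>The rejection region is not a half-line, so its probability is obtained through
    weak convergence: its boundary has at most two points, a null set for the normal law.\<close>
  have "weak_conv_m (\<lambda>k. distr (measure_pmf (P' k)) borel (T k)) (shifted_normal \<kappa>0)"
    unfolding weak_conv_m_def weak_conv_def cdf_distr_pmf cdf_shifted_normal[of \<kappa>0]
    using cdf_lim by blast
  then have "(\<lambda>k. measure (distr (measure_pmf (P' k)) borel (T k)) {x. z < \<bar>x\<bar>}) \<longlonglongrightarrow> measure (shifted_normal \<kappa>0) {x. z < \<bar>x\<bar>}"
  proof (rule weak_conv_imp_continuity_set_conv[rotated 2])
    show "real_distribution (distr (measure_pmf (P' k)) borel (T k))" for k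
      by (rule prob_space.real_distribution_distr[OF prob_space_measure_pmf]) simp
    show "real_distribution (shifted_normal \<kappa>0)" by (rule real_distribution_shifted_normal)
    show "{x::real. z < \<bar>x\<bar>} \<in> sets borel" by simp
    have "frontier {x::real. z < \<bar>x\<bar>} \<subseteq> {z, - z}"
    proof -
      have "open {x::real. z < \<bar>x\<bar>}" by (intro open_Collect_less continuous_intros)
      moreover have "closure {x::real. z < \<bar>x\<bar>} \<subseteq> {x. z \<le> \<bar>x\<bar>}"
        by (intro closure_minimal closed_Collect_le continuous_intros) auto
      ultimately show ?thesis unfolding frontier_def by (auto simp: interior_open)
    qed
    then have "finite (frontier {x::real. z < \<bar>x\<bar>})" by (rule finite_subset) simp
    then show "emeasure (shifted_normal \<kappa>0) (frontier {x. z < \<bar>x\<bar>}) = 0" by (rule shifted_normal_finite)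
  qed
  moreover have "measure (distr (measure_pmf (P' k)) borel (T k)) {x. z < \<bar>x\<bar>} = measure_pmf.prob (P' k) {H. z < \<bar>T k H\<bar>}" for k
    by (subst measure_distr) (auto simp: vimage_def)
  ultimately show ?thesis by simp
qed

text \<open>If the shifted statistic still lies below \<open>z\<close>, then either the null
  statistic is below a fixed \<open>c\<close> of small limiting probability, or the increment misses
  the shift by more than half of it. The tolerance is relative to the shift because the coupling
  error grows as well.\<close>

lemma diverging_shift_pmf:
  fixes T :: "nat \<Rightarrow> 'a \<Rightarrow> real"
  assumes Q: "\<forall>\<^sub>F k in sequentially. map_pmf fst (Q k) = P k \<and> map_pmf snd (Q k) = P' k"
    and weak: "\<And>y. (\<lambda>k. measure_pmf.prob (P k) {H. T k H \<le> y}) \<longlonglongrightarrow> cdf std_normal_distribution y"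
    and \<kappa>: "filterlim \<kappa> at_top sequentially"
    and close: "(\<lambda>k. measure_pmf.prob (Q k) {z. \<kappa> k / 2 < \<bar>T k (snd z) - T k (fst z) - \<kappa> k\<bar>}) \<longlonglongrightarrow> 0"
  shows "(\<lambda>k. measure_pmf.prob (P' k) {H. z < \<bar>T k H\<bar>}) \<longlonglongrightarrow> 1"
proof (rule tendstoI)
  fix e :: real assume e: "0 < e"
  interpret real_distribution std_normal_distribution by (rule real_distribution_shifted_normal)
  let ?F = "cdf std_normal_distribution"
  have aux3: "2 * (z - c) < l \<Longrightarrow> \<not> t \<le> c \<Longrightarrow> t' \<le> z \<Longrightarrow> l / 2 < \<bar>t' - t - l\<bar>" for c l t t' :: real
  proof -
    assume "2 * (z - c) < l" "\<not> t \<le> c" "t' \<le> z"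
    then have "l / 2 < - (t' - t - l)" by (simp add: field_simps)
    also have "\<dots> \<le> \<bar>t' - t - l\<bar>" by (rule abs_ge_minus_self)
    finally show ?thesis .
  qed
  have "eventually (\<lambda>x. ?F x < e / 3) at_bot" by (rule order_tendstoD(2)[OF cdf_lim_at_bot]) (use e in simp)
  then obtain c where c: "?F c < e / 3" unfolding eventually_at_bot_linorder by blast
  let ?bad = "\<lambda>k. measure_pmf.prob (Q k) {z. \<kappa> k / 2 < \<bar>T k (snd z) - T k (fst z) - \<kappa> k\<bar>}"
  have "\<forall>\<^sub>F k in sequentially. dist (?bad k) 0 < e / 3" using close e by (intro tendstoD) auto
  moreover have "\<forall>\<^sub>F k in sequentially. 2 * (z - c) < \<kappa> k" 
    using \<kappa> unfolding filterlim_at_top_dense by blast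
  moreover have "\<forall>\<^sub>F k in sequentially. dist (measure_pmf.prob (P k) {H. T k H \<le> c}) (?F c) < e / 3"
    using weak e by (intro tendstoD) auto
  ultimately show "\<forall>\<^sub>F k in sequentially. dist (measure_pmf.prob (P' k) {H. z < \<bar>T k H\<bar>}) 1 < e"
    using Q
  proof eventually_elim
    case (elim k)
    then have q: "map_pmf fst (Q k) = P k" "map_pmf snd (Q k) = P' k" by auto
    have "measure_pmf.prob (P' k) {H. \<not> z < \<bar>T k H\<bar>} \<le> measure_pmf.prob (P k) {H. T k H \<le> c} + ?bad k"
      unfolding prob_coupled[OF q]
    proof (rule prob_le_Un, rule subsetI)
      fix w :: "'a \<times> 'a" assume "w \<in> {w. snd w \<in> {H. \<not> z < \<bar>T k H\<bar>}}"
      then show "w \<in> {w. fst w \<in> {H. T k H \<le> c}} \<union> {z. \<kappa> k / 2 < \<bar>T k (snd z) - T k (fst z) - \<kappa> k\<bar>}"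
        using aux3[OF elim(2), of "T k (fst w)" "T k (snd w)"] abs_ge_self[of "T k (snd w)"] by (auto simp: not_less)
    qed
    moreover have "measure_pmf.prob (P' k) {H. \<not> z < \<bar>T k H\<bar>} = 1 - measure_pmf.prob (P' k) {H. z < \<bar>T k H\<bar>}"
    proof -
      have "{H. \<not> z < \<bar>T k H\<bar>} = UNIV - {H. z < \<bar>T k H\<bar>}" by auto
      then show ?thesis using measure_pmf.prob_compl[of "{H. z < \<bar>T k H\<bar>}" "P' k"] by simp
    qed
    moreover have "measure_pmf.prob (P' k) {H. z < \<bar>T k H\<bar>} \<le> 1" by simp
    ultimately show ?case using elim c unfolding dist_real_def by linarith
  qed
qed

section \<open>Power of the likelihood ratio test\<close>

text \<open>A degree minus its mean is a score, so the form is the variance of a linear form in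
  independent edges: the Fisher information as covariance of the sufficient statistic.\<close>

lemma degree_cov_form_eq:
  assumes s: "2 \<le> s" "2 * s \<le> n"
  shows "degree_cov_form n s \<beta> w = (\<Sum>e\<in>ssubsets n s. sigvar (sum \<beta> e) * (sum w e)\<^sup>2)"
proof -
  \<comment> \<open>Any bound valid for the finitely many edge sums will do, since it leaves no
    trace in an identity; inserting 0 keeps the maximum over a nonempty set.\<close>
  define K where "K = Max (insert 0 ((\<lambda>e. \<bar>sum \<beta> e\<bar>) ` ssubsets n s))"
  have K: "\<bar>sum \<beta> e\<bar> \<le> K" if "e \<in> ssubsets n s" for e
    unfolding K_def using that by (intro Max_ge) auto
  interpret finite_product "ssubsets n s" False "\<lambda>e. bernoulli_pmf (edge_prob \<beta> e)"
    by unfold_locales (simp_all add: finite_subset[OF subset_UNIV])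
  interpret beta_layer n s False "\<lambda>e. bernoulli_pmf (edge_prob \<beta> e)" \<beta> "\<lambda>x. x" "sigvar_min K"
    by unfold_locales (use s K in \<open>simp_all add: sigvar_min_pos sigvar_ge_min map_pmf_ident\<close>)
  have model: "beta_model n s \<beta> = map_pmf Hyp prodP"
    unfolding beta_model_def prodP_def Hyp_def[abs_def] ..
  have deg: "real (sdegree (Hyp \<omega>) v) = A v \<omega> + (\<Sum>e\<in>star n s v. sigmoid (sum \<beta> e))" for v \<omega>
    unfolding sdegree_eq_sum[OF Hyp_subset] score_def by (simp add: sum_subtractf)
  have ExA: "Ex (A v) = 0" for v
  proof -
    have "Ex (A v) = (\<Sum>e\<in>star n s v. Ex (\<lambda>\<omega>. \<zeta> e (\<omega> e)))" unfolding A_eq[abs_def] by simp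
    also have "\<dots> = 0"
      using \<zeta>_centered starD by (intro sum.neutral ballI) (subst Ex_component, blast+)
    finally show ?thesis .
  qed
  have cov: "degree_cov n s \<beta> u v = Ex (\<lambda>\<omega>. A u \<omega> * A v \<omega>)" for u v
    unfolding degree_cov_def covariance_pmf_def model by (simp add: deg ExA)
  have "degree_cov_form n s \<beta> w = Ex (\<lambda>\<omega>. (\<Sum>v=1..n. w v * A v \<omega>)\<^sup>2)"
    unfolding degree_cov_form_def cov power2_eq_square sum_product by (simp add: mult_ac)
  also have "\<dots> = Ex (\<lambda>\<omega>. (\<Sum>e\<in>ssubsets n s. sum w e * \<zeta> e (\<omega> e))\<^sup>2)"
    unfolding A_eq by (simp only: sum_distrib_left sum_star_swap sum_distrib_right)
  also have "\<dots> = (\<Sum>e\<in>ssubsets n s. measure_pmf.expectation (bernoulli_pmf (edge_prob \<beta> e)) (\<lambda>z. (sum w e * \<zeta> e z)\<^sup>2))"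
    using \<zeta>_centered by (intro second_moment_linear) auto
  also have "\<dots> = (\<Sum>e\<in>ssubsets n s. sigvar (sum \<beta> e) * (sum w e)\<^sup>2)"
    by (rule sum.cong[OF refl]) (simp add: power_mult_distrib \<zeta>_variance)
  finally show ?thesis .
qed

text \<open>Divergence and covariance form both have order \<open>k\<close> by coercivity of the
  edge-sum form. Twice the divergence and the form agree to second order: twice a third-order
  remainder plus one change of base point of \<open>sigvar\<close> gives the factor 3.\<close>

lemma shift_bounds:
  fixes \<gamma> \<gamma>' :: "nat \<Rightarrow> real"
  assumes s: "2 \<le> s" "2 * s \<le> n"
    and K: "\<And>v. v \<in> {1..n} \<Longrightarrow> \<bar>\<gamma> v\<bar> \<le> K" "\<And>v. v \<in> {1..n} \<Longrightarrow> \<bar>\<gamma>' v\<bar> \<le> K"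
  defines "a \<equiv> sigvar_min (real s * K)" and "k \<equiv> stard n s * (l2_dist n \<gamma>' \<gamma>)\<^sup>2"
    and "f \<equiv> degree_cov_form n s \<gamma> (\<lambda>v. \<gamma>' v - \<gamma> v)"
  shows "a / 4 * k \<le> LR_shift n s \<gamma> \<gamma>'" "LR_shift n s \<gamma> \<gamma>' \<le> real s * k"
    and "a / 2 * k \<le> f" "f \<le> real s * k"
    and "\<bar>2 * LR_shift n s \<gamma> \<gamma>' - f\<bar> \<le> 3 * real s ^ 2 * l2_dist n \<gamma>' \<gamma> * k"
proof -
  let ?d = "l2_dist n \<gamma>' \<gamma>" and ?E = "ssubsets n s"
  define \<delta> where "\<delta> v = \<gamma>' v - \<gamma> v" for v
  have sum_\<delta>: "sum \<gamma>' e - sum \<gamma> e = sum \<delta> e" "sum \<gamma> e - sum \<gamma>' e = - sum \<delta> e" for e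
    unfolding \<delta>_def by (simp_all add: sum_subtractf)
  have d: "?d = L2_set \<delta> {1..n}" unfolding l2_dist_def \<delta>_def ..
  have d0: "0 \<le> ?d" unfolding d by simp
  have a: "0 < a" unfolding a_def by (rule sigvar_min_pos)
  have d2: "?d\<^sup>2 = (\<Sum>v=1..n. (\<delta> v)\<^sup>2)" unfolding d L2_set_def by (simp add: sum_nonneg)
  have lo: "k / 2 \<le> (\<Sum>e\<in>?E. (sum \<delta> e)\<^sup>2)"
    using sum_edge_square_ge[OF s, of \<delta>] unfolding k_def d2 by simp
  have hi: "(\<Sum>e\<in>?E. (sum \<delta> e)\<^sup>2) \<le> real s * k"
    using sum_edge_square_le[of s \<delta> n] s unfolding k_def d2 by (simp add: mult.assoc)
  have f: "f = (\<Sum>e\<in>?E. sigvar (sum \<gamma> e) * (sum \<delta> e)\<^sup>2)"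
    unfolding f_def degree_cov_form_eq[OF s] \<delta>_def ..
  have S: "LR_shift n s \<gamma> \<gamma>' = (\<Sum>e\<in>?E. softplus_breg (sum \<gamma>' e) (- sum \<delta> e))"
    unfolding LR_shift_def sum_\<delta> ..
  have "a / 2 * (k / 2) \<le> a / 2 * (\<Sum>e\<in>?E. (sum \<delta> e)\<^sup>2)" using lo a by (intro mult_left_mono) auto
  also have "\<dots> \<le> LR_shift n s \<gamma> \<gamma>'"
    unfolding S sum_distrib_left
  proof (rule sum_mono)
    fix e assume e: "e \<in> ?E"
    have "sum \<gamma>' e + - sum \<delta> e = sum \<gamma> e" using sum_\<delta>(1)[of e] by simp
    then show "a / 2 * (sum \<delta> e)\<^sup>2 \<le> softplus_breg (sum \<gamma>' e) (- sum \<delta> e)"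
      using softplus_breg_ge[of "sum \<gamma>' e" "real s * K" "- sum \<delta> e"] abs_sum_edge_le[OF e K(1)] abs_sum_edge_le[OF e K(2)]
      unfolding a_def by simp
  qed
  finally show "a / 4 * k \<le> LR_shift n s \<gamma> \<gamma>'" by simp
  have "LR_shift n s \<gamma> \<gamma>' \<le> (\<Sum>e\<in>?E. (- sum \<delta> e)\<^sup>2)" unfolding S by (intro sum_mono softplus_breg_le)
  then show "LR_shift n s \<gamma> \<gamma>' \<le> real s * k" using hi by simp
  have "a * (k / 2) \<le> a * (\<Sum>e\<in>?E. (sum \<delta> e)\<^sup>2)" using lo a by (intro mult_left_mono) auto
  also have "\<dots> \<le> f"
    unfolding f sum_distrib_left
  proof (intro sum_mono mult_right_mono)
    fix e assume e: "e \<in> ?E"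
    show "a \<le> sigvar (sum \<gamma> e)" unfolding a_def by (rule sigvar_ge_min) (rule abs_sum_edge_le[OF e K(1)])
  qed simp
  finally show "a / 2 * k \<le> f" by simp
  have "f \<le> (\<Sum>e\<in>?E. 1 * (sum \<delta> e)\<^sup>2)"
    unfolding f
  proof (intro sum_mono mult_right_mono)
    show "sigvar (sum \<gamma> e) \<le> 1" for e using sigvar_bounds(2)[of "sum \<gamma> e"] by simp
  qed simp
  then show "f \<le> real s * k" using hi by simp
  have "\<bar>2 * LR_shift n s \<gamma> \<gamma>' - f\<bar> \<le> (\<Sum>e\<in>?E. \<bar>2 * softplus_breg (sum \<gamma>' e) (- sum \<delta> e) - sigvar (sum \<gamma> e) * (sum \<delta> e)\<^sup>2\<bar>)"
    unfolding S f sum_distrib_left sum_subtractf[symmetric] by (rule sum_abs)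
  also have "\<dots> \<le> (\<Sum>e\<in>?E. 3 * (real s * ?d) * (sum \<delta> e)\<^sup>2)"
  proof (rule sum_mono)
    fix e assume e: "e \<in> ?E"
    let ?t = "sum \<delta> e"
    have t: "\<bar>?t\<bar> \<le> real s * ?d" unfolding d by (rule abs_sum_edge_le[OF e]) (rule abs_le_L2_set, auto)
    have "\<bar>softplus_rem (sum \<gamma>' e) (- ?t)\<bar> \<le> \<bar>?t\<bar> ^ 3" using softplus_rem_bound[of "sum \<gamma>' e" "- ?t"] by simp
    moreover have "\<bar>(sigvar (sum \<gamma>' e) - sigvar (sum \<gamma> e)) * ?t\<^sup>2\<bar> \<le> \<bar>?t\<bar> ^ 3"
    proof -
      have "\<bar>sigvar (sum \<gamma>' e) - sigvar (sum \<gamma> e)\<bar> * ?t\<^sup>2 \<le> \<bar>?t\<bar> * ?t\<^sup>2"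
        using sigvar_lipschitz[of "sum \<gamma>' e" "sum \<gamma> e"] unfolding sum_\<delta> by (rule mult_right_mono) simp
      then show ?thesis by (simp add: abs_mult power3_eq_cube power2_eq_square)
    qed
    moreover have "2 * softplus_breg (sum \<gamma>' e) (- ?t) - sigvar (sum \<gamma> e) * ?t\<^sup>2
      = 2 * softplus_rem (sum \<gamma>' e) (- ?t) + (sigvar (sum \<gamma>' e) - sigvar (sum \<gamma> e)) * ?t\<^sup>2"
      unfolding softplus_rem_def by (simp add: algebra_simps)
    ultimately have "\<bar>2 * softplus_breg (sum \<gamma>' e) (- ?t) - sigvar (sum \<gamma> e) * ?t\<^sup>2\<bar> \<le> 3 * \<bar>?t\<bar> ^ 3" by linarith
    also have "\<dots> = 3 * \<bar>?t\<bar> * ?t\<^sup>2" by (simp add: power3_eq_cube power2_eq_square)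
    also have "\<dots> \<le> 3 * (real s * ?d) * ?t\<^sup>2" using t by (intro mult_right_mono mult_left_mono) auto
    finally show "\<bar>2 * softplus_breg (sum \<gamma>' e) (- ?t) - sigvar (sum \<gamma> e) * ?t\<^sup>2\<bar> \<le> 3 * (real s * ?d) * ?t\<^sup>2" .
  qed
  also have "\<dots> = 3 * (real s * ?d) * (\<Sum>e\<in>?E. (sum \<delta> e)\<^sup>2)" by (simp only: sum_distrib_left)
  also have "\<dots> \<le> 3 * (real s * ?d) * (real s * k)" using hi d0 by (intro mult_left_mono) auto
  finally show "\<bar>2 * LR_shift n s \<gamma> \<gamma>' - f\<bar> \<le> 3 * real s ^ 2 * ?d * k" by (simp add: power2_eq_square mult_ac)
qed

section \<open>The order of the star size and the critical rate\<close>

lemma stard_order: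
  assumes "2 \<le> s" "2 * s \<le> n"
  shows "(1 / (2 * real s)) ^ (s - 1) * real n ^ (s - 1) \<le> stard n s" "stard n s \<le> real n ^ (s - 1)"
proof -
  have "(real n / (2 * real s)) ^ (s - 1) \<le> (real (n - 1) / real (s - 1)) ^ (s - 1)"
  proof (rule power_mono)
    have "real n / (2 * real s) = (real n / 2) / real s" by simp
    also have "\<dots> \<le> real (n - 1) / real (s - 1)" using assms by (intro frac_le) auto
    finally show "real n / (2 * real s) \<le> real (n - 1) / real (s - 1)" .
  qed simp
  also have "\<dots> \<le> stard n s"
    unfolding stard_def using assms by (intro binomial_ge_n_over_k_pow_k) auto
  finally show "(1 / (2 * real s)) ^ (s - 1) * real n ^ (s - 1) \<le> stard n s"
    by (simp add: power_mult_distrib[symmetric])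
  have "(n - 1) choose (s - 1) \<le> (n - 1) ^ (s - 1)" using assms by (intro binomial_le_pow) auto
  also have "\<dots> \<le> n ^ (s - 1)" by (intro power_mono) auto
  finally show "stard n s \<le> real n ^ (s - 1)" unfolding stard_def by (metis of_nat_le_iff of_nat_power)
qed

text \<open>This identity fixes the exponent: at distance n^(-(2s-3)/4) a shift of order n^(s-1)
  times the squared distance equals sqrt n, the scale of the statistic.\<close>

lemma rate_square:
  assumes "2 \<le> s" "1 \<le> n"
  shows "(real n powr ((2 * real s - 3) / 4))\<^sup>2 * sqrt n = real n ^ (s - 1)"
proof -
  have n: "0 < real n" using assms by simp
  have "(real n powr ((2 * real s - 3) / 4))\<^sup>2 * sqrt n = real n powr ((2 * real s - 3) / 4 + (2 * real s - 3) / 4 + 1 / 2)"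
    unfolding powr_add powr_half_sqrt[OF less_imp_le[OF n]] by (simp only: power2_eq_square)
  also have "(2 * real s - 3) / 4 + (2 * real s - 3) / 4 + 1 / 2 = real (s - 1)"
    using assms by (simp add: field_simps)
  finally show ?thesis using n by (simp add: powr_realpow)
qed

lemma LR_power_eq:
  "LR_power n s \<alpha> \<gamma> bhat \<gamma>' = measure_pmf.prob (beta_model n s \<gamma>')
     {H. std_normal_quantile (1 - \<alpha> / 2) < \<bar>LR_stat n s \<gamma> bhat H\<bar>}"
proof -
  have "LR_test n s \<alpha> \<gamma> bhat = indicator {H. std_normal_quantile (1 - \<alpha> / 2) < \<bar>LR_stat n s \<gamma> bhat H\<bar>}"
    by (auto simp: LR_test_def fun_eq_iff indicator_def)
  then show ?thesis unfolding LR_power_def by simp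
qed

section \<open>The statistic along a sequence of alternatives\<close>

locale LR_setting =
  fixes s :: nat and M :: real and \<gamma> \<gamma>' :: "nat \<Rightarrow> nat \<Rightarrow> real"
    and bhat :: "nat \<Rightarrow> nat set set \<Rightarrow> nat \<Rightarrow> real"
  assumes s2: "2 \<le> s"
    and bounded: "\<And>n v. v \<in> {1..n} \<Longrightarrow> \<bar>\<gamma> n v\<bar> \<le> M"
    and estimator: "\<And>n. mle_estimator n s (bhat n)"
    and null_limit: "weak_conv_m
           (\<lambda>n. distr (measure_pmf (beta_model n s (\<gamma> n))) borel (LR_stat n s (\<gamma> n) (bhat n)))
           std_normal_distribution"
    and bounded_dist: "(\<lambda>n. l2_dist n (\<gamma> n) (\<gamma>' n)) \<in> O(\<lambda>_. 1)"
begin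

abbreviation T :: "nat \<Rightarrow> nat set set \<Rightarrow> real" where "T n \<equiv> LR_stat n s (\<gamma> n) (bhat n)"

definition dist2 :: "nat \<Rightarrow> real" where "dist2 n = l2_dist n (\<gamma>' n) (\<gamma> n)"

text \<open>The signal-to-noise ratio. The shift \<open>\<kappa>\<close>, the limiting quantity
  \<open>form\<close> and the squared rescaled distance are all eventually comparable to it, so the
  three regimes are read off from \<open>g\<close>.\<close>

definition g :: "nat \<Rightarrow> real" where "g n = stard n s * (dist2 n)\<^sup>2 / sqrt n"

definition form :: "nat \<Rightarrow> real" where
  "form n = degree_cov_form n s (\<gamma> n) (\<lambda>v. \<gamma>' n v - \<gamma> n v) / sqrt n"

definition \<kappa> :: "nat \<Rightarrow> real" where "\<kappa> n = sqrt 2 * LR_shift n s (\<gamma> n) (\<gamma>' n) / sqrt n"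

definition rate :: "nat \<Rightarrow> real" where "rate n = real n powr ((2 * real s - 3) / 4) * dist2 n"

lemma dist2_nonneg: "0 \<le> dist2 n"
  unfolding dist2_def l2_dist_def by simp

lemma g_nonneg: "0 \<le> g n"
  unfolding g_def by simp

lemma null_cdf: "(\<lambda>n. measure_pmf.prob (beta_model n s (\<gamma> n)) {H. T n H \<le> y}) \<longlonglongrightarrow> cdf std_normal_distribution y"
  using null_limit unfolding weak_conv_m_def weak_conv_def cdf_distr_pmf
  using isCont_cdf_std_normal by blast

lemma g_rate:
  "\<exists>c>0. \<forall>\<^sub>F n in sequentially. c * (rate n)\<^sup>2 \<le> g n \<and> g n \<le> (rate n)\<^sup>2"
proof (intro exI conjI)
  let ?c = "(1 / (2 * real s)) ^ (s - 1)"
  show "0 < ?c" using s2 by simp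
  show "\<forall>\<^sub>F n in sequentially. ?c * (rate n)\<^sup>2 \<le> g n \<and> g n \<le> (rate n)\<^sup>2"
    using eventually_ge_at_top[of "2 * s"]
  proof eventually_elim
    case (elim n)
    have n: "1 \<le> n" using elim s2 by simp
    have r: "(rate n)\<^sup>2 = real n ^ (s - 1) * (dist2 n)\<^sup>2 / sqrt n"
      unfolding rate_def rate_square[OF s2 n, symmetric] using n by (simp add: power_mult_distrib)
    have "?c * real n ^ (s - 1) * (dist2 n)\<^sup>2 / sqrt n \<le> g n"
      unfolding g_def by (intro divide_right_mono mult_right_mono stard_order[OF s2 elim]) auto
    moreover have "g n \<le> real n ^ (s - 1) * (dist2 n)\<^sup>2 / sqrt n"
      unfolding g_def by (intro divide_right_mono mult_right_mono stard_order[OF s2 elim]) auto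
    ultimately show ?case unfolding r by simp
  qed
qed

text \<open>\<open>a\<close> and \<open>C\<close> do not depend on \<open>n\<close>. In the error
  term, 1 stands for the n^(1/4) difference of Newton drops and \<open>sqrt (g n)\<close> for the
  linear score term, both divided by the normalisation sqrt n.\<close>

definition coupled_stats :: "real \<Rightarrow> real \<Rightarrow> nat \<Rightarrow> (nat set set \<times> nat set set) pmf \<Rightarrow> bool" where
  "coupled_stats a C n Q \<longleftrightarrow>
    map_pmf fst Q = beta_model n s (\<gamma> n) \<and> map_pmf snd Q = beta_model n s (\<gamma>' n) \<and>
    (\<forall>\<epsilon>>0. measure_pmf.prob Q {z. \<epsilon> < \<bar>T n (snd z) - T n (fst z) - \<kappa> n\<bar>}
      \<le> C / n + C * (1 + sqrt (g n)) / (\<epsilon> * sqrt (sqrt n))) \<and>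
    a * g n \<le> \<kappa> n \<and> \<kappa> n \<le> 2 * real s * g n \<and> a * g n \<le> form n \<and> form n \<le> real s * g n \<and>
    \<bar>\<kappa> n - form n / sqrt 2\<bar> \<le> 3 * real s ^ 2 * dist2 n * g n"

lemma coupled_stats_exist:
  obtains a C Q where "0 < a" "0 \<le> C" "\<forall>\<^sub>F n in sequentially. coupled_stats a C n (Q n)"
proof -
  obtain c where c: "0 < c" "\<forall>\<^sub>F n in sequentially. norm (l2_dist n (\<gamma> n) (\<gamma>' n)) \<le> c * norm (1 :: real)"
    using bounded_dist by (rule landau_o.bigE)
  \<comment> \<open>The Euclidean distance dominates the sup norm, so a bound \<open>c\<close> on it
    extends the bound \<open>M\<close> on \<open>\<gamma>\<close> to a bound for
    \<open>\<gamma>'\<close>.\<close>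
  define K where "K = M + c"
  define m where "m = sigvar_min (real s * (K + 1 + 1))"
  define a where "a = sigvar_min (real s * K)"
  \<comment> \<open>The second entry carries a factor 2 because the threshold for the unnormalised
    ratio, \<epsilon> * sqrt n / sqrt 2, is replaced by the smaller \<epsilon> * sqrt n / 2.\<close>
  define C where "C = max (2 * bad_const s a m) (2 * (compare_const s a c + 40 * real s ^ 4 / (a ^ 4 * m) + sqrt (real s)))"
  have a: "0 < a" and m: "0 < m" unfolding a_def m_def by (rule sigvar_min_pos)+
  have cc0: "0 \<le> compare_const s a c" and bc0: "0 \<le> bad_const s a m"
    unfolding compare_const_def bad_const_def using a m c(1) by (auto intro!: add_nonneg_nonneg mult_nonneg_nonneg divide_nonneg_nonneg)
  have C: "0 \<le> C" "2 * bad_const s a m \<le> C" using bc0 by (auto simp: C_def)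
  have C2: "2 * (compare_const s a c + 40 * real s ^ 4 / (a ^ 4 * m) + sqrt (real s)) \<le> C" by (simp add: C_def)
  let ?coupled = "\<lambda>n Q. map_pmf fst Q = beta_model n s (\<gamma> n) \<and> map_pmf snd Q = beta_model n s (\<gamma>' n) \<and>
      (\<forall>\<epsilon>>0. measure_pmf.prob Q {z. \<epsilon> < \<bar>T n (snd z) - T n (fst z) - \<kappa> n\<bar>}
        \<le> C / n + C * (1 + sqrt (g n)) / (\<epsilon> * sqrt (sqrt n)))"
  let ?bounds = "\<lambda>n. a / 4 * g n \<le> \<kappa> n \<and> \<kappa> n \<le> 2 * real s * g n \<and> a / 4 * g n \<le> form n \<and> form n \<le> real s * g n \<and>
      \<bar>\<kappa> n - form n / sqrt 2\<bar> \<le> 3 * real s ^ 2 * dist2 n * g n"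
  have "\<forall>\<^sub>F n in sequentially. \<exists>Q. coupled_stats (a / 4) C n Q"
    using c(2) eventually_ge_at_top[of "2 * s"]
  proof eventually_elim
    case (elim n)
    have n: "0 < real n" "1 \<le> real n" using elim s2 by auto
    have sym: "l2_dist n (\<gamma> n) (\<gamma>' n) = dist2 n"
      unfolding dist2_def l2_dist_def L2_set_def by (simp add: power2_commute)
    have d: "dist2 n \<le> c" using elim(1) sym dist2_nonneg[of n] by simp
    have b: "\<bar>\<gamma> n v\<bar> \<le> K" if "v \<in> {1..n}" for v using bounded[OF that] c(1) by (simp add: K_def)
    have b': "\<bar>\<gamma>' n v\<bar> \<le> K" if "v \<in> {1..n}" for v
    proof -
      have "\<bar>\<gamma>' n v - \<gamma> n v\<bar> \<le> dist2 n"
        unfolding dist2_def l2_dist_def using abs_le_L2_set[OF _ that, of "\<lambda>v. \<gamma>' n v - \<gamma> n v"] by simp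
      then show ?thesis using bounded[OF that] d by (simp add: K_def)
    qed
    let ?k = "stard n s * (l2_dist n (\<gamma>' n) (\<gamma> n))\<^sup>2"
    have k: "?k = g n * sqrt n" unfolding g_def dist2_def using n by simp
    note sh = shift_bounds[OF s2 elim(2), of "\<gamma> n" K "\<gamma>' n", OF b b', folded a_def, unfolded k]
    have form: "degree_cov_form n s (\<gamma> n) (\<lambda>v. \<gamma>' n v - \<gamma> n v) = form n * sqrt n"
      unfolding form_def using n by simp
    have \<kappa>: "LR_shift n s (\<gamma> n) (\<gamma>' n) = \<kappa> n * sqrt n / sqrt 2"
      unfolding \<kappa>_def using n by simp
    have r2: "1 \<le> sqrt 2" "sqrt 2 \<le> 2" by (auto intro: real_le_lsqrt)
    have kap: "\<kappa> n = sqrt 2 * (LR_shift n s (\<gamma> n) (\<gamma>' n) / sqrt n)" unfolding \<kappa>_def by simp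
    have q1: "a / 4 * g n \<le> LR_shift n s (\<gamma> n) (\<gamma>' n) / sqrt n"
      using sh(1) n by (simp add: pos_le_divide_eq mult.assoc)
    have q2: "LR_shift n s (\<gamma> n) (\<gamma>' n) / sqrt n \<le> real s * g n"
      using sh(2) n by (simp add: pos_divide_le_eq mult.assoc)
    have g0: "0 \<le> a / 4 * g n" using a g_nonneg by simp
    have q0: "0 \<le> LR_shift n s (\<gamma> n) (\<gamma>' n) / sqrt n" using g0 q1 by (rule order_trans)
    have "1 * (a / 4 * g n) \<le> \<kappa> n" unfolding kap using q1 g0 r2 by (intro mult_mono) auto
    moreover have "\<kappa> n \<le> 2 * (real s * g n)"
      unfolding kap by (rule mult_mono[OF r2(2) q2 _ q0]) simp
    moreover have "a / 2 * g n * sqrt n \<le> form n * sqrt n" "form n * sqrt n \<le> real s * g n * sqrt n"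
      using sh(3,4) unfolding form by (simp_all add: mult.assoc)
    then have "a / 2 * g n \<le> form n" "form n \<le> real s * g n" using n by simp_all
    moreover have "\<bar>\<kappa> n - form n / sqrt 2\<bar> \<le> 3 * real s ^ 2 * dist2 n * g n"
    proof -
      let ?B = "3 * real s ^ 2 * dist2 n * g n"
      have "2 * (\<kappa> n * sqrt n / sqrt 2) - form n * sqrt n = (\<kappa> n - form n / sqrt 2) * (sqrt 2 * sqrt n)"
        by (simp add: field_simps)
      then have "\<bar>\<kappa> n - form n / sqrt 2\<bar> * (sqrt 2 * sqrt n) \<le> ?B * sqrt n"
        using sh(5) n unfolding form \<kappa> dist2_def[symmetric] by (simp add: abs_mult mult.assoc)
      then have "\<bar>\<kappa> n - form n / sqrt 2\<bar> * sqrt 2 \<le> ?B" using n by (simp add: mult.assoc[symmetric])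
      moreover have "\<bar>\<kappa> n - form n / sqrt 2\<bar> * 1 \<le> \<bar>\<kappa> n - form n / sqrt 2\<bar> * sqrt 2"
        using r2 by (intro mult_left_mono) auto
      ultimately show ?thesis by simp
    qed
    moreover have "a / 4 * g n \<le> a / 2 * g n" using a g_nonneg by (intro mult_right_mono) auto
    ultimately have bnds: "?bounds n" by simp
    obtain Q where Q: "map_pmf fst Q = beta_model n s (\<gamma> n)" "map_pmf snd Q = beta_model n s (\<gamma>' n)"
      "\<And>u. 0 < u \<Longrightarrow> measure_pmf.prob Q {z. u < \<bar>log_LR n s (\<gamma> n) (bhat n) (snd z) - log_LR n s (\<gamma> n) (bhat n) (fst z) - LR_shift n s (\<gamma> n) (\<gamma>' n)\<bar>}
      \<le> 2 * bad_const s a m / n + (compare_const s a c * sqrt (sqrt n) + 40 * real s ^ 4 / (a ^ 4 * m)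
          + sqrt (real s * stard n s) * dist2 n) / u"
      using LR_coupling[OF s2 elim(2) b b' estimator d[unfolded dist2_def], folded a_def m_def, folded dist2_def] by blast
    have "?coupled n Q"
    proof (intro conjI Q(1,2) allI impI)
      fix \<epsilon> :: real assume \<epsilon>: "0 < \<epsilon>"
      let ?q = "sqrt (sqrt (real n))"
      let ?u = "\<epsilon> * sqrt n / sqrt 2"
      have q: "1 \<le> ?q" "?q * ?q = sqrt n" using n by auto
      have u: "0 < ?u" using \<epsilon> n by simp
      have diff: "T n H' - T n H - \<kappa> n = (log_LR n s (\<gamma> n) (bhat n) H' - log_LR n s (\<gamma> n) (bhat n) H - LR_shift n s (\<gamma> n) (\<gamma>' n)) * (sqrt 2 / sqrt n)" for H H'
      proof -
        have "2 / sqrt (2 * real n) = (sqrt 2 * sqrt 2) / (sqrt 2 * sqrt n)" by (simp add: real_sqrt_mult)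
        also have "\<dots> = sqrt 2 / sqrt n" by (rule mult_divide_mult_cancel_left) simp
        finally have quot: "2 / sqrt (2 * real n) = sqrt 2 / sqrt n" .
        have pull: "2 * z / w = z * (2 / w)" for z w :: real by simp
        have *: "2 * z / sqrt (2 * real n) = z * (sqrt 2 / sqrt n)" for z
          unfolding pull[of z] quot ..
        have "T n H' - T n H = 2 * (log_LR n s (\<gamma> n) (bhat n) H' - log_LR n s (\<gamma> n) (bhat n) H) / sqrt (2 * real n)"
          unfolding LR_stat_def by (simp add: diff_divide_distrib algebra_simps)
        then show ?thesis unfolding * \<kappa>_def by (simp add: algebra_simps)
      qed
      have "{z. \<epsilon> < \<bar>T n (snd z) - T n (fst z) - \<kappa> n\<bar>} =
        {z. ?u < \<bar>log_LR n s (\<gamma> n) (bhat n) (snd z) - log_LR n s (\<gamma> n) (bhat n) (fst z) - LR_shift n s (\<gamma> n) (\<gamma>' n)\<bar>}"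
        unfolding diff abs_mult using n by (auto simp: field_simps)
      then have "measure_pmf.prob Q {z. \<epsilon> < \<bar>T n (snd z) - T n (fst z) - \<kappa> n\<bar>}
        \<le> 2 * bad_const s a m / n + (compare_const s a c * ?q + 40 * real s ^ 4 / (a ^ 4 * m)
          + sqrt (real s * stard n s) * dist2 n) / ?u" using Q(3)[OF u] by simp
      also have "\<dots> \<le> C / n + (C / 2 * (?q * (1 + sqrt (g n)))) / (\<epsilon> * sqrt n / 2)"
      proof (rule add_mono[OF divide_right_mono[OF C(2)] frac_le])
        let ?p1 = "compare_const s a c" and ?p2 = "40 * real s ^ 4 / (a ^ 4 * m)" and ?p3 = "sqrt (real s)"
        have p: "0 \<le> ?p1" "0 \<le> ?p2" "0 \<le> ?p3" using cc0 a m by auto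
        have "sqrt (stard n s) * dist2 n = sqrt (g n * sqrt n)"
          unfolding k[folded dist2_def, symmetric] using dist2_nonneg[of n] by (simp add: real_sqrt_mult)
        then have r: "sqrt (real s * stard n s) * dist2 n = ?p3 * (?q * sqrt (g n))"
          by (simp add: real_sqrt_mult mult_ac)
        have sg: "0 \<le> sqrt (g n)" using g_nonneg by simp
        have qq: "?q \<le> ?q * (1 + sqrt (g n))" "1 \<le> ?q * (1 + sqrt (g n))" "?q * sqrt (g n) \<le> ?q * (1 + sqrt (g n))"
          using q(1) sg mult_mono[of 1 ?q 1 "1 + sqrt (g n)"] by (auto simp: distrib_left)
        have "?p1 * ?q + ?p2 * 1 + ?p3 * (?q * sqrt (g n)) \<le> ?p1 * (?q * (1 + sqrt (g n))) + ?p2 * (?q * (1 + sqrt (g n))) + ?p3 * (?q * (1 + sqrt (g n)))"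
          using p qq by (intro add_mono mult_left_mono) auto
        also have "\<dots> = (?p1 + ?p2 + ?p3) * (?q * (1 + sqrt (g n)))" by (simp add: algebra_simps)
        also have "\<dots> \<le> C / 2 * (?q * (1 + sqrt (g n)))" using C2 qq(2) by (intro mult_right_mono) auto
        finally show "?p1 * ?q + ?p2 + sqrt (real s * stard n s) * dist2 n \<le> C / 2 * (?q * (1 + sqrt (g n)))"
          unfolding r by simp
        show "0 \<le> C / 2 * (?q * (1 + sqrt (g n)))" using C(1) qq(2) by simp
        show "\<epsilon> * sqrt n / 2 \<le> ?u" using r2 \<epsilon> n by (intro divide_left_mono) auto
        show "0 < \<epsilon> * sqrt n / 2" using \<epsilon> n by simp
      qed (use n in auto)
      also have "(C / 2 * (?q * (1 + sqrt (g n)))) / (\<epsilon> * sqrt n / 2) = C * (1 + sqrt (g n)) / (\<epsilon> * ?q)"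
      proof -
        have gen: "(C / 2 * (p * w)) / (\<epsilon> * (p * p) / 2) = C * w / (\<epsilon> * p)" if "0 < p" for p w :: real
          using that \<epsilon> by (simp add: field_simps)
        have "0 < ?q" using q(1) by linarith
        from gen[OF this, of "1 + sqrt (g n)"] show ?thesis unfolding q(2) .
      qed
      finally show "measure_pmf.prob Q {z. \<epsilon> < \<bar>T n (snd z) - T n (fst z) - \<kappa> n\<bar>} \<le> C / n + C * (1 + sqrt (g n)) / (\<epsilon> * ?q)" .
    qed
    then have "coupled_stats (a / 4) C n Q"
      unfolding coupled_stats_def using bnds by - (elim conjE, intro conjI, assumption+)
    then show ?case by (rule exI)
  qed
  then have "\<forall>\<^sub>F n in sequentially. coupled_stats (a / 4) C n (SOME Q. coupled_stats (a / 4) C n Q)"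
    by (rule eventually_mono) (rule someI_ex)
  moreover have "0 < a / 4" using a by simp
  ultimately show ?thesis using C(1) by (intro that)
qed

end

lemma sqrt_sqrt_at_top: "filterlim (\<lambda>n. sqrt (sqrt (real n))) at_top sequentially"
  by (rule filterlim_compose[OF sqrt_at_top filterlim_compose[OF sqrt_at_top filterlim_real_sequentially]])

section \<open>The three regimes of the power\<close>

context LR_setting
begin

text \<open>For bounded \<open>g\<close> the coupling error decays like n^(-1/4). The subsequence is
  there for the critical regime, where \<open>\<kappa>\<close> need not converge along all
  \<open>n\<close>; the identity gives the regime of small distances.\<close>

lemma power_limit_bounded:
  assumes r: "strict_mono r" and g: "\<forall>\<^sub>F k in sequentially. g (r k) \<le> G"
    and \<kappa>: "(\<lambda>k. \<kappa> (r k)) \<longlonglongrightarrow> \<kappa>0"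
  shows "(\<lambda>k. LR_power (r k) s \<alpha> (\<gamma> (r k)) (bhat (r k)) (\<gamma>' (r k)))
    \<longlonglongrightarrow> measure (shifted_normal \<kappa>0) {x. std_normal_quantile (1 - \<alpha> / 2) < \<bar>x\<bar>}"
proof -
  obtain a C Q where a: "0 < a" and C: "0 \<le> C"
    and facts: "\<forall>\<^sub>F n in sequentially. coupled_stats a C n (Q n)"
    by (rule coupled_stats_exist)
  have Q: "\<forall>\<^sub>F n in sequentially.
      map_pmf fst (Q n) = beta_model n s (\<gamma> n) \<and> map_pmf snd (Q n) = beta_model n s (\<gamma>' n) \<and>
      (\<forall>\<epsilon>>0. measure_pmf.prob (Q n) {z. \<epsilon> < \<bar>T n (snd z) - T n (fst z) - \<kappa> n\<bar>}
        \<le> C / n + C * (1 + sqrt (g n)) / (\<epsilon> * sqrt (sqrt n)))"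
    using facts by (rule eventually_mono) (unfold coupled_stats_def, blast)
  have sub: "filterlim r sequentially sequentially" using r by (rule filterlim_subseq)
  note Qr = eventually_compose_filterlim[OF Q sub]
  show ?thesis
    unfolding LR_power_eq
  proof (rule slutsky_pmf[where P = "\<lambda>k. beta_model (r k) s (\<gamma> (r k))" and Q = "\<lambda>k. Q (r k)" and \<kappa> = "\<lambda>k. \<kappa> (r k)"])
    show "\<forall>\<^sub>F k in sequentially. map_pmf fst (Q (r k)) = beta_model (r k) s (\<gamma> (r k)) \<and> map_pmf snd (Q (r k)) = beta_model (r k) s (\<gamma>' (r k))"
      using Qr by (rule eventually_mono) blast
    show "(\<lambda>k. measure_pmf.prob (beta_model (r k) s (\<gamma> (r k))) {H. T (r k) H \<le> y}) \<longlonglongrightarrow> cdf std_normal_distribution y" for y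
      by (rule filterlim_compose[OF null_cdf sub])
    show "(\<lambda>k. \<kappa> (r k)) \<longlonglongrightarrow> \<kappa>0" by (rule \<kappa>)
    fix \<epsilon> :: real assume \<epsilon>: "0 < \<epsilon>"
    have "(\<lambda>n. C / real n + C * (1 + sqrt G) / \<epsilon> / sqrt (sqrt (real n))) \<longlonglongrightarrow> 0 + 0"
      by (intro tendsto_add tendsto_divide_0[OF tendsto_const] filterlim_at_top_imp_at_infinity
          filterlim_real_sequentially sqrt_sqrt_at_top)
    then have lim: "(\<lambda>k. C / real (r k) + C * (1 + sqrt G) / \<epsilon> / sqrt (sqrt (real (r k)))) \<longlonglongrightarrow> 0"
      using filterlim_compose[OF _ sub] by simp
    show "(\<lambda>k. measure_pmf.prob (Q (r k)) {z. \<epsilon> < \<bar>T (r k) (snd z) - T (r k) (fst z) - \<kappa> (r k)\<bar>}) \<longlonglongrightarrow> 0"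
    proof (rule tendsto_sandwich[OF _ _ tendsto_const lim])
      show "\<forall>\<^sub>F k in sequentially. measure_pmf.prob (Q (r k)) {z. \<epsilon> < \<bar>T (r k) (snd z) - T (r k) (fst z) - \<kappa> (r k)\<bar>}
        \<le> C / real (r k) + C * (1 + sqrt G) / \<epsilon> / sqrt (sqrt (real (r k)))"
        using Qr g
      proof eventually_elim
        case (elim k)
        have "C * (1 + sqrt (g (r k))) / (\<epsilon> * sqrt (sqrt (r k))) \<le> C * (1 + sqrt G) / (\<epsilon> * sqrt (sqrt (r k)))"
          using elim(2) C \<epsilon> by (intro divide_right_mono mult_left_mono add_left_mono) auto
        moreover have "measure_pmf.prob (Q (r k)) {z. \<epsilon> < \<bar>T (r k) (snd z) - T (r k) (fst z) - \<kappa> (r k)\<bar>}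
          \<le> C / (r k) + C * (1 + sqrt (g (r k))) / (\<epsilon> * sqrt (sqrt (r k)))"
          using elim(1) \<epsilon> by blast
        ultimately show ?case by simp
      qed
    qed simp
  qed
qed

lemma power_limit_null:
  assumes rate: "rate \<longlonglongrightarrow> 0" and \<alpha>: "0 < \<alpha>" "\<alpha> < 1"
  shows "(\<lambda>n. LR_power n s \<alpha> (\<gamma> n) (bhat n) (\<gamma>' n)) \<longlonglongrightarrow> \<alpha>"
proof -
  obtain a C Q where a: "0 < a" and C: "0 \<le> C"
    and facts: "\<forall>\<^sub>F n in sequentially. coupled_stats a C n (Q n)"
    by (rule coupled_stats_exist)
  have bnd: "\<forall>\<^sub>F n in sequentially. a * g n \<le> \<kappa> n \<and> \<kappa> n \<le> 2 * real s * g n"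
    using facts by (rule eventually_mono) (unfold coupled_stats_def, blast)
  obtain c where gr: "\<forall>\<^sub>F n in sequentially. c * (rate n)\<^sup>2 \<le> g n \<and> g n \<le> (rate n)\<^sup>2"
    using g_rate by blast
  have "(\<lambda>n. (rate n)\<^sup>2) \<longlonglongrightarrow> 0\<^sup>2" by (intro tendsto_power rate)
  then have rate2: "(\<lambda>n. (rate n)\<^sup>2) \<longlonglongrightarrow> 0" by simp
  have g: "g \<longlonglongrightarrow> 0"
  proof (rule tendsto_sandwich[OF _ _ tendsto_const rate2])
    show "\<forall>\<^sub>F n in sequentially. g n \<le> (rate n)\<^sup>2" using gr by (rule eventually_mono) blast
  qed (simp add: g_nonneg)
  have sg: "(\<lambda>n. 2 * real s * g n) \<longlonglongrightarrow> 0" using tendsto_mult_left[OF g, of "2 * real s"] by simp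
  have \<kappa>: "\<kappa> \<longlonglongrightarrow> 0"
  proof (rule tendsto_sandwich[OF _ _ tendsto_const sg])
    show "\<forall>\<^sub>F n in sequentially. 0 \<le> \<kappa> n"
      using bnd
    proof eventually_elim
      case (elim n)
      have "0 \<le> a * g n" using a g_nonneg by simp
      then show ?case using elim by linarith
    qed
    show "\<forall>\<^sub>F n in sequentially. \<kappa> n \<le> 2 * real s * g n" using bnd by (rule eventually_mono) blast
  qed
  have "\<forall>\<^sub>F n in sequentially. g n < 1" using g by (rule order_tendstoD) simp
  then have "\<forall>\<^sub>F n in sequentially. g n \<le> 1" by (rule eventually_mono) simp
  then show ?thesis
    using power_limit_bounded[of "\<lambda>n. n" 1 0 \<alpha>] \<kappa> std_normal_two_sided[OF \<alpha>] by (simp add: strict_mono_def)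
qed

text \<open>With tolerance \<open>\<kappa> n / 2\<close>, which is at least
  \<open>a * g n / 2\<close>, the coupling error is of order 1/n plus
  \<open>(1 + sqrt (g n)) / g n\<close>, and vanishes as \<open>g\<close> diverges.\<close>

lemma power_limit_diverging:
  assumes rate: "filterlim rate at_top sequentially"
  shows "(\<lambda>n. LR_power n s \<alpha> (\<gamma> n) (bhat n) (\<gamma>' n)) \<longlonglongrightarrow> 1"
proof -
  obtain a C Q where a: "0 < a" and C: "0 \<le> C"
    and facts: "\<forall>\<^sub>F n in sequentially. coupled_stats a C n (Q n)"
    by (rule coupled_stats_exist)
  have Q: "\<forall>\<^sub>F n in sequentially.
      map_pmf fst (Q n) = beta_model n s (\<gamma> n) \<and> map_pmf snd (Q n) = beta_model n s (\<gamma>' n) \<and>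
      (\<forall>\<epsilon>>0. measure_pmf.prob (Q n) {z. \<epsilon> < \<bar>T n (snd z) - T n (fst z) - \<kappa> n\<bar>}
        \<le> C / n + C * (1 + sqrt (g n)) / (\<epsilon> * sqrt (sqrt n))) \<and> a * g n \<le> \<kappa> n"
    using facts by (rule eventually_mono) (unfold coupled_stats_def, blast)
  obtain c where c: "0 < c" and gr2: "\<forall>\<^sub>F n in sequentially. c * (rate n)\<^sup>2 \<le> g n \<and> g n \<le> (rate n)\<^sup>2"
    using g_rate by blast
  have gr: "\<forall>\<^sub>F n in sequentially. c * (rate n)\<^sup>2 \<le> g n" using gr2 by (rule eventually_mono) blast
  have "filterlim (\<lambda>n. c * (rate n)\<^sup>2) at_top sequentially"
    by (intro filterlim_tendsto_pos_mult_at_top[OF tendsto_const c] filterlim_pow_at_top rate) simp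
  then have g: "filterlim g at_top sequentially" using gr by (rule filterlim_at_top_mono)
  have "filterlim (\<lambda>n. a * g n) at_top sequentially"
    by (rule filterlim_tendsto_pos_mult_at_top[OF tendsto_const a g])
  then have \<kappa>: "filterlim \<kappa> at_top sequentially"
  proof (rule filterlim_at_top_mono)
    show "\<forall>\<^sub>F n in sequentially. a * g n \<le> \<kappa> n" using Q by (rule eventually_mono) blast
  qed
  have sg: "filterlim (\<lambda>n. sqrt (g n)) at_top sequentially" by (rule filterlim_compose[OF sqrt_at_top g])
  show ?thesis
    unfolding LR_power_eq
  proof (rule diverging_shift_pmf[where P = "\<lambda>n. beta_model n s (\<gamma> n)" and Q = Q and \<kappa> = \<kappa>])
    show "\<forall>\<^sub>F n in sequentially. map_pmf fst (Q n) = beta_model n s (\<gamma> n) \<and> map_pmf snd (Q n) = beta_model n s (\<gamma>' n)"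
      using Q by (rule eventually_mono) blast
    have "(\<lambda>n. C / real n + (2 * C / a / g n + 2 * C / a / sqrt (g n))) \<longlonglongrightarrow> 0 + (0 + 0)"
      by (intro tendsto_add tendsto_divide_0[OF tendsto_const] filterlim_at_top_imp_at_infinity
          filterlim_real_sequentially g sg)
    then have lim: "(\<lambda>n. C / real n + (2 * C / a / g n + 2 * C / a / sqrt (g n))) \<longlonglongrightarrow> 0" by simp
    show "(\<lambda>n. measure_pmf.prob (Q n) {z. \<kappa> n / 2 < \<bar>T n (snd z) - T n (fst z) - \<kappa> n\<bar>}) \<longlonglongrightarrow> 0"
    proof (rule tendsto_sandwich[OF _ _ tendsto_const lim])
      have "\<forall>\<^sub>F n in sequentially. 0 < g n" using g unfolding filterlim_at_top_dense by blast
      then show "\<forall>\<^sub>F n in sequentially. measure_pmf.prob (Q n) {z. \<kappa> n / 2 < \<bar>T n (snd z) - T n (fst z) - \<kappa> n\<bar>}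
        \<le> C / real n + (2 * C / a / g n + 2 * C / a / sqrt (g n))"
        using Q eventually_ge_at_top[of 1]
      proof eventually_elim
        case (elim n)
        have ag: "0 < a * g n" using a elim(1) by simp
        then have \<epsilon>: "0 < \<kappa> n / 2" using elim(2) by linarith
        have q: "1 \<le> sqrt (sqrt (real n))" using elim(3) by simp
        have "a * g n / 2 * 1 \<le> \<kappa> n / 2 * sqrt (sqrt (real n))"
          using elim(2) ag q by (intro mult_mono) auto
        then have "C * (1 + sqrt (g n)) / (\<kappa> n / 2 * sqrt (sqrt n)) \<le> C * (1 + sqrt (g n)) / (a * g n / 2 * 1)"
          using C elim(1) ag \<epsilon> q by (intro divide_left_mono mult_pos_pos mult_nonneg_nonneg) auto
        also have "\<dots> = 2 * C / a / g n + 2 * C / a * (sqrt (g n) / g n)"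
          using a elim(1) by (simp add: field_simps)
        also have "sqrt (g n) / g n = 1 / sqrt (g n)"
          using elim(1) by (simp only: sqrt_divide_self_eq[OF less_imp_le] inverse_eq_divide)
        finally have "C * (1 + sqrt (g n)) / (\<kappa> n / 2 * sqrt (sqrt n)) \<le> 2 * C / a / g n + 2 * C / a * (1 / sqrt (g n))" .
        moreover have "measure_pmf.prob (Q n) {z. \<kappa> n / 2 < \<bar>T n (snd z) - T n (fst z) - \<kappa> n\<bar>}
          \<le> C / n + C * (1 + sqrt (g n)) / (\<kappa> n / 2 * sqrt (sqrt n))"
          using elim(2) \<epsilon> by blast
        ultimately show ?case by simp
      qed
    qed simp
  qed (rule null_cdf \<kappa>)+
qed

text \<open>\<open>form\<close> lies eventually between positive multiples of the squared rate: it
  is bounded, so Bolzano-Weierstrass gives a convergent subsequence, and every subsequential limit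
  is positive.\<close>

lemma power_limit_critical:
  assumes \<tau>: "0 < \<tau>" and rate: "rate \<longlonglongrightarrow> \<tau>"
  shows "\<exists>\<eta>>0. \<exists>r::nat \<Rightarrow> nat. strict_mono r \<and> (\<lambda>k. form (r k)) \<longlonglongrightarrow> \<eta>"
    and "strict_mono r \<Longrightarrow> (\<lambda>k. form (r k)) \<longlonglongrightarrow> \<eta> \<Longrightarrow> 0 < \<eta> \<and>
      (\<lambda>k. LR_power (r k) s \<alpha> (\<gamma> (r k)) (bhat (r k)) (\<gamma>' (r k)))
         \<longlonglongrightarrow> measure (shifted_normal (- \<eta> / sqrt 2)) {x. std_normal_quantile (1 - \<alpha> / 2) < \<bar>x\<bar>}"
proof -
  obtain a C Q where a: "0 < a" and C: "0 \<le> C"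
    and facts: "\<forall>\<^sub>F n in sequentially. coupled_stats a C n (Q n)"
    by (rule coupled_stats_exist)
  have bnd: "\<forall>\<^sub>F n in sequentially. a * g n \<le> form n \<and> form n \<le> real s * g n \<and>
      \<bar>\<kappa> n - form n / sqrt 2\<bar> \<le> 3 * real s ^ 2 * dist2 n * g n"
    using facts by (rule eventually_mono) (unfold coupled_stats_def, blast)
  obtain c where c: "0 < c" and gr: "\<forall>\<^sub>F n in sequentially. c * (rate n)\<^sup>2 \<le> g n \<and> g n \<le> (rate n)\<^sup>2"
    using g_rate by blast
  have rate2: "(\<lambda>n. (rate n)\<^sup>2) \<longlonglongrightarrow> \<tau>\<^sup>2" by (intro tendsto_power rate)
  define G where "G = \<tau>\<^sup>2 + 1"
  have "\<forall>\<^sub>F n in sequentially. (rate n)\<^sup>2 < G" by (rule order_tendstoD(2)[OF rate2]) (simp add: G_def)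
  with gr have gG: "\<forall>\<^sub>F n in sequentially. g n \<le> G" by eventually_elim linarith
  have pos: "0 < \<eta>" if "strict_mono r" "(\<lambda>k. form (r k)) \<longlonglongrightarrow> \<eta>" for \<eta> r
  proof -
    have "\<forall>\<^sub>F n in sequentially. a * (c * (rate n)\<^sup>2) \<le> form n"
      using bnd gr
    proof eventually_elim
      case (elim n)
      have "a * (c * (rate n)\<^sup>2) \<le> a * g n" using elim a by (intro mult_left_mono) auto
      then show ?case using elim by linarith
    qed
    then have ev: "\<forall>\<^sub>F k in sequentially. a * (c * (rate (r k))\<^sup>2) \<le> form (r k)"
      by (rule eventually_compose_filterlim[OF _ filterlim_subseq[OF that(1)]])
    have "(\<lambda>k. a * (c * (rate (r k))\<^sup>2)) \<longlonglongrightarrow> a * (c * \<tau>\<^sup>2)"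
      by (intro tendsto_mult tendsto_const filterlim_compose[OF rate2 filterlim_subseq[OF that(1)]])
    from tendsto_le[OF _ that(2) this ev] have "a * (c * \<tau>\<^sup>2) \<le> \<eta>" by simp
    moreover have "0 < a * (c * \<tau>\<^sup>2)" using a c \<tau> by simp
    ultimately show ?thesis by linarith
  qed
  show "\<exists>\<eta>>0. \<exists>r::nat \<Rightarrow> nat. strict_mono r \<and> (\<lambda>k. form (r k)) \<longlonglongrightarrow> \<eta>"
  proof -
    have "\<forall>\<^sub>F n in sequentially. norm (form n) \<le> real s * G"
      using bnd gG
    proof eventually_elim
      case (elim n)
      have "0 \<le> a * g n" using a g_nonneg by simp
      moreover have "real s * g n \<le> real s * G" using elim by (intro mult_left_mono) auto
      ultimately show ?case using elim by simp
    qed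
    then have "Bseq form" by (rule BfunI)
    then have "bounded (range form)" by (simp add: Bseq_eq_bounded)
    then obtain \<eta>1 r1 where "strict_mono r1" "(form \<circ> r1) \<longlonglongrightarrow> \<eta>1"
      using bounded_imp_convergent_subsequence by blast
    then show ?thesis
      using pos unfolding comp_def by blast
  qed
  assume r: "strict_mono r" and \<eta>: "(\<lambda>k. form (r k)) \<longlonglongrightarrow> \<eta>"
  have sub: "filterlim r sequentially sequentially" using r by (rule filterlim_subseq)
  \<comment> \<open>For s at least 2 the exponent (2s-3)/4 is positive, so a convergent rescaled
    distance forces the distance itself to zero. This removes the third-order gap between
    \<open>\<kappa>\<close> and \<open>form / sqrt 2\<close>.\<close>
  have dist0: "dist2 \<longlonglongrightarrow> 0"
  proof -
    have "(\<lambda>n. rate n * real n powr (- ((2 * real s - 3) / 4))) \<longlonglongrightarrow> \<tau> * 0"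
      using s2 by (intro tendsto_mult rate tendsto_neg_powr filterlim_real_sequentially) auto
    moreover have "\<forall>\<^sub>F n in sequentially. rate n * real n powr (- ((2 * real s - 3) / 4)) = dist2 n"
      using eventually_ge_at_top[of 1]
    proof eventually_elim
      case (elim n)
      have "real n powr ((2 * real s - 3) / 4) * real n powr (- ((2 * real s - 3) / 4)) = 1"
        using elim by (simp add: powr_minus)
      then show ?case unfolding rate_def by (simp add: mult_ac)
    qed
    ultimately have "dist2 \<longlonglongrightarrow> \<tau> * 0" by (rule Lim_transform_eventually)
    then show ?thesis by simp
  qed
  have "(\<lambda>n. 3 * real s ^ 2 * dist2 n * G) \<longlonglongrightarrow> 3 * real s ^ 2 * 0 * G"
    by (intro tendsto_mult tendsto_const dist0)
  then have lim0: "(\<lambda>n. 3 * real s ^ 2 * dist2 n * G) \<longlonglongrightarrow> 0" by simp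
  have "(\<lambda>n. \<kappa> n - form n / sqrt 2) \<longlonglongrightarrow> 0"
  proof (rule Lim_null_comparison[OF _ lim0])
    show "\<forall>\<^sub>F n in sequentially. norm (\<kappa> n - form n / sqrt 2) \<le> 3 * real s ^ 2 * dist2 n * G"
      using bnd gG
    proof eventually_elim
      case (elim n)
      have "3 * real s ^ 2 * dist2 n * g n \<le> 3 * real s ^ 2 * dist2 n * G"
        using elim dist2_nonneg[of n] by (intro mult_left_mono) auto
      then show ?case using elim by simp
    qed
  qed
  then have "(\<lambda>k. \<kappa> (r k) - form (r k) / sqrt 2) \<longlonglongrightarrow> 0" by (rule filterlim_compose[OF _ sub])
  moreover have "(\<lambda>k. form (r k) / sqrt 2) \<longlonglongrightarrow> \<eta> / sqrt 2" by (intro tendsto_divide \<eta> tendsto_const) simp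
  ultimately have "(\<lambda>k. (\<kappa> (r k) - form (r k) / sqrt 2) + form (r k) / sqrt 2) \<longlonglongrightarrow> 0 + \<eta> / sqrt 2"
    by (rule tendsto_add)
  then have \<kappa>: "(\<lambda>k. \<kappa> (r k)) \<longlonglongrightarrow> \<eta> / sqrt 2" by simp
  have "\<forall>\<^sub>F k in sequentially. g (r k) \<le> G" by (rule eventually_compose_filterlim[OF gG sub])
  \<comment> \<open>The shift is upwards, to mean \<open>\<eta> / sqrt 2\<close>; the two-sided
    rejection region is symmetric, so the sign of the mean can be reversed.\<close>
  from power_limit_bounded[OF r this \<kappa>, of \<alpha>]
  have "(\<lambda>k. LR_power (r k) s \<alpha> (\<gamma> (r k)) (bhat (r k)) (\<gamma>' (r k)))
         \<longlonglongrightarrow> measure (shifted_normal (- \<eta> / sqrt 2)) {x. std_normal_quantile (1 - \<alpha> / 2) < \<bar>x\<bar>}"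
    unfolding shifted_normal_symmetric[of "\<eta> / sqrt 2"] minus_divide_left .
  with pos[OF r \<eta>] show "0 < \<eta> \<and> (\<lambda>k. LR_power (r k) s \<alpha> (\<gamma> (r k)) (bhat (r k)) (\<gamma>' (r k)))
         \<longlonglongrightarrow> measure (shifted_normal (- \<eta> / sqrt 2)) {x. std_normal_quantile (1 - \<alpha> / 2) < \<bar>x\<bar>}"
    by (rule conjI)
qed

end

theorem theorem3p2:
  fixes s :: nat and M \<alpha> :: real
    and \<gamma> \<gamma>' :: "nat \<Rightarrow> nat \<Rightarrow> real"
    and bhat :: "nat \<Rightarrow> nat set set \<Rightarrow> nat \<Rightarrow> real"
  assumes "s \<ge> 2" and "M > 0" and "0 < \<alpha>" and "\<alpha> < 1"
    and "\<And>n. \<gamma> n \<in> vecs n" and "\<And>n v. v \<in> {1..n} \<Longrightarrow> \<bar>\<gamma> n v\<bar> \<le> M"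
    and "\<And>n. mle_estimator n s (bhat n)"
    and "weak_conv_m
           (\<lambda>n. distr (measure_pmf (beta_model n s (\<gamma> n))) borel (LR_stat n s (\<gamma> n) (bhat n)))
           std_normal_distribution"
    and "\<And>n. \<gamma>' n \<in> vecs n" and "\<And>n. n \<ge> 1 \<Longrightarrow> \<gamma>' n \<noteq> \<gamma> n"
    and "(\<lambda>n. l2_dist n (\<gamma> n) (\<gamma>' n)) \<in> O(\<lambda>_. 1)"
  shows "((\<lambda>n. l2_dist n (\<gamma>' n) (\<gamma> n) / real n powr (- ((2 * real s - 3) / 4))) \<longlonglongrightarrow> 0
            \<longrightarrow> (\<lambda>n. LR_power n s \<alpha> (\<gamma> n) (bhat n) (\<gamma>' n)) \<longlonglongrightarrow> \<alpha>)
       \<and> (filterlim (\<lambda>n. l2_dist n (\<gamma>' n) (\<gamma> n) / real n powr (- ((2 * real s - 3) / 4)))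
             at_top sequentially
            \<longrightarrow> (\<lambda>n. LR_power n s \<alpha> (\<gamma> n) (bhat n) (\<gamma>' n)) \<longlonglongrightarrow> 1)
       \<and> (\<forall>\<tau>>0. (\<lambda>n. real n powr ((2 * real s - 3) / 4) * l2_dist n (\<gamma>' n) (\<gamma> n)) \<longlonglongrightarrow> \<tau>
            \<longrightarrow> (\<exists>\<eta>>0. \<exists>r::nat \<Rightarrow> nat. strict_mono r \<and>
                   (\<lambda>k. degree_cov_form (r k) s (\<gamma> (r k)) (\<lambda>v. \<gamma>' (r k) v - \<gamma> (r k) v)
                          / sqrt (real (r k))) \<longlonglongrightarrow> \<eta>)
              \<and> (\<forall>\<eta>. \<forall>r::nat \<Rightarrow> nat. strict_mono r \<longrightarrow>
                   (\<lambda>k. degree_cov_form (r k) s (\<gamma> (r k)) (\<lambda>v. \<gamma>' (r k) v - \<gamma> (r k) v)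
                          / sqrt (real (r k))) \<longlonglongrightarrow> \<eta>
                   \<longrightarrow> 0 < \<eta> \<and>
                     (\<lambda>k. LR_power (r k) s \<alpha> (\<gamma> (r k)) (bhat (r k)) (\<gamma>' (r k)))
                       \<longlonglongrightarrow> measure (density lborel (normal_density (- \<eta> / sqrt 2) 1))
                             {x. \<bar>x\<bar> > std_normal_quantile (1 - \<alpha> / 2)}))"
proof -
  interpret LR_setting s M \<gamma> \<gamma>' bhat
    by unfold_locales (fact assms)+
  have rate: "rate = (\<lambda>n. l2_dist n (\<gamma>' n) (\<gamma> n) / real n powr (- ((2 * real s - 3) / 4)))"
    "rate = (\<lambda>n. real n powr ((2 * real s - 3) / 4) * l2_dist n (\<gamma>' n) (\<gamma> n))"
  proof -
    \<comment> \<open>Also true for \<open>p = 0\<close>, as \<open>inverse 0 = 0\<close>, so both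
      forms of the rate agree at every index, including \<open>n = 0\<close>.\<close>
    have "w / inverse p = p * w" for w p :: real by (simp add: divide_inverse mult.commute)
    then show "rate = (\<lambda>n. l2_dist n (\<gamma>' n) (\<gamma> n) / real n powr (- ((2 * real s - 3) / 4)))"
      unfolding rate_def[abs_def] dist2_def[abs_def] powr_minus by (simp only:)
  qed (simp only: rate_def[abs_def] dist2_def[abs_def])
  have form: "(\<lambda>k. degree_cov_form (r k) s (\<gamma> (r k)) (\<lambda>v. \<gamma>' (r k) v - \<gamma> (r k) v) / sqrt (real (r k)))
    = (\<lambda>k. form (r k))" for r :: "nat \<Rightarrow> nat"
    unfolding form_def ..
  show ?thesis
    unfolding form rate(1)[symmetric] rate(2)[symmetric]
  proof (intro conjI impI allI)
    show "(\<lambda>n. LR_power n s \<alpha> (\<gamma> n) (bhat n) (\<gamma>' n)) \<longlonglongrightarrow> \<alpha>" if "rate \<longlonglongrightarrow> 0"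
      by (rule power_limit_null[OF that assms(3,4)])
    show "(\<lambda>n. LR_power n s \<alpha> (\<gamma> n) (bhat n) (\<gamma>' n)) \<longlonglongrightarrow> 1" if "filterlim rate at_top sequentially"
      by (rule power_limit_diverging[OF that])
    fix \<tau> :: real assume \<tau>: "0 < \<tau>" "rate \<longlonglongrightarrow> \<tau>"
    show "\<exists>\<eta>>0. \<exists>r. strict_mono r \<and> (\<lambda>k. form (r k)) \<longlonglongrightarrow> \<eta>"
      by (rule power_limit_critical(1)[OF \<tau>])
    fix \<eta> :: real and r :: "nat \<Rightarrow> nat" assume r: "strict_mono r" "(\<lambda>k. form (r k)) \<longlonglongrightarrow> \<eta>"
    note lim = power_limit_critical(2)[OF \<tau> r, of \<alpha>]
    show "0 < \<eta>" using lim by (rule conjunct1)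
    show "(\<lambda>k. LR_power (r k) s \<alpha> (\<gamma> (r k)) (bhat (r k)) (\<gamma>' (r k)))
      \<longlonglongrightarrow> measure (density lborel (normal_density (- \<eta> / sqrt 2) 1)) {x. \<bar>x\<bar> > std_normal_quantile (1 - \<alpha> / 2)}"
      using lim by (rule conjunct2)
  qed
qed

end
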